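(* Let $\delta>0$ and $V:\mathbb{Z}\to\mathbb{R}$ be such that $\Delta^{\!\delta} V$ is everywhere positive and bounded, and $$\Lambda:=\sup_{\kappa\in\mathbb{Z}}\frac{\big(\Delta^{\!\delta}[(\Delta^{\!\delta} V)^2]\big)_\kappa}{(\Delta^{\!\delta} V)_\kappa}<\infty.$$ Then the semigroup $\mathfrak{S}$ on $\mathcal{P}^\delta_{2,c}$ generated by the system $\dot\rho_\kappa=\big(\Delta^{\!\delta}(\rho\,\Delta^{\!\delta} V)\big)_\kappa$, $\kappa\in\mathbb{Z}$, is $(-\Lambda)$-contractive with respect to the energy $\mathcal{E}(\rho)=-\delta\sum_\kappa V_\kappa\rho_\kappa$.
   Context: Fix $\delta>0$. For $f:\mathbb{Z}\to\mathbb{R}$, $(\Delta^{\!\delta} f)_\kappa=(f_{\kappa+1}+f_{\kappa-1}-2f_\kappa)/\delta^2$; products and squares of grid functions are pointwise. $\mathcal{P}^\delta_{2,c}$ is the set of $\rho:\mathbb{Z}\to[0,\infty)$ with $\delta\sum_\kappa\rho_\kappa=1$, $\delta\sum_\kappa(\delta\kappa)^2\rho_\kappa<\infty$, $\delta\sum_\kappa(\delta\kappa)\rho_\kappa=0$. Define $Q(p,r)=p^2/r$ if $r>0$, $Q(0,0)=0$, $Q(p,0)=+\infty$ if $p\ne0$. $\mathcal{C}(\rho^0,\rho^1)$ is the set of pairs $(\rho,\mathfrak{w})$, $\rho:[0,1]\to\mathcal{P}^\delta_{2,c}$, $\mathfrak{w}:[0,1]\to\ell^2$, with $\rho(0)=\rho^0$,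 $\rho(1)=\rho^1$, $\rho_\kappa\in H^1(0,1)$, $\mathfrak{w}_\kappa\in L^2(0,1)$ and $\dot\rho_\kappa=(\Delta^{\!\delta}\mathfrak{w})_\kappa$ a.e., for each $\kappa$. The distance is ${\mathbb{D}}^\delta(\rho^0,\rho^1)^2=\inf_{\mathcal{C}(\rho^0,\rho^1)}\delta\sum_\kappa\int_0^1Q(\mathfrak{w}_\kappa(s),\rho_\kappa(s))\,ds$. A semigroup $\mathfrak{S}$ on $\mathcal{P}^\delta_{2,c}$ is $\lambda$-contractive with respect to $\mathcal{E}$ if for all $\bar\rho,\bar\eta\in\mathcal{P}^\delta_{2,c}$ with ${\mathbb{D}}^\delta(\bar\rho,\bar\eta)<\infty$ the evolution variational inequality $$\limsup_{t\downarrow0}\frac{{\mathbb{D}}^\delta(\mathfrak{S}^t\bar\rho,\bar\eta)^2-{\mathbb{D}}^\delta(\bar\rho,\bar\eta)^2}{2t}+\frac\lambda2{\mathbb{D}}^\delta(\bar\rho,\bar\eta)^2\le\mathcal{E}(\bar\eta)-\mathcal{E}(\bar\rho)$$ holds. *)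

theory Defs
  imports "HOL-Analysis.Analysis"
begin

definition dlap :: "real \<Rightarrow> (int \<Rightarrow> real) \<Rightarrow> int \<Rightarrow> real" where
  "dlap \<delta> f \<kappa> = (f (\<kappa> + 1) + f (\<kappa> - 1) - 2 * f \<kappa>) / \<delta>\<^sup>2"

definition P2c :: "real \<Rightarrow> (int \<Rightarrow> real) set" where
  "P2c \<delta> = {\<rho>. (\<forall>\<kappa>. 0 \<le> \<rho> \<kappa>)
      \<and> ((\<lambda>\<kappa>. \<delta> * \<rho> \<kappa>) has_sum 1) UNIV
      \<and> (\<lambda>\<kappa>. \<delta> * (\<delta> * real_of_int \<kappa>)\<^sup>2 * \<rho> \<kappa>) summable_on UNIV
      \<and> ((\<lambda>\<kappa>. \<delta> * (\<delta> * real_of_int \<kappa>) * \<rho> \<kappa>) has_sum 0) UNIV}"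

definition Qact :: "real \<Rightarrow> real \<Rightarrow> ennreal" where
  "Qact p r = (if r > 0 then ennreal (p\<^sup>2 / r) else if p = 0 then 0 else top)"

definition L2_01 :: "(real \<Rightarrow> real) \<Rightarrow> bool" where
  "L2_01 g \<longleftrightarrow> set_borel_measurable lborel {0..1} g
      \<and> set_integrable lborel {0..1} (\<lambda>s. (g s)\<^sup>2)"

text \<open>g is the weak derivative of f on (0,1), f being identified with its
  absolutely continuous representative on [0,1].\<close>
definition weak_deriv_01 :: "(real \<Rightarrow> real) \<Rightarrow> (real \<Rightarrow> real) \<Rightarrow> bool" where
  "weak_deriv_01 f g \<longleftrightarrow> set_integrable lborel {0..1} g
      \<and> (\<forall>t\<in>{0..1}. f t = f 0 + (LINT s:{0..t}|lborel. g s))"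

definition H1_01 :: "(real \<Rightarrow> real) \<Rightarrow> bool" where
  "H1_01 f \<longleftrightarrow> (\<exists>g. L2_01 g \<and> weak_deriv_01 f g)"

definition adm_curves :: "real \<Rightarrow> (int \<Rightarrow> real) \<Rightarrow> (int \<Rightarrow> real)
      \<Rightarrow> ((real \<Rightarrow> int \<Rightarrow> real) \<times> (real \<Rightarrow> int \<Rightarrow> real)) set" where
  "adm_curves \<delta> \<rho>0 \<rho>1 = {(\<rho>, w).
      (\<forall>s\<in>{0..1}. \<rho> s \<in> P2c \<delta>)
    \<and> (\<forall>s\<in>{0..1}. (\<lambda>\<kappa>. (w s \<kappa>)\<^sup>2) summable_on UNIV)
    \<and> \<rho> 0 = \<rho>0 \<and> \<rho> 1 = \<rho>1
    \<and> (\<forall>\<kappa>. H1_01 (\<lambda>s. \<rho> s \<kappa>))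
    \<and> (\<forall>\<kappa>. L2_01 (\<lambda>s. w s \<kappa>))
    \<and> (\<forall>\<kappa>. weak_deriv_01 (\<lambda>s. \<rho> s \<kappa>) (\<lambda>s. dlap \<delta> (w s) \<kappa>))}"

definition action :: "real \<Rightarrow> (real \<Rightarrow> int \<Rightarrow> real) \<Rightarrow> (real \<Rightarrow> int \<Rightarrow> real) \<Rightarrow> ennreal" where
  "action \<delta> \<rho> w = ennreal \<delta> *
     (\<integral>\<^sup>+ \<kappa>. (\<integral>\<^sup>+ s\<in>{0..1}. Qact (w s \<kappa>) (\<rho> s \<kappa>) \<partial>lborel) \<partial>count_space UNIV)"

text \<open>Squared distance D^\<delta>(\<rho>0,\<rho>1)^2 (= \<infinity> if there is no admissible curve).\<close>
definition Dsq :: "real \<Rightarrow> (int \<Rightarrow> real) \<Rightarrow> (int \<Rightarrow> real) \<Rightarrow> ennreal" where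
  "Dsq \<delta> \<rho>0 \<rho>1 = (INF c\<in>adm_curves \<delta> \<rho>0 \<rho>1. action \<delta> (fst c) (snd c))"

definition energy :: "real \<Rightarrow> (int \<Rightarrow> real) \<Rightarrow> (int \<Rightarrow> real) \<Rightarrow> real" where
  "energy \<delta> V \<rho> = - \<delta> * (\<Sum>\<^sub>\<infinity>\<kappa>. V \<kappa> * \<rho> \<kappa>)"

definition generated_semigroup :: "real \<Rightarrow> (int \<Rightarrow> real)
      \<Rightarrow> (real \<Rightarrow> (int \<Rightarrow> real) \<Rightarrow> (int \<Rightarrow> real)) \<Rightarrow> bool" where
  "generated_semigroup \<delta> V S \<longleftrightarrow> (\<forall>\<rho>\<in>P2c \<delta>.
       S 0 \<rho> = \<rho>
     \<and> (\<forall>t\<ge>0. S t \<rho> \<in> P2c \<delta>)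
     \<and> (\<forall>t\<ge>0. \<forall>\<kappa>. ((\<lambda>s. S s \<rho> \<kappa>) has_real_derivative
            dlap \<delta> (\<lambda>j. S t \<rho> j * dlap \<delta> V j) \<kappa>) (at t within {0..})))"

text \<open>\<lambda>-contractivity via the evolution variational inequality.\<close>
definition lambda_contractive :: "real \<Rightarrow> real \<Rightarrow> ((int \<Rightarrow> real) \<Rightarrow> real)
      \<Rightarrow> (real \<Rightarrow> (int \<Rightarrow> real) \<Rightarrow> (int \<Rightarrow> real)) \<Rightarrow> bool" where
  "lambda_contractive \<delta> lam E S \<longleftrightarrow> (\<forall>\<rho>\<in>P2c \<delta>. \<forall>\<eta>\<in>P2c \<delta>. Dsq \<delta> \<rho> \<eta> < top \<longrightarrow>
      Limsup (at_right 0)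
        (\<lambda>t. (enn2ereal (Dsq \<delta> (S t \<rho>) \<eta>) - enn2ereal (Dsq \<delta> \<rho> \<eta>)) / ereal (2 * t))
      + ereal (lam / 2 * enn2real (Dsq \<delta> \<rho> \<eta>))
      \<le> ereal (E \<eta> - E \<rho>))"

end

theory Submission
  imports Defs
begin

text \<open>With \<open>a = \<Delta> V\<close>, the flow \<open>\<rho>' = \<Delta> (a \<rho>)\<close> and its dual \<open>v' = a \<Delta> v\<close> satisfy
  \<open>exp (\<tau> \<Delta> a) \<Delta> = \<Delta> exp (\<tau> a \<Delta>)\<close>. Uniformization writes both semigroups as Poisson mixtures
  of the powers of one-step operators with nonnegative coefficients. Joint convexity and homogeneity
  of \<open>Q\<close> show that one step of size \<open>h\<close> multiplies \<open>\<Sum> Q(v, \<rho>)\<close> by at most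
  \<open>1 - 2 h a / \<delta>\<^sup>2 + (h / \<delta>\<^sup>2) (a\<^sub>+\<^sup>2 + a\<^sub>-\<^sup>2) / a = 1 + h \<Delta> (a\<^sup>2) / a\<close>, so time \<open>\<tau>\<close> costs at
  most a factor \<open>exp (\<Lambda> \<tau>)\<close>.

  Given an almost minimal curve \<open>(\<rho>, w)\<close> from \<open>\<rho>0\<close> to \<open>\<eta>\<close>, the curve
  \<open>s \<mapsto> exp ((1 - s) t \<Delta> a) \<rho>\<^sub>s\<close> connects the evolved measure with \<open>\<eta>\<close> and has flux
  \<open>exp ((1 - s) t a \<Delta>) w\<^sub>s - t a \<rho>\<^sub>s\<^sup>t\<close>. Expanding the square, its action is at most
  \<open>exp (\<Lambda> t) D\<^sup>2 - 2 t \<delta> \<integral> \<Sum> a w + O(t\<^sup>2)\<close>, and \<open>\<delta> \<integral> \<Sum> a w\<close> is the energy difference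
  by summation by parts. Here \<open>\<Lambda> \<ge> 0\<close>, since otherwise \<open>a\<^sup>2\<close> would be strictly concave and
  nonnegative on the integers.\<close>

section \<open>Convexity of the action integrand\<close>

text \<open>The semigroup is given only by differentiability at each site, so it must first be
  matched with the explicit Poisson series. One Duhamel formula, for
  \<open>s \<mapsto> fflow \<alpha> ((1 - s) * R) (x s)\<close>, does this and also gives the
  continuity equation of the evolved curve: along an orbit the source vanishes, along a general
  curve it becomes the Laplacian of the new flux once Laplacian and flows are interchanged. The
  matching in turn supplies mass, barycentre and second moment of the evolved curve, which the
  series does not show. Bounded rates allow uniformization, and the growth estimate becomes Jensen's
  inequality with nonnegative weights; \<open>Q\<close>, singular where the density vanishes, is
  never differentiated. The evolution time \<open>(1 - s) * t\<close> vanishes at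
  \<open>s = 1\<close>, which keeps \<eta> fixed, and its derivative \<open>- t\<close> produces the
  correction flux. Replacing the evolved flux by \<open>w\<close> in the cross term costs O(t) in
  the summable norm, and the prefactor \<open>t\<close> makes this second order. The factor
  \<open>exp (\<Lambda> * (1 - s) * t)\<close> is replaced by \<open>exp (\<Lambda> * t)\<close>,
  which uses \<Lambda> \<ge> 0.\<close>

lemma Qact_le_iff:
  assumes "0 \<le> r"
  shows "Qact p r \<le> X \<longleftrightarrow> (\<forall>y. ennreal (2 * p * y - r * y\<^sup>2) \<le> X)"
proof (cases "r = 0")
  case False
  with assms have r: "r > 0" by simp
  \<comment> \<open>Completing the square. \<open>Q\<close> is the supremum over \<open>y\<close> of
    functions linear in \<open>(p, r)\<close>, and the convexity statements below are read off from
    this form. At \<open>r = 0\<close> the supremum is infinite unless \<open>p = 0\<close>, which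
    reproduces the conventions of \<open>Qact\<close>.\<close>
  have 1: "2 * p * y - r * y\<^sup>2 \<le> p\<^sup>2 / r" for y
  proof -
    have "p\<^sup>2 / r - (2 * p * y - r * y\<^sup>2) = (p - r * y)\<^sup>2 / r"
      using r by (simp add: field_simps power2_eq_square)
    moreover have "(p - r * y)\<^sup>2 / r \<ge> 0" using r by simp
    ultimately show ?thesis by linarith
  qed
  \<comment> \<open>The maximizer is \<open>y = p / r\<close>.\<close>
  have 2: "2 * p * (p / r) - r * (p / r)\<^sup>2 = p\<^sup>2 / r"
    using r by (simp add: field_simps power2_eq_square)
  show ?thesis
  proof -
    have "Qact p r = ennreal (2 * p * (p / r) - r * (p / r)\<^sup>2)" using r 2 by (simp add: Qact_def)
    moreover have "ennreal (2 * p * y - r * y\<^sup>2) \<le> Qact p r" for y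
      using 1[of y] r by (simp add: Qact_def ennreal_leI)
    ultimately show ?thesis by (metis order_trans)
  qed
next
  case True
  show ?thesis
  proof (cases "p = 0")
    case False
    have "X = top" if *: "\<forall>y. ennreal (2 * p * y) \<le> X"
    proof (rule ccontr)
      assume "X \<noteq> top"
      then obtain x where x: "0 \<le> x" "X = ennreal x" by (cases X) auto
      \<comment> \<open>This \<open>y\<close> makes \<open>2 * p * y\<close> equal to
        \<open>x + 1\<close>, beyond the supposed finite bound \<open>x\<close>.\<close>
      have "ennreal (2 * p * ((x + 1) / (2 * p))) \<le> X" using * by blast
      with False x show False by (simp add: ennreal_le_iff)
    qed
    then show ?thesis using True False by (auto simp: Qact_def top_unique)
  qed (use True in \<open>simp add: Qact_def\<close>)
qed

lemma Qact_ge: "0 \<le> r \<Longrightarrow> ennreal (2 * p * y - r * y\<^sup>2) \<le> Qact p r"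
  using Qact_le_iff by blast

text \<open>Negative terms are truncated to 0 on the right before they are added, so the bound holds
  for all signs; the expressions in the dual form of \<open>Qact\<close> have no fixed sign.\<close>

lemma ennreal_add_le: "ennreal (u + v) \<le> ennreal u + ennreal v"
proof -
  have "ennreal (u + v) \<le> ennreal (max 0 u + max 0 v)" by (intro ennreal_leI) auto
  also have "\<dots> = ennreal u + ennreal v" by (simp add: max_def ennreal_neg)
  finally show ?thesis .
qed

lemma Qact_subadd:
  assumes "0 \<le> r" "0 \<le> r'"
  shows "Qact (p + p') (r + r') \<le> Qact p r + Qact p' r'"
proof (subst Qact_le_iff)
  show "\<forall>y. ennreal (2 * (p + p') * y - (r + r') * y\<^sup>2) \<le> Qact p r + Qact p' r'"
  proof
    fix y
    have "ennreal (2 * (p + p') * y - (r + r') * y\<^sup>2)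
        = ennreal ((2 * p * y - r * y\<^sup>2) + (2 * p' * y - r' * y\<^sup>2))"
      by (simp add: algebra_simps)
    also have "\<dots> \<le> ennreal (2 * p * y - r * y\<^sup>2) + ennreal (2 * p' * y - r' * y\<^sup>2)"
      by (rule ennreal_add_le)
    also have "\<dots> \<le> Qact p r + Qact p' r'"
      using assms by (intro add_mono Qact_ge)
    finally show "ennreal (2 * (p + p') * y - (r + r') * y\<^sup>2) \<le> Qact p r + Qact p' r'" .
  qed
qed (use assms in simp)

text \<open>The two factors differ on purpose: the dual step weights the flux of a neighbour with
  the rate at \<kappa>, the forward step weights its mass with the rate at the neighbour. The
  quotient \<open>l\<^sup>2 / m\<close> is what later assembles into the growth rate.\<close>

lemma Qact_scale:
  assumes "0 < l" "0 < m"
  shows "Qact (l * p) (m * r) = ennreal (l\<^sup>2 / m) * Qact p r"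
proof (cases "r > 0")
  case True
  have "ennreal ((l * p)\<^sup>2 / (m * r)) = ennreal (l\<^sup>2 / m * (p\<^sup>2 / r))"
    by (simp add: power_mult_distrib)
  also have "\<dots> = ennreal (l\<^sup>2 / m) * ennreal (p\<^sup>2 / r)"
    using True assms by (intro ennreal_mult) auto
  finally show ?thesis using True assms by (simp add: Qact_def)
next
  case False
  then have "\<not> m * r > 0" using assms by (simp add: zero_less_mult_iff)
  then show ?thesis using False assms by (auto simp: Qact_def ennreal_mult_top)
qed

lemma Qact_scale_same:
  assumes "0 \<le> m"
  shows "Qact (m * p) (m * r) = ennreal m * Qact p r"
proof (cases "m = 0")
  case False
  with assms have "m > 0" by simp
  then show ?thesis using Qact_scale[of m m p r] by (simp add: power2_eq_square)
qed (simp add: Qact_def)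

text \<open>Jensen's inequality for countable mixtures, in the homogeneous form that subadditivity
  and scaling give. For fixed \<open>y\<close> the dual expression is linear and passes to the limit
  of the partial sums, so the possible value infinity of \<open>Qact\<close> causes no
  trouble.\<close>

lemma Qact_suminf:
  assumes r: "\<And>n. 0 \<le> r n" and c: "\<And>n::nat. 0 \<le> c n"
    and sp: "summable (\<lambda>n. c n * p n)" and sr: "summable (\<lambda>n. c n * r n)"
  shows "Qact (\<Sum>n. c n * p n) (\<Sum>n. c n * r n) \<le> (\<Sum>n. ennreal (c n) * Qact (p n) (r n))"
proof (subst Qact_le_iff)
  show "0 \<le> (\<Sum>n. c n * r n)" using r c sr by (intro suminf_nonneg) auto
  show "\<forall>y. ennreal (2 * (\<Sum>n. c n * p n) * y - (\<Sum>n. c n * r n) * y\<^sup>2)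
      \<le> (\<Sum>n. ennreal (c n) * Qact (p n) (r n))" (is "\<forall>y. _ \<le> ?X")
  proof
    fix y
    have "(\<lambda>n. 2 * y * (c n * p n) - y\<^sup>2 * (c n * r n)) sums
        (2 * y * (\<Sum>n. c n * p n) - y\<^sup>2 * (\<Sum>n. c n * r n))"
      by (intro sums_diff sums_mult summable_sums sp sr)
    then have "(\<lambda>N. ennreal (\<Sum>n<N. 2 * y * (c n * p n) - y\<^sup>2 * (c n * r n))) \<longlonglongrightarrow>
        ennreal (2 * y * (\<Sum>n. c n * p n) - y\<^sup>2 * (\<Sum>n. c n * r n))"
      unfolding sums_def by (rule tendsto_ennrealI)
    moreover have "ennreal (\<Sum>n<N. 2 * y * (c n * p n) - y\<^sup>2 * (c n * r n)) \<le> ?X" for N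
    proof -
      have sub: "ennreal (\<Sum>n<N. 2 * y * (c n * p n) - y\<^sup>2 * (c n * r n)) \<le> (\<Sum>n<N. ennreal (c n) * Qact (p n) (r n))"
      proof (induction N)
        case (Suc N)
        have "ennreal (2 * y * (c N * p N) - y\<^sup>2 * (c N * r N))
            = ennreal (c N) * ennreal (2 * p N * y - r N * y\<^sup>2)"
          unfolding ennreal_mult'[OF c[of N], symmetric] by (simp add: algebra_simps)
        also have "\<dots> \<le> ennreal (c N) * Qact (p N) (r N)"
          using r by (intro mult_left_mono Qact_ge) auto
        finally have *: "ennreal (2 * y * (c N * p N) - y\<^sup>2 * (c N * r N)) \<le> ennreal (c N) * Qact (p N) (r N)" .
        from order_trans[OF ennreal_add_le add_mono[OF Suc *]] show ?case by simp
      qed simp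
      also have "\<dots> \<le> ?X" by (intro sum_le_suminf) auto
      finally show ?thesis .
    qed
    ultimately have "ennreal (2 * y * (\<Sum>n. c n * p n) - y\<^sup>2 * (\<Sum>n. c n * r n)) \<le> ?X"
      by (intro LIMSEQ_le_const2) auto
    then show "ennreal (2 * (\<Sum>n. c n * p n) * y - (\<Sum>n. c n * r n) * y\<^sup>2) \<le> ?X"
      by (simp add: mult.commute mult.left_commute mult.assoc)
  qed
qed

lemma Qact_measurable [measurable]:
  assumes [measurable]: "f \<in> borel_measurable M" "g \<in> borel_measurable M"
  shows "(\<lambda>x. Qact (f x) (g x)) \<in> borel_measurable M"
  unfolding Qact_def by measurable

section \<open>The uniformized semigroup and its dual\<close>

text \<open>\<open>fstep \<alpha>\<close> and \<open>bstep \<alpha>\<close> are the explicit Euler steps of \<open>\<rho>' = \<Delta> (a \<rho>)\<close> and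
  \<open>v' = a \<Delta> v\<close> with \<open>\<alpha> = a / A\<close>, \<open>A\<close> an upper bound of \<open>a\<close>, and step size \<open>\<delta>\<^sup>2 / (2 A)\<close>.
  Hence \<open>fflow \<alpha> r\<close> and \<open>bflow \<alpha> r\<close> are the semigroups at time \<open>r \<delta>\<^sup>2 / (2 A)\<close>.\<close>

definition fstep :: "(int \<Rightarrow> real) \<Rightarrow> (int \<Rightarrow> real) \<Rightarrow> int \<Rightarrow> real" where
  "fstep \<alpha> f \<kappa> = (1 - \<alpha> \<kappa>) * f \<kappa> + (\<alpha> (\<kappa> + 1) * f (\<kappa> + 1) + \<alpha> (\<kappa> - 1) * f (\<kappa> - 1)) / 2"

definition bstep :: "(int \<Rightarrow> real) \<Rightarrow> (int \<Rightarrow> real) \<Rightarrow> int \<Rightarrow> real" where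
  "bstep \<alpha> w \<kappa> = (1 - \<alpha> \<kappa>) * w \<kappa> + \<alpha> \<kappa> * (w (\<kappa> + 1) + w (\<kappa> - 1)) / 2"

definition pois :: "nat \<Rightarrow> real \<Rightarrow> real" where
  "pois n r = exp (- r) * (r ^ n / fact n)"

definition fflow :: "(int \<Rightarrow> real) \<Rightarrow> real \<Rightarrow> (int \<Rightarrow> real) \<Rightarrow> int \<Rightarrow> real" where
  "fflow \<alpha> r f \<kappa> = (\<Sum>n. pois n r * (fstep \<alpha> ^^ n) f \<kappa>)"

definition bflow :: "(int \<Rightarrow> real) \<Rightarrow> real \<Rightarrow> (int \<Rightarrow> real) \<Rightarrow> int \<Rightarrow> real" where
  "bflow \<alpha> r f \<kappa> = (\<Sum>n. pois n r * (bstep \<alpha> ^^ n) f \<kappa>)"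

lemma pois_nonneg: "0 \<le> r \<Longrightarrow> 0 \<le> pois n r"
  by (simp add: pois_def)

text \<open>The generating function of the Poisson law. It is used at \<open>x = 1\<close> for the
  total mass, at \<open>x = 2\<close> for the crude growth of the iterates and at
  \<open>x = L\<close> for the action.\<close>

lemma pois_power_sums: "(\<lambda>n. pois n r * x ^ n) sums exp (r * (x - 1))"
proof -
  have "(\<lambda>n. exp (- r) * ((r * x) ^ n /\<^sub>R fact n)) sums (exp (- r) * exp (r * x))"
    by (intro sums_mult exp_converges)
  then show ?thesis
    by (simp add: pois_def exp_add[symmetric] algebra_simps power_mult_distrib divide_inverse)
qed

lemma pois_sums_1: "(\<lambda>n. pois n r) sums 1"
  using pois_power_sums[of r 1] by simp

lemma pois_0 [simp]: "pois n 0 = (if n = 0 then 1 else 0)"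
  by (simp add: pois_def)

lemma summable_pois_bound:
  assumes "0 \<le> r" "\<And>n. \<bar>f n\<bar> \<le> C * x ^ n"
  shows "summable (\<lambda>n. pois n r * f n)"
proof (rule summable_comparison_test')
  show "summable (\<lambda>n. C * (pois n r * x ^ n))"
    using pois_power_sums[of r x] by (intro summable_mult) (auto simp: sums_iff)
  show "norm (pois n r * f n) \<le> C * (pois n r * x ^ n)" for n
    using mult_left_mono[OF assms(2)[of n] pois_nonneg[OF assms(1), of n]]
    by (simp add: abs_mult pois_nonneg assms(1) mult_ac)
qed

text \<open>Write \<open>D\<close> for the second difference and \<open>h = 1/2\<close>. Then
  \<open>bstep\<close> is \<open>1 + h \<alpha> D\<close>, \<open>fstep\<close> is
  \<open>1 + h D \<alpha>\<close>, and \<open>D (1 + h \<alpha> D) = (1 + h D \<alpha>) D\<close>.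
  This is the discrete source of the continuity equation for evolved curves.\<close>

lemma dlap_bstep: "dlap \<delta> (bstep \<alpha> w) = fstep \<alpha> (dlap \<delta> w)"
proof
  fix \<kappa>
  have *: "(((1 - a1) * w1 + a1 * (w2 + w0) / 2) + ((1 - am) * wm + am * (w0 + wmm) / 2)
        - 2 * ((1 - a0) * w0 + a0 * (w1 + wm) / 2)) / d
      = (1 - a0) * ((w1 + wm - 2 * w0) / d)
        + (a1 * ((w2 + w0 - 2 * w1) / d) + am * ((w0 + wmm - 2 * wm) / d)) / 2"
    for a1 am a0 w0 w1 w2 wm wmm d :: real
    by (cases "d = 0") (simp, simp add: field_simps)
  show "dlap \<delta> (bstep \<alpha> w) \<kappa> = fstep \<alpha> (dlap \<delta> w) \<kappa>"
    using *[of "\<alpha> (\<kappa>+1)" "w (\<kappa>+1)" "w (\<kappa>+1+1)" "w \<kappa>" "\<alpha> (\<kappa>-1)" "w (\<kappa>-1)" "w (\<kappa>-1-1)" "\<alpha> \<kappa>" "\<delta>\<^sup>2"]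
    unfolding dlap_def bstep_def fstep_def add_diff_cancel_right' diff_add_cancel .
qed

lemma dlap_bstep_pow: "dlap \<delta> ((bstep \<alpha> ^^ n) w) = (fstep \<alpha> ^^ n) (dlap \<delta> w)"
  by (induction n) (simp_all add: dlap_bstep)

text \<open>The companion identity
  \<open>(1 + h \<alpha> D) \<alpha> = \<alpha> (1 + h D \<alpha>)\<close>, with \<open>D\<close>
  the second difference. It turns the transported source into the correction
  \<open>t a \<rho>\<close> of the new flux.\<close>

lemma bstep_mult: "bstep \<alpha> (\<lambda>j. k * \<alpha> j * f j) = (\<lambda>j. k * \<alpha> j * fstep \<alpha> f j)"
  by (auto simp: bstep_def fstep_def fun_eq_iff algebra_simps)

lemma bstep_pow_mult: "(bstep \<alpha> ^^ n) (\<lambda>j. k * \<alpha> j * f j) = (\<lambda>j. k * \<alpha> j * (fstep \<alpha> ^^ n) f j)"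
  by (induction n) (simp_all add: bstep_mult)

lemma bstep_lin: "bstep \<alpha> (\<lambda>j. f j - k * g j) = (\<lambda>j. bstep \<alpha> f j - k * bstep \<alpha> g j)"
  by (simp add: bstep_def fun_eq_iff) (simp add: field_simps)

lemma bstep_pow_lin:
  "(bstep \<alpha> ^^ n) (\<lambda>j. f j - k * g j) = (\<lambda>j. (bstep \<alpha> ^^ n) f j - k * (bstep \<alpha> ^^ n) g j)"
  by (induction n) (simp_all add: bstep_lin)

lemma fstep_lin: "fstep \<alpha> (\<lambda>j. f j - k * g j) = (\<lambda>j. fstep \<alpha> f j - k * fstep \<alpha> g j)"
  by (simp add: fstep_def fun_eq_iff) (simp add: field_simps)

lemma fstep_pow_lin:
  "(fstep \<alpha> ^^ n) (\<lambda>j. f j - k * g j) = (\<lambda>j. (fstep \<alpha> ^^ n) f j - k * (fstep \<alpha> ^^ n) g j)"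
  by (induction n) (simp_all add: fstep_lin)

text \<open>The upper bound makes the diagonal coefficient \<open>1 - \<alpha> \<kappa>\<close>
  nonnegative, hence both steps positive operators; strict positivity matters because the action
  estimate divides by neighbouring rates.\<close>

locale rates =
  fixes \<alpha> :: "int \<Rightarrow> real"
  assumes pos: "\<And>\<kappa>. 0 < \<alpha> \<kappa>" and le1: "\<And>\<kappa>. \<alpha> \<kappa> \<le> 1"
begin

lemma fstep_nonneg: "(\<And>\<kappa>. 0 \<le> f \<kappa>) \<Longrightarrow> 0 \<le> fstep \<alpha> f \<kappa>"
  unfolding fstep_def
  by (intro add_nonneg_nonneg mult_nonneg_nonneg divide_nonneg_pos)
     (simp_all add: le1 less_imp_le[OF pos])

lemma fstep_pow_nonneg: "(\<And>\<kappa>. 0 \<le> f \<kappa>) \<Longrightarrow> 0 \<le> (fstep \<alpha> ^^ n) f \<kappa>"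
  by (induction n arbitrary: \<kappa>) (simp, simp, rule fstep_nonneg)

text \<open>The coefficients in one row add up to at most 2 and in general not to 1, since the
  forward step preserves mass rather than constants. A factor 2 per step is harmless against the
  factorials of the Poisson weights.\<close>

lemma fstep_bound:
  assumes "\<And>\<kappa>. \<bar>f \<kappa>\<bar> \<le> C"
  shows "\<bar>fstep \<alpha> f \<kappa>\<bar> \<le> 2 * C"
proof -
  have m: "\<bar>x * f j\<bar> \<le> x * C" if "0 \<le> x" for x j
    using that assms[of j] by (simp add: abs_mult mult_left_mono)
  have C: "0 \<le> C" using assms[of 0] by linarith
  have *: "\<bar>x + (y + z) / 2\<bar> \<le> x' + (y' + z') / 2"
    if "\<bar>x\<bar> \<le> x'" "\<bar>y\<bar> \<le> y'" "\<bar>z\<bar> \<le> z'" for x y z x' y' z' :: real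
    using that by (simp add: abs_le_iff field_simps)
  have "\<bar>fstep \<alpha> f \<kappa>\<bar> \<le> (1 - \<alpha> \<kappa>) * C + (\<alpha> (\<kappa> + 1) * C + \<alpha> (\<kappa> - 1) * C) / 2"
    unfolding fstep_def using m[of "1 - \<alpha> \<kappa>" \<kappa>] m[of "\<alpha> (\<kappa>+1)" "\<kappa>+1"] m[of "\<alpha> (\<kappa>-1)" "\<kappa>-1"]
      less_imp_le[OF pos[of "\<kappa>+1"]] less_imp_le[OF pos[of "\<kappa>-1"]] le1[of \<kappa>]
    by (intro *) auto
  also have "\<dots> \<le> 1 * C + (1 * C + 1 * C) / 2"
    using pos[of \<kappa>] le1 C by (intro add_mono mult_right_mono divide_right_mono) (auto simp: less_imp_le)
  finally show ?thesis by simp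
qed

lemma fstep_pow_bound:
  assumes "\<And>\<kappa>. \<bar>f \<kappa>\<bar> \<le> C"
  shows "\<bar>(fstep \<alpha> ^^ n) f \<kappa>\<bar> \<le> C * 2 ^ n"
proof (induction n arbitrary: \<kappa>)
  case (Suc n)
  show ?case using fstep_bound[of "(fstep \<alpha> ^^ n) f", OF Suc] by (simp add: mult_ac)
qed (simp add: assms)

text \<open>A row of the dual step is a convex combination of three values, so here the supremum
  norm does not grow.\<close>

lemma bstep_bound:
  assumes "\<And>\<kappa>. \<bar>f \<kappa>\<bar> \<le> C"
  shows "\<bar>bstep \<alpha> f \<kappa>\<bar> \<le> C"
proof -
  have m: "\<bar>x * y\<bar> \<le> x * C" if "0 \<le> x" "\<bar>y\<bar> \<le> C" for x y
    using that by (simp add: abs_mult mult_left_mono)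
  have "\<bar>(f (\<kappa> + 1) + f (\<kappa> - 1)) / 2\<bar> \<le> C" using assms[of "\<kappa>+1"] assms[of "\<kappa>-1"] by (simp add: abs_le_iff)
  then have "\<bar>bstep \<alpha> f \<kappa>\<bar> \<le> (1 - \<alpha> \<kappa>) * C + \<alpha> \<kappa> * C"
    unfolding bstep_def times_divide_eq_right[symmetric]
    using m[of "1 - \<alpha> \<kappa>" "f \<kappa>"] m[of "\<alpha> \<kappa>" "(f (\<kappa> + 1) + f (\<kappa> - 1)) / 2"] assms[of \<kappa>] pos[of \<kappa>] le1[of \<kappa>]
    by (intro order_trans[OF abs_triangle_ineq] add_mono) auto
  then show ?thesis by (simp add: algebra_simps)
qed

lemma bstep_pow_bound:
  assumes "\<And>\<kappa>. \<bar>f \<kappa>\<bar> \<le> C"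
  shows "\<bar>(bstep \<alpha> ^^ n) f \<kappa>\<bar> \<le> C"
  by (induction n arbitrary: \<kappa>) (simp add: assms, simp, rule bstep_bound)

lemma fflow_summable:
  assumes "0 \<le> r" "\<And>\<kappa>. \<bar>f \<kappa>\<bar> \<le> C"
  shows "summable (\<lambda>n. pois n r * (fstep \<alpha> ^^ n) f \<kappa>)"
  using assms by (intro summable_pois_bound[of r _ C 2]) (auto intro: fstep_pow_bound)

lemma bflow_summable:
  assumes "0 \<le> r" "\<And>\<kappa>. \<bar>f \<kappa>\<bar> \<le> C"
  shows "summable (\<lambda>n. pois n r * (bstep \<alpha> ^^ n) f \<kappa>)"
  using assms by (intro summable_pois_bound[of r _ C 1]) (auto intro: bstep_pow_bound)

text \<open>Only three sites enter \<open>dlap\<close>, so the identity for one step passes through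
  the Poisson series term by term.\<close>

lemma dlap_bflow:
  assumes "0 \<le> r" "\<And>\<kappa>. \<bar>w \<kappa>\<bar> \<le> C"
  shows "dlap \<delta> (bflow \<alpha> r w) \<kappa> = fflow \<alpha> r (dlap \<delta> w) \<kappa>"
proof -
  note s = summable_sums[OF bflow_summable[OF assms]]
  have "(\<lambda>n. (pois n r * (bstep \<alpha> ^^ n) w (\<kappa> + 1) + pois n r * (bstep \<alpha> ^^ n) w (\<kappa> - 1)
        - 2 * (pois n r * (bstep \<alpha> ^^ n) w \<kappa>)) / \<delta>\<^sup>2) sums dlap \<delta> (bflow \<alpha> r w) \<kappa>"
    unfolding dlap_def bflow_def by (intro sums_divide sums_diff sums_add sums_mult s)
  also have "(\<lambda>n. (pois n r * (bstep \<alpha> ^^ n) w (\<kappa> + 1) + pois n r * (bstep \<alpha> ^^ n) w (\<kappa> - 1)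
        - 2 * (pois n r * (bstep \<alpha> ^^ n) w \<kappa>)) / \<delta>\<^sup>2)
      = (\<lambda>n. pois n r * (fstep \<alpha> ^^ n) (dlap \<delta> w) \<kappa>)"
    unfolding dlap_bstep_pow[symmetric] by (rule ext) (simp add: dlap_def divide_inverse algebra_simps)
  finally show ?thesis unfolding fflow_def by (simp add: sums_iff)
qed

lemma bflow_diff_mult:
  assumes "0 \<le> r" "\<And>\<kappa>. \<bar>w \<kappa>\<bar> \<le> C" "\<And>\<kappa>. \<bar>f \<kappa>\<bar> \<le> C'"
  shows "bflow \<alpha> r (\<lambda>j. w j - k * \<alpha> j * f j) \<kappa> = bflow \<alpha> r w \<kappa> - k * \<alpha> \<kappa> * fflow \<alpha> r f \<kappa>"
proof -
  have "(\<lambda>n. pois n r * (bstep \<alpha> ^^ n) w \<kappa> - k * \<alpha> \<kappa> * (pois n r * (fstep \<alpha> ^^ n) f \<kappa>))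
     sums (bflow \<alpha> r w \<kappa> - k * \<alpha> \<kappa> * fflow \<alpha> r f \<kappa>)"
    unfolding bflow_def fflow_def
    by (intro sums_diff sums_mult summable_sums bflow_summable[OF assms(1,2)] fflow_summable[OF assms(1,3)])
  then show ?thesis
    using bstep_pow_lin[of _ \<alpha> w 1 "\<lambda>j. k * \<alpha> j * f j"]
    unfolding bflow_def[of _ _ "\<lambda>j. w j - k * \<alpha> j * f j"]
    by (simp add: bstep_pow_mult sums_iff right_diff_distrib mult.left_commute)
qed

end

lemma nn_integral_int_shift:
  fixes f :: "int \<Rightarrow> ennreal"
  shows "(\<integral>\<^sup>+ \<kappa>. f (\<kappa> + k) \<partial>count_space UNIV) = (\<integral>\<^sup>+ \<kappa>. f \<kappa> \<partial>count_space UNIV)"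
  by (rule nn_integral_bij_count_space) (rule bij_betwI[of _ _ _ "\<lambda>x. x - k"]; simp)

section \<open>Growth of the action under the two flows\<close>

context rates
begin

text \<open>Both arguments collect contributions from the same three sites. From
  \<open>\<kappa> + 1\<close> the flux arrives with factor \<open>\<alpha> \<kappa> / 2\<close> and
  the mass with factor \<open>\<alpha> (\<kappa> + 1) / 2\<close>, and \<open>Qact_scale\<close>
  turns this pair into the coefficient.\<close>

lemma Qact_step_le:
  assumes \<rho>: "\<And>\<kappa>. 0 \<le> \<rho> \<kappa>"
  shows "Qact (bstep \<alpha> w \<kappa>) (fstep \<alpha> \<rho> \<kappa>) \<le> ennreal (1 - \<alpha> \<kappa>) * Qact (w \<kappa>) (\<rho> \<kappa>)
     + (ennreal ((\<alpha> \<kappa>)\<^sup>2 / (2 * \<alpha> (\<kappa> + 1))) * Qact (w (\<kappa> + 1)) (\<rho> (\<kappa> + 1))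
     + ennreal ((\<alpha> \<kappa>)\<^sup>2 / (2 * \<alpha> (\<kappa> - 1))) * Qact (w (\<kappa> - 1)) (\<rho> (\<kappa> - 1)))"
proof -
  have sc: "Qact (\<alpha> \<kappa> / 2 * w j) (\<alpha> j / 2 * \<rho> j) = ennreal ((\<alpha> \<kappa>)\<^sup>2 / (2 * \<alpha> j)) * Qact (w j) (\<rho> j)" for j
    using Qact_scale[of "\<alpha> \<kappa> / 2" "\<alpha> j / 2" "w j" "\<rho> j"] pos[of \<kappa>] pos[of j]
    by (simp add: power2_eq_square field_simps)
  have nn: "0 \<le> \<alpha> j / 2 * \<rho> j" for j
    using \<rho>[of j] pos[of j] by simp
  have "Qact (bstep \<alpha> w \<kappa>) (fstep \<alpha> \<rho> \<kappa>)
      = Qact ((1 - \<alpha> \<kappa>) * w \<kappa> + (\<alpha> \<kappa> / 2 * w (\<kappa> + 1) + \<alpha> \<kappa> / 2 * w (\<kappa> - 1)))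
          ((1 - \<alpha> \<kappa>) * \<rho> \<kappa> + (\<alpha> (\<kappa> + 1) / 2 * \<rho> (\<kappa> + 1) + \<alpha> (\<kappa> - 1) / 2 * \<rho> (\<kappa> - 1)))"
    unfolding bstep_def fstep_def by (simp add: add_divide_distrib distrib_left)
  also have "\<dots> \<le> Qact ((1 - \<alpha> \<kappa>) * w \<kappa>) ((1 - \<alpha> \<kappa>) * \<rho> \<kappa>)
     + (Qact (\<alpha> \<kappa> / 2 * w (\<kappa> + 1)) (\<alpha> (\<kappa> + 1) / 2 * \<rho> (\<kappa> + 1)) + Qact (\<alpha> \<kappa> / 2 * w (\<kappa> - 1)) (\<alpha> (\<kappa> - 1) / 2 * \<rho> (\<kappa> - 1)))"
    using nn \<rho> le1[of \<kappa>]
    by (intro order_trans[OF Qact_subadd] add_left_mono Qact_subadd add_nonneg_nonneg) auto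
  finally show ?thesis unfolding sc using le1[of \<kappa>] by (simp add: Qact_scale_same)
qed

text \<open>After a shift of the summation index, everything that site \<kappa> contributes to
  itself and to its two neighbours is gathered into one coefficient, which is the left side of the
  assumption on \<open>L\<close>.\<close>

lemma action_step:
  assumes \<rho>: "\<And>\<kappa>. 0 \<le> \<rho> \<kappa>"
    and L: "\<And>\<kappa>. 1 - \<alpha> \<kappa> + ((\<alpha> (\<kappa> + 1))\<^sup>2 + (\<alpha> (\<kappa> - 1))\<^sup>2) / (2 * \<alpha> \<kappa>) \<le> L"
  shows "(\<integral>\<^sup>+ \<kappa>. Qact (bstep \<alpha> w \<kappa>) (fstep \<alpha> \<rho> \<kappa>) \<partial>count_space UNIV)
     \<le> ennreal L * (\<integral>\<^sup>+ \<kappa>. Qact (w \<kappa>) (\<rho> \<kappa>) \<partial>count_space UNIV)"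
proof -
  let ?q = "\<lambda>\<kappa>. Qact (w \<kappa>) (\<rho> \<kappa>)"
  have "(\<integral>\<^sup>+ \<kappa>. Qact (bstep \<alpha> w \<kappa>) (fstep \<alpha> \<rho> \<kappa>) \<partial>count_space UNIV)
    \<le> (\<integral>\<^sup>+ \<kappa>. ennreal (1 - \<alpha> \<kappa>) * ?q \<kappa>
     + (ennreal ((\<alpha> \<kappa>)\<^sup>2 / (2 * \<alpha> (\<kappa> + 1))) * ?q (\<kappa> + 1)
     + ennreal ((\<alpha> \<kappa>)\<^sup>2 / (2 * \<alpha> (\<kappa> - 1))) * ?q (\<kappa> - 1)) \<partial>count_space UNIV)"
    by (intro nn_integral_mono Qact_step_le \<rho>)
  also have "\<dots> = (\<integral>\<^sup>+ \<kappa>. ennreal (1 - \<alpha> \<kappa>) * ?q \<kappa> \<partial>count_space UNIV)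
     + ((\<integral>\<^sup>+ \<kappa>. ennreal ((\<alpha> \<kappa>)\<^sup>2 / (2 * \<alpha> (\<kappa> + 1))) * ?q (\<kappa> + 1) \<partial>count_space UNIV)
     + (\<integral>\<^sup>+ \<kappa>. ennreal ((\<alpha> \<kappa>)\<^sup>2 / (2 * \<alpha> (\<kappa> - 1))) * ?q (\<kappa> - 1) \<partial>count_space UNIV))"
    by (simp add: nn_integral_add)
  also have "\<dots> = (\<integral>\<^sup>+ \<kappa>. ennreal (1 - \<alpha> \<kappa>) * ?q \<kappa> \<partial>count_space UNIV)
     + ((\<integral>\<^sup>+ \<kappa>. ennreal ((\<alpha> (\<kappa> - 1))\<^sup>2 / (2 * \<alpha> \<kappa>)) * ?q \<kappa> \<partial>count_space UNIV)
     + (\<integral>\<^sup>+ \<kappa>. ennreal ((\<alpha> (\<kappa> + 1))\<^sup>2 / (2 * \<alpha> \<kappa>)) * ?q \<kappa> \<partial>count_space UNIV))"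
    using nn_integral_int_shift[of "\<lambda>\<kappa>. ennreal ((\<alpha> (\<kappa> - 1))\<^sup>2 / (2 * \<alpha> \<kappa>)) * ?q \<kappa>" 1]
      nn_integral_int_shift[of "\<lambda>\<kappa>. ennreal ((\<alpha> (\<kappa> + 1))\<^sup>2 / (2 * \<alpha> \<kappa>)) * ?q \<kappa>" "-1"]
    by simp
  also have "\<dots> = (\<integral>\<^sup>+ \<kappa>. (ennreal (1 - \<alpha> \<kappa>) + (ennreal ((\<alpha> (\<kappa> - 1))\<^sup>2 / (2 * \<alpha> \<kappa>))
      + ennreal ((\<alpha> (\<kappa> + 1))\<^sup>2 / (2 * \<alpha> \<kappa>)))) * ?q \<kappa> \<partial>count_space UNIV)"
    by (simp add: nn_integral_add distrib_right)
  also have "\<dots> \<le> (\<integral>\<^sup>+ \<kappa>. ennreal L * ?q \<kappa> \<partial>count_space UNIV)"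
  proof (intro nn_integral_mono mult_right_mono)
    fix \<kappa>
    have "ennreal (1 - \<alpha> \<kappa>) + (ennreal ((\<alpha> (\<kappa> - 1))\<^sup>2 / (2 * \<alpha> \<kappa>)) + ennreal ((\<alpha> (\<kappa> + 1))\<^sup>2 / (2 * \<alpha> \<kappa>)))
       = ennreal (1 - \<alpha> \<kappa> + ((\<alpha> (\<kappa> + 1))\<^sup>2 + (\<alpha> (\<kappa> - 1))\<^sup>2) / (2 * \<alpha> \<kappa>))"
      using le1[of \<kappa>] less_imp_le[OF pos[of \<kappa>]] by (simp add: add_divide_distrib ac_simps)
    also have "\<dots> \<le> ennreal L" by (rule ennreal_leI[OF L])
    finally show "ennreal (1 - \<alpha> \<kappa>) + (ennreal ((\<alpha> (\<kappa> - 1))\<^sup>2 / (2 * \<alpha> \<kappa>)) + ennreal ((\<alpha> (\<kappa> + 1))\<^sup>2 / (2 * \<alpha> \<kappa>)))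
      \<le> ennreal L" .
  qed simp
  finally show ?thesis by (simp add: nn_integral_cmult)
qed

lemma action_step_pow:
  assumes \<rho>: "\<And>\<kappa>. 0 \<le> \<rho> \<kappa>" and "0 \<le> L"
    and L: "\<And>\<kappa>. 1 - \<alpha> \<kappa> + ((\<alpha> (\<kappa> + 1))\<^sup>2 + (\<alpha> (\<kappa> - 1))\<^sup>2) / (2 * \<alpha> \<kappa>) \<le> L"
  shows "(\<integral>\<^sup>+ \<kappa>. Qact ((bstep \<alpha> ^^ n) w \<kappa>) ((fstep \<alpha> ^^ n) \<rho> \<kappa>) \<partial>count_space UNIV)
     \<le> ennreal (L ^ n) * (\<integral>\<^sup>+ \<kappa>. Qact (w \<kappa>) (\<rho> \<kappa>) \<partial>count_space UNIV)"
proof (induction n)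
  case (Suc n)
  have "(\<integral>\<^sup>+ \<kappa>. Qact ((bstep \<alpha> ^^ Suc n) w \<kappa>) ((fstep \<alpha> ^^ Suc n) \<rho> \<kappa>) \<partial>count_space UNIV)
     \<le> ennreal L * (\<integral>\<^sup>+ \<kappa>. Qact ((bstep \<alpha> ^^ n) w \<kappa>) ((fstep \<alpha> ^^ n) \<rho> \<kappa>) \<partial>count_space UNIV)"
    using action_step[OF fstep_pow_nonneg[OF \<rho>] L] by simp
  also have "\<dots> \<le> ennreal L * (ennreal (L ^ n) * (\<integral>\<^sup>+ \<kappa>. Qact (w \<kappa>) (\<rho> \<kappa>) \<partial>count_space UNIV))"
    by (intro mult_left_mono Suc) simp
  finally show ?case using \<open>0 \<le> L\<close> by (simp add: ennreal_mult mult.assoc)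
qed simp

text \<open>Jensen over the Poisson weights leaves the Poisson mean of \<open>L ^ n\<close>, which
  is \<open>exp (r * (L - 1))\<close>: the growth factor of a step becomes an exponential
  rate.\<close>

lemma action_flow:
  assumes \<rho>: "\<And>\<kappa>. 0 \<le> \<rho> \<kappa>" and "0 \<le> L" and r: "0 \<le> r"
    and L: "\<And>\<kappa>. 1 - \<alpha> \<kappa> + ((\<alpha> (\<kappa> + 1))\<^sup>2 + (\<alpha> (\<kappa> - 1))\<^sup>2) / (2 * \<alpha> \<kappa>) \<le> L"
    and "\<And>\<kappa>. \<bar>w \<kappa>\<bar> \<le> C" "\<And>\<kappa>. \<bar>\<rho> \<kappa>\<bar> \<le> C'"
  shows "(\<integral>\<^sup>+ \<kappa>. Qact (bflow \<alpha> r w \<kappa>) (fflow \<alpha> r \<rho> \<kappa>) \<partial>count_space UNIV)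
     \<le> ennreal (exp (r * (L - 1))) * (\<integral>\<^sup>+ \<kappa>. Qact (w \<kappa>) (\<rho> \<kappa>) \<partial>count_space UNIV)" (is "_ \<le> _ * ?F")
proof -
  have "(\<integral>\<^sup>+ \<kappa>. Qact (bflow \<alpha> r w \<kappa>) (fflow \<alpha> r \<rho> \<kappa>) \<partial>count_space UNIV)
    \<le> (\<integral>\<^sup>+ \<kappa>. (\<Sum>n. ennreal (pois n r) * Qact ((bstep \<alpha> ^^ n) w \<kappa>) ((fstep \<alpha> ^^ n) \<rho> \<kappa>)) \<partial>count_space UNIV)"
    unfolding bflow_def fflow_def
    by (intro nn_integral_mono Qact_suminf fstep_pow_nonneg \<rho> pois_nonneg r bflow_summable[OF r assms(5)]
        fflow_summable[OF r assms(6)])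
  also have "\<dots> = (\<Sum>n. ennreal (pois n r) * (\<integral>\<^sup>+ \<kappa>. Qact ((bstep \<alpha> ^^ n) w \<kappa>) ((fstep \<alpha> ^^ n) \<rho> \<kappa>) \<partial>count_space UNIV))"
    by (simp add: nn_integral_suminf nn_integral_cmult)
  also have "\<dots> \<le> (\<Sum>n. ennreal (pois n r) * (ennreal (L ^ n) * ?F))"
    by (intro suminf_le mult_left_mono action_step_pow assms) auto
  also have "\<dots> = (\<Sum>n. ennreal (pois n r * L ^ n)) * ?F"
    using \<open>0 \<le> L\<close> r by (simp add: ennreal_mult pois_nonneg mult.assoc flip: ennreal_suminf_multc)
  also have "(\<Sum>n. ennreal (pois n r * L ^ n)) = ennreal (exp (r * (L - 1)))"
    using pois_power_sums[of r L] \<open>0 \<le> L\<close> r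
    by (subst suminf_ennreal2) (auto simp: pois_nonneg sums_iff)
  finally show ?thesis .
qed

section \<open>Closeness of the dual flow to the identity in the summable norm\<close>

lemma bstep_l1:
  "(\<integral>\<^sup>+ \<kappa>. ennreal \<bar>bstep \<alpha> w \<kappa>\<bar> \<partial>count_space UNIV) \<le> 2 * (\<integral>\<^sup>+ \<kappa>. ennreal \<bar>w \<kappa>\<bar> \<partial>count_space UNIV)"
proof -
  have p: "ennreal \<bar>bstep \<alpha> w \<kappa>\<bar> \<le> ennreal \<bar>w \<kappa>\<bar> + (ennreal (1/2) * ennreal \<bar>w (\<kappa> + 1)\<bar> + ennreal (1/2) * ennreal \<bar>w (\<kappa> + -1)\<bar>)" for \<kappa>
  proof -
    have "\<bar>bstep \<alpha> w \<kappa>\<bar> \<le> \<bar>(1 - \<alpha> \<kappa>) * w \<kappa>\<bar> + \<bar>\<alpha> \<kappa> * ((w (\<kappa> + 1) + w (\<kappa> - 1)) / 2)\<bar>"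
      unfolding bstep_def times_divide_eq_right[symmetric] by (rule abs_triangle_ineq)
    also have "\<dots> \<le> \<bar>w \<kappa>\<bar> + \<bar>(w (\<kappa> + 1) + w (\<kappa> - 1)) / 2\<bar>"
      using pos[of \<kappa>] le1[of \<kappa>] by (intro add_mono) (auto simp: abs_mult intro!: mult_left_le_one_le)
    also have "\<dots> \<le> \<bar>w \<kappa>\<bar> + (1/2 * \<bar>w (\<kappa> + 1)\<bar> + 1/2 * \<bar>w (\<kappa> + -1)\<bar>)" by simp
    finally show ?thesis
      by (metis (mono_tags, opaque_lifting) abs_ge_zero add_nonneg_nonneg ennreal_leI ennreal_mult ennreal_plus half_gt_zero_iff less_imp_le mult_nonneg_nonneg zero_less_one)
  qed
  have "(\<integral>\<^sup>+ \<kappa>. ennreal \<bar>bstep \<alpha> w \<kappa>\<bar> \<partial>count_space UNIV)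
     \<le> (\<integral>\<^sup>+ \<kappa>. ennreal \<bar>w \<kappa>\<bar> + (ennreal (1/2) * ennreal \<bar>w (\<kappa> + 1)\<bar> + ennreal (1/2) * ennreal \<bar>w (\<kappa> + -1)\<bar>) \<partial>count_space UNIV)"
    by (intro nn_integral_mono p)
  also have "\<dots> = (\<integral>\<^sup>+ \<kappa>. ennreal \<bar>w \<kappa>\<bar> \<partial>count_space UNIV) + (ennreal (1/2) * (\<integral>\<^sup>+ \<kappa>. ennreal \<bar>w \<kappa>\<bar> \<partial>count_space UNIV)
      + ennreal (1/2) * (\<integral>\<^sup>+ \<kappa>. ennreal \<bar>w \<kappa>\<bar> \<partial>count_space UNIV))"
    using nn_integral_int_shift[of "\<lambda>\<kappa>. ennreal \<bar>w \<kappa>\<bar>" 1] nn_integral_int_shift[of "\<lambda>\<kappa>. ennreal \<bar>w \<kappa>\<bar>" "-1"]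
    by (simp add: nn_integral_add nn_integral_cmult del: ennreal_half)
  also have "\<dots> = (1 + (ennreal (1/2) + ennreal (1/2))) * (\<integral>\<^sup>+ \<kappa>. ennreal \<bar>w \<kappa>\<bar> \<partial>count_space UNIV)"
    by (simp only: distrib_right mult_1)
  also have "1 + (ennreal (1/2) + ennreal (1/2)) = 2"
    by (subst ennreal_plus[symmetric]) auto
  finally show ?thesis .
qed

lemma bstep_pow_l1:
  "(\<integral>\<^sup>+ \<kappa>. ennreal \<bar>(bstep \<alpha> ^^ n) w \<kappa>\<bar> \<partial>count_space UNIV) \<le> 2 ^ n * (\<integral>\<^sup>+ \<kappa>. ennreal \<bar>w \<kappa>\<bar> \<partial>count_space UNIV)"
proof (induction n)
  case (Suc n)
  have "(\<integral>\<^sup>+ \<kappa>. ennreal \<bar>(bstep \<alpha> ^^ Suc n) w \<kappa>\<bar> \<partial>count_space UNIV)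
      \<le> 2 * (\<integral>\<^sup>+ \<kappa>. ennreal \<bar>(bstep \<alpha> ^^ n) w \<kappa>\<bar> \<partial>count_space UNIV)"
    using bstep_l1[of "(bstep \<alpha> ^^ n) w"] by simp
  also have "\<dots> \<le> 2 * (2 ^ n * (\<integral>\<^sup>+ \<kappa>. ennreal \<bar>w \<kappa>\<bar> \<partial>count_space UNIV))"
    by (intro mult_left_mono Suc) simp
  finally show ?case by (simp add: mult.assoc)
qed simp

text \<open>With no jump nothing changes, so only \<open>n \<ge> 1\<close> contributes, each time
  with at most \<open>2 ^ n + 1\<close>. The Poisson mean of this vanishes at \<open>r = 0\<close>
  and is of order \<open>r\<close>, which makes the exchange of fluxes in the action a second-order
  error.\<close>

lemma bflow_minus_id_l1:
  assumes r: "0 \<le> r" and C: "\<And>\<kappa>. \<bar>w \<kappa>\<bar> \<le> C"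
  shows "(\<integral>\<^sup>+ \<kappa>. ennreal \<bar>bflow \<alpha> r w \<kappa> - w \<kappa>\<bar> \<partial>count_space UNIV)
     \<le> ennreal (exp r + 1 - 2 * exp (- r)) * (\<integral>\<^sup>+ \<kappa>. ennreal \<bar>w \<kappa>\<bar> \<partial>count_space UNIV)" (is "_ \<le> _ * ?W")
proof -
  define d where "d n \<kappa> = pois n r * \<bar>(bstep \<alpha> ^^ n) w \<kappa> - w \<kappa>\<bar>" for n \<kappa>
  \<comment> \<open>In this shape the sum is explicit: two full Poisson series minus the term at
    \<open>n = 0\<close>, where \<open>2 ^ 0 + 1 = 2\<close>.\<close>
  define e where "e n = pois n r * 2 ^ n + pois n r - (if n = 0 then 2 * exp (- r) else 0)" for n
  have d0: "0 \<le> d n \<kappa>" for n \<kappa> by (simp add: d_def pois_nonneg r)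
  have e: "e n = (if n = 0 then 0 else pois n r * (2 ^ n + 1))" for n
    by (cases "n = 0") (simp add: e_def pois_def, simp add: e_def distrib_left)
  have e0: "0 \<le> e n" for n by (simp add: e pois_nonneg r)
  have es: "e sums (exp r + 1 - 2 * exp (- r))"
  proof -
    have "(\<lambda>n. pois n r * 2 ^ n + pois n r - (if n = 0 then 2 * exp (- r) else 0)) sums (exp (r * (2 - 1)) + 1 - 2 * exp (- r))"
      by (intro sums_diff sums_add pois_power_sums pois_sums_1 sums_single[of 0 "\<lambda>_. 2 * exp (- r)"])
    then show ?thesis by (simp add: e_def[abs_def])
  qed
  have ds: "summable (\<lambda>n. d n \<kappa>)" for \<kappa>
  proof -
    have "\<bar>\<bar>(bstep \<alpha> ^^ n) w \<kappa> - w \<kappa>\<bar>\<bar> \<le> (2 * C) * 1 ^ n" for n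
      using bstep_pow_bound[of w C n \<kappa>, OF C] C[of \<kappa>] by simp
    from summable_pois_bound[OF r this] show ?thesis by (simp add: d_def)
  qed
  have pt: "ennreal \<bar>bflow \<alpha> r w \<kappa> - w \<kappa>\<bar> \<le> (\<Sum>n. ennreal (d n \<kappa>))" for \<kappa>
  proof -
    have "(\<lambda>n. pois n r * (bstep \<alpha> ^^ n) w \<kappa> - pois n r * w \<kappa>) sums (bflow \<alpha> r w \<kappa> - 1 * w \<kappa>)"
      unfolding bflow_def by (intro sums_diff summable_sums bflow_summable[OF r C] sums_mult2 pois_sums_1)
    then have "\<bar>bflow \<alpha> r w \<kappa> - w \<kappa>\<bar> = norm (\<Sum>n. pois n r * (bstep \<alpha> ^^ n) w \<kappa> - pois n r * w \<kappa>)"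
      by (simp add: sums_iff)
    also have "\<dots> \<le> (\<Sum>n. d n \<kappa>)"
      by (intro norm_suminf_le ds) (simp add: d_def right_diff_distrib[symmetric] abs_mult pois_nonneg r)
    finally show ?thesis by (simp add: suminf_ennreal2[OF d0 ds] ennreal_leI)
  qed
  have dn: "(\<integral>\<^sup>+ \<kappa>. ennreal (d n \<kappa>) \<partial>count_space UNIV) \<le> ennreal (e n) * ?W" for n
  proof (cases "n = 0")
    case False
    have "(\<integral>\<^sup>+ \<kappa>. ennreal (d n \<kappa>) \<partial>count_space UNIV) \<le>
      (\<integral>\<^sup>+ \<kappa>. ennreal (pois n r) * (ennreal \<bar>(bstep \<alpha> ^^ n) w \<kappa>\<bar> + ennreal \<bar>w \<kappa>\<bar>) \<partial>count_space UNIV)"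
    proof (intro nn_integral_mono)
      fix \<kappa>
      have "d n \<kappa> \<le> pois n r * (\<bar>(bstep \<alpha> ^^ n) w \<kappa>\<bar> + \<bar>w \<kappa>\<bar>)"
        unfolding d_def by (intro mult_left_mono abs_triangle_ineq4 pois_nonneg r)
      from ennreal_leI[OF this]
      show "ennreal (d n \<kappa>) \<le> ennreal (pois n r) * (ennreal \<bar>(bstep \<alpha> ^^ n) w \<kappa>\<bar> + ennreal \<bar>w \<kappa>\<bar>)"
        by (simp add: ennreal_mult pois_nonneg r)
    qed
    also have "\<dots> = ennreal (pois n r) * ((\<integral>\<^sup>+ \<kappa>. ennreal \<bar>(bstep \<alpha> ^^ n) w \<kappa>\<bar> \<partial>count_space UNIV) + ?W)"
      by (simp add: nn_integral_cmult nn_integral_add)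
    also have "\<dots> \<le> ennreal (pois n r) * (2 ^ n * ?W + ?W)"
      by (intro mult_left_mono add_right_mono bstep_pow_l1) simp
    also have "\<dots> = ennreal (pois n r) * (ennreal (2 ^ n + 1) * ?W)"
      by (simp add: distrib_right ennreal_power[symmetric])
    also have "\<dots> = ennreal (e n) * ?W"
      using False by (simp add: e ennreal_mult pois_nonneg r mult.assoc)
    finally show ?thesis .
  qed (simp add: d_def)
  have "(\<integral>\<^sup>+ \<kappa>. ennreal \<bar>bflow \<alpha> r w \<kappa> - w \<kappa>\<bar> \<partial>count_space UNIV) \<le> (\<integral>\<^sup>+ \<kappa>. (\<Sum>n. ennreal (d n \<kappa>)) \<partial>count_space UNIV)"
    by (intro nn_integral_mono pt)
  also have "\<dots> = (\<Sum>n. \<integral>\<^sup>+ \<kappa>. ennreal (d n \<kappa>) \<partial>count_space UNIV)"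
    by (simp add: nn_integral_suminf)
  also have "\<dots> \<le> (\<Sum>n. ennreal (e n) * ?W)" by (intro suminf_le dn) auto
  also have "\<dots> = ennreal (exp r + 1 - 2 * exp (- r)) * ?W"
    using es by (simp add: suminf_ennreal2[OF e0] sums_iff)
  finally show ?thesis .
qed

end

section \<open>Weak derivatives along the flow\<close>

lemma weak_derivI:
  assumes "set_integrable lborel {0..1} g" "\<And>t. t \<in> {0..1} \<Longrightarrow> f t = f 0 + (LINT s:{0..t}|lborel. g s)"
  shows "weak_deriv_01 f g"
  using assms unfolding weak_deriv_01_def by blast

lemma weak_derivD:
  assumes "weak_deriv_01 f g"
  shows "set_integrable lborel {0..1} g" "t \<in> {0..1} \<Longrightarrow> f t = f 0 + (LINT s:{0..t}|lborel. g s)"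
  using assms unfolding weak_deriv_01_def by blast+

lemma set_integrable_01_sub:
  fixes g :: "real \<Rightarrow> real"
  assumes "set_integrable lborel {0..1} g" "t \<in> {0..1::real}"
  shows "set_integrable lborel {0..t} g"
  using assms by (intro set_integrable_subset[OF assms(1)]) auto

lemma weak_deriv_continuous:
  assumes "weak_deriv_01 f g"
  shows "continuous_on {0..1} f"
proof -
  note g = weak_derivD(1)[OF assms]
  have e: "f t = f 0 + integral {0..t} g" if "t \<in> {0..1}" for t
    using weak_derivD(2)[OF assms that] set_borel_integral_eq_integral(2)[OF set_integrable_01_sub[OF g that]]
    by (rule trans[OF _ arg_cong])
  have "continuous_on {0..1} (\<lambda>t. f 0 + integral {0..t} g)"
    by (intro continuous_intros indefinite_integral_continuous_1 set_borel_integral_eq_integral(1)[OF g])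
  moreover have "continuous_on {0..1} f \<longleftrightarrow> continuous_on {0..1} (\<lambda>t. f 0 + integral {0..t} g)"
    by (intro continuous_on_cong refl e)
  ultimately show ?thesis by blast
qed

lemma weak_deriv_cmult:
  assumes "weak_deriv_01 f g"
  shows "weak_deriv_01 (\<lambda>s. c * f s) (\<lambda>s. c * g s)"
proof (rule weak_derivI)
  show "set_integrable lborel {0..1} (\<lambda>s. c * g s)" using weak_derivD(1)[OF assms] by simp
  show "c * f t = c * f 0 + (LINT s:{0..t}|lborel. c * g s)" if "t \<in> {0..1}" for t
    by (subst weak_derivD(2)[OF assms that]) (simp add: distrib_left)
qed

lemma weak_deriv_add:
  assumes "weak_deriv_01 f g" "weak_deriv_01 f' g'"
  shows "weak_deriv_01 (\<lambda>s. f s + f' s) (\<lambda>s. g s + g' s)"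
proof (rule weak_derivI)
  note i = weak_derivD(1)[OF assms(1)] weak_derivD(1)[OF assms(2)]
  show "set_integrable lborel {0..1} (\<lambda>s. g s + g' s)" using i by (rule set_integral_add)
  show "f t + f' t = f 0 + f' 0 + (LINT s:{0..t}|lborel. g s + g' s)" if t: "t \<in> {0..1}" for t
    by (subst set_integral_add(2)[OF set_integrable_01_sub[OF i(1) t] set_integrable_01_sub[OF i(2) t]],
        subst weak_derivD(2)[OF assms(1) t], subst weak_derivD(2)[OF assms(2) t]) simp
qed

text \<open>\<open>weak_deriv_01\<close> fixes the continuous representative, so the functions must
  agree everywhere on the interval, whereas the derivative matters only almost everywhere.\<close>

lemma weak_deriv_cong:
  assumes w: "weak_deriv_01 f g" and f: "\<And>s. s \<in> {0..1} \<Longrightarrow> f s = f' s"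
    and ae: "AE s in lborel. s \<in> {0..1} \<longrightarrow> g s = g' s" and m: "set_borel_measurable lborel {0..1} g'"
  shows "weak_deriv_01 f' g'"
proof -
  note g = weak_derivD(1)[OF w]
  have g': "set_integrable lborel {0..1} g'"
    unfolding set_integrable_def
  proof (rule integrable_cong_AE_imp)
    show "integrable lborel (\<lambda>x. indicator {0..1} x *\<^sub>R g x)" using g by (simp add: set_integrable_def)
    show "AE x in lborel. indicator {0..1} x *\<^sub>R g x = indicator {0..1} x *\<^sub>R g' x"
      using ae by eventually_elim (auto simp: indicator_def)
  qed (use m in \<open>simp add: set_borel_measurable_def\<close>)
  have i: "(LINT s:{0..t}|lborel. g s) = (LINT s:{0..t}|lborel. g' s)" if t: "t \<in> {0..1}" for t
    unfolding set_lebesgue_integral_def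
  proof (rule integral_cong_AE)
    show "AE x in lborel. indicat_real {0..t} x *\<^sub>R g x = indicat_real {0..t} x *\<^sub>R g' x"
      using ae by eventually_elim (use t in \<open>auto simp: indicator_def\<close>)
  qed (use set_integrable_01_sub[OF g t] set_integrable_01_sub[OF g' t] in
      \<open>auto simp: set_integrable_def dest: borel_measurable_integrable\<close>)
  show ?thesis
  proof (rule weak_derivI[OF g'])
    show "f' t = f' 0 + (LINT s:{0..t}|lborel. g' s)" if "t \<in> {0..1}" for t
      using weak_derivD(2)[OF w that] f[OF that] f[of 0] i[OF that] by simp
  qed
qed

text \<open>Since the derivative of \<open>f\<close> is merely integrable, the product rule comes
  from Fubini on a triangle, where only the smooth factor is integrated explicitly.\<close>

lemma weak_deriv_mult_smooth:
  assumes w: "weak_deriv_01 f g"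
    and \<phi>: "\<And>x. (\<phi> has_real_derivative \<phi>' x) (at x)" and c: "continuous_on UNIV \<phi>'"
  shows "weak_deriv_01 (\<lambda>s. \<phi> s * f s) (\<lambda>s. \<phi>' s * f s + \<phi> s * g s)"
proof -
  have g: "set_integrable lborel {0..1} g" and f: "\<And>t. t \<in> {0..1} \<Longrightarrow> (LINT s:{0..t}|lborel. g s) = f t - f 0"
    using weak_derivD[OF w] by (blast, metis add_diff_cancel_left')
  have c\<phi>: "continuous_on UNIV \<phi>"
    using \<phi> by (meson DERIV_isCont continuous_at_imp_continuous_on)
  have [measurable]: "\<phi> \<in> borel_measurable borel" "\<phi>' \<in> borel_measurable borel"
    using c c\<phi> by (auto intro: borel_measurable_continuous_onI)
  have "bounded (\<phi> ` {0..1})" "bounded (\<phi>' ` {0..1})"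
    by (intro compact_imp_bounded compact_continuous_image continuous_on_subset[OF c] continuous_on_subset[OF c\<phi>]; simp)+
  then obtain M M' where M: "\<And>x. x \<in> {0..1} \<Longrightarrow> \<bar>\<phi> x\<bar> \<le> M" and M': "\<And>x. x \<in> {0..1} \<Longrightarrow> \<bar>\<phi>' x\<bar> \<le> M'"
    unfolding bounded_iff by (force simp: image_iff)
  define G where "G u = indicator {0..1} u * g u" for u
  have G: "integrable lborel G" using g by (simp add: set_integrable_def G_def[abs_def])
  then have [measurable]: "G \<in> borel_measurable borel" by auto
  have i1: "set_integrable lborel {0..1} (\<lambda>s. \<phi>' s * f s)"
    by (intro borel_integrable_atLeastAtMost' continuous_intros weak_deriv_continuous[OF w] continuous_on_subset[OF c]) auto
  have i2: "set_integrable lborel {0..1} (\<lambda>s. \<phi> s * g s)"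
    unfolding set_integrable_def
  proof (rule Bochner_Integration.integrable_bound)
    show "integrable lborel (\<lambda>x. M * G x)" using G by simp
    have "(\<lambda>x. \<phi> x * G x) \<in> borel_measurable lborel" by measurable
    then show "(\<lambda>x. indicat_real {0..1} x *\<^sub>R (\<phi> x * g x)) \<in> borel_measurable lborel"
      by (simp add: G_def mult.left_commute)
    have "0 \<le> M" using M[of 0] by simp
    then show "AE x in lborel. norm (indicat_real {0..1} x *\<^sub>R (\<phi> x * g x)) \<le> norm (M * G x)"
      using M by (auto simp: G_def abs_mult indicator_def intro!: mult_right_mono)
  qed
  have main: "\<phi> T * f T = \<phi> 0 * f 0 + (LINT s:{0..T}|lborel. \<phi>' s * f s + \<phi> s * g s)" if T: "T \<in> {0..1}" for T
  proof -
    note sub = set_integrable_subset[of lborel "{0..1}" _ "{0..T}"]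
    have FTC: "(LINT r:{u..T}|lborel. \<phi>' r) = \<phi> T - \<phi> u" if "u \<le> T" for u
      unfolding set_lebesgue_integral_def
      by (rule integral_FTC_atLeastAtMost[OF that])
        (auto intro: has_field_derivative_at_within[OF \<phi>] continuous_on_subset[OF c]
          simp: has_real_derivative_iff_has_vector_derivative[symmetric])
    \<comment> \<open>This is \<open>\<phi>' r * g u\<close> on the triangle
      \<open>0 \<le> u \<le> r \<le> T\<close>. Integrating first over \<open>u\<close> gives
      \<open>\<phi>' r * (f r - f 0)\<close>, first over \<open>r\<close> gives
      \<open>(\<phi> T - \<phi> u) * g u\<close>.\<close>
    define k where "k r u = indicator {0..T} r * \<phi>' r * (indicator {0..r} u * G u)" for r u
    have kint: "integrable (lborel \<Otimes>\<^sub>M lborel) (case_prod k)"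
    proof (rule Bochner_Integration.integrable_bound)
      show "integrable (lborel \<Otimes>\<^sub>M lborel) (\<lambda>(r, u). (M' * indicator {0..1::real} r) * G u)"
      proof (rule lborel_pair.Fubini_integrable)
        show "integrable lborel (\<lambda>x. LINT y|lborel. norm (case (x, y) of (r, u) \<Rightarrow> M' * indicat_real {0..1::real} r * G u))"
        proof -
          have "integrable lborel (indicator {0..1::real} :: real \<Rightarrow> real)"
            by (rule integrable_real_indicator) auto
          then show ?thesis by (simp add: abs_mult)
        qed
        show "AE x in lborel. integrable lborel (\<lambda>y. case (x, y) of (r, u) \<Rightarrow> M' * indicat_real {0..1::real} r * G u)"
          using G by simp
      qed measurable
      show "case_prod k \<in> borel_measurable (lborel \<Otimes>\<^sub>M lborel)"
      proof -
        \<comment> \<open>The moving interval \<open>{0..r}\<close> becomes a condition on the pair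
          \<open>(r, u)\<close>, which the measurability prover can handle.\<close>
        have "k r u = indicator {0..T} r * \<phi>' r * ((if 0 \<le> u \<and> u \<le> r then 1 else 0) * G u)" for r u
          by (auto simp: k_def indicator_def)
        then have "case_prod k = (\<lambda>(r, u). indicator {0..T} r * \<phi>' r * ((if 0 \<le> u \<and> u \<le> r then 1 else 0) * G u))"
          by auto
        then show ?thesis by simp
      qed
      have "\<bar>k r u\<bar> \<le> \<bar>M' * indicator {0..1} r * G u\<bar>" for r u
        using M'[of r] T by (auto simp: k_def indicator_def abs_mult intro!: mult_right_mono)
      then show "AE x in lborel \<Otimes>\<^sub>M lborel. norm (case_prod k x) \<le> norm (case x of (r, u) \<Rightarrow> M' * indicat_real {0..1} r * G u)"
        by (intro AE_I2) (auto split: prod.split)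
    qed
    have "(\<integral>r. (\<integral>u. k r u \<partial>lborel) \<partial>lborel) = (\<integral>u. (\<integral>r. k r u \<partial>lborel) \<partial>lborel)"
      using lborel_pair.Fubini_integral[OF kint] by simp
    moreover have "(\<integral>u. k r u \<partial>lborel) = indicator {0..T} r * (\<phi>' r * f r - f 0 * \<phi>' r)" for r
    proof (cases "r \<in> {0..T}")
      case True
      have "(\<integral>u. indicator {0..r} u * G u \<partial>lborel) = (LINT s:{0..r}|lborel. g s)"
        unfolding set_lebesgue_integral_def using True T
        by (intro Bochner_Integration.integral_cong) (auto simp: G_def indicator_def)
      also have "\<dots> = f r - f 0" using f[of r] True T by simp
      finally show ?thesis using True by (simp add: k_def) (simp add: right_diff_distrib mult.commute)
    qed (simp add: k_def)
    moreover have "(\<integral>r. k r u \<partial>lborel) = indicator {0..T} u * (\<phi> T * g u - \<phi> u * g u)" for u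
    proof (cases "u \<in> {0..T}")
      case True
      have "(\<integral>r. k r u \<partial>lborel) = (\<integral>r. g u * (indicator {u..T} r *\<^sub>R \<phi>' r) \<partial>lborel)"
        using True T by (intro Bochner_Integration.integral_cong) (auto simp: k_def G_def indicator_def)
      also have "\<dots> = g u * (\<phi> T - \<phi> u)"
        using FTC[of u] True by (simp add: set_lebesgue_integral_def)
      finally show ?thesis using True by (simp add: algebra_simps)
    next
      case False
      then have "k r u = 0" for r using T by (auto simp: k_def indicator_def G_def)
      then show ?thesis using False by simp
    qed
    ultimately have "(LINT r:{0..T}|lborel. \<phi>' r * f r - f 0 * \<phi>' r) = (LINT u:{0..T}|lborel. \<phi> T * g u - \<phi> u * g u)"
      by (simp add: set_lebesgue_integral_def)
    moreover have "(LINT r:{0..T}|lborel. \<phi>' r * f r - f 0 * \<phi>' r)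
        = (LINT r:{0..T}|lborel. \<phi>' r * f r) - f 0 * (\<phi> T - \<phi> 0)"
    proof -
      have "set_integrable lborel {0..T} \<phi>'"
        by (intro borel_integrable_atLeastAtMost' continuous_on_subset[OF c]) auto
      then show ?thesis using sub[OF i1] T FTC[of 0] by (subst set_integral_diff) auto
    qed
    moreover have "(LINT u:{0..T}|lborel. \<phi> T * g u - \<phi> u * g u) = \<phi> T * (f T - f 0) - (LINT u:{0..T}|lborel. \<phi> u * g u)"
      using sub[OF i2] sub[OF g] T f[OF T] by (subst set_integral_diff) auto
    moreover have "(LINT s:{0..T}|lborel. \<phi>' s * f s + \<phi> s * g s)
      = (LINT s:{0..T}|lborel. \<phi>' s * f s) + (LINT s:{0..T}|lborel. \<phi> s * g s)"
      using sub[OF i1] sub[OF i2] T by (intro set_integral_add) auto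
    ultimately show ?thesis by (simp add: algebra_simps)
  qed
  show ?thesis by (intro weak_derivI set_integral_add(1) i1 i2 main)
qed

text \<open>The right side of the forward equation of the Poisson process. The weight preceding
  \<open>n = 0\<close> counts as 0, and the case split guards against \<open>0 - 1 = 0\<close> on
  \<open>nat\<close>.\<close>

definition dpois :: "nat \<Rightarrow> real \<Rightarrow> real" where
  "dpois n r = (if n = 0 then 0 else pois (n - 1) r) - pois n r"

lemma pois_deriv: "(pois n has_real_derivative dpois n r) (at r)"
proof (cases n)
  case 0
  have "((\<lambda>r. exp (- r)) has_real_derivative - exp (- r)) (at r)"
    by (auto intro!: derivative_eq_intros)
  then show ?thesis using 0 by (simp add: pois_def[abs_def] dpois_def)
next
  case (Suc m)
  have "((\<lambda>r. exp (- r) * (r ^ Suc m / fact (Suc m))) has_real_derivative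
      exp (- r) * (real (Suc m) * r ^ m / fact (Suc m)) - exp (- r) * (r ^ Suc m / fact (Suc m))) (at r)"
  proof -
    have "((\<lambda>r. r ^ Suc m / fact (Suc m)) has_real_derivative real (Suc m) * r ^ m / fact (Suc m)) (at r)"
      using DERIV_cdivide[OF DERIV_pow[of "Suc m" r], of "fact (Suc m)"] by (simp del: fact_Suc power_Suc)
    moreover have "((\<lambda>r. exp (- r)) has_real_derivative - exp (- r)) (at r)"
      by (auto intro!: derivative_eq_intros)
    ultimately show ?thesis
      by (intro DERIV_cong[OF DERIV_mult]) (assumption, assumption, simp del: fact_Suc power_Suc)
  qed
  moreover have "real (Suc m) * r ^ m / fact (Suc m) = r ^ m / fact m"
    unfolding fact_Suc by (simp del: of_nat_Suc)
  ultimately show ?thesis unfolding Suc pois_def[abs_def] dpois_def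
    by (simp only: nat.distinct if_False diff_Suc_1)
qed

lemma continuous_pois: "continuous_on A (pois n)"
  unfolding pois_def[abs_def] by (intro continuous_intros) auto

lemma continuous_dpois: "continuous_on A (dpois n)"
  unfolding dpois_def[abs_def] by (cases "n = 0") (auto intro!: continuous_intros continuous_pois)

lemma pois_le: "0 \<le> r \<Longrightarrow> r \<le> R \<Longrightarrow> pois n r \<le> R ^ n / fact n"
  unfolding pois_def
  by (rule order_trans[OF mult_left_le_one_le]) (auto intro!: divide_right_mono power_mono)

text \<open>The factor \<open>R\<close>, which the chain rule supplies later, turns
  \<open>R ^ (n - 1) / fact (n - 1)\<close> into \<open>n * (R ^ n / fact n)\<close>, so that both
  terms share one power of \<open>R\<close>.\<close>

lemma abs_dpois_le:
  assumes "0 \<le> r" "r \<le> R"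
  shows "R * \<bar>dpois n r\<bar> \<le> (real n + R) * (R ^ n / fact n)"
proof (cases n)
  case 0
  then show ?thesis using assms pois_le[OF assms, of 0]
    by (simp add: dpois_def pois_nonneg mult_left_le)
next
  case (Suc m)
  have "\<bar>dpois n r\<bar> \<le> pois m r + pois n r"
    using Suc assms(1) by (simp add: dpois_def abs_le_iff pois_nonneg)
  also have "\<dots> \<le> R ^ m / fact m + R ^ n / fact n" by (intro add_mono pois_le assms)
  finally have "R * \<bar>dpois n r\<bar> \<le> R * (R ^ m / fact m + R ^ n / fact n)"
    using assms by (intro mult_left_mono) auto
  also have "\<dots> = R * (R ^ m / fact m) + R * (R ^ n / fact n)" by (simp add: distrib_left)
  also have "R * (R ^ m / fact m) = real n * (R ^ n / fact n)" using Suc by simp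
  also have "real n * (R ^ n / fact n) + R * (R ^ n / fact n) = (real n + R) * (R ^ n / fact n)"
    by (simp only: distrib_right)
  finally show ?thesis .
qed

context rates
begin

lemma weak_deriv_fstep_pow:
  assumes "\<And>\<kappa>. weak_deriv_01 (\<lambda>s. x s \<kappa>) (\<lambda>s. g s \<kappa>)"
  shows "weak_deriv_01 (\<lambda>s. (fstep \<alpha> ^^ n) (x s) \<kappa>) (\<lambda>s. (fstep \<alpha> ^^ n) (g s) \<kappa>)"
proof (induction n arbitrary: \<kappa>)
  case (Suc n)
  let ?f = "\<lambda>s j. (fstep \<alpha> ^^ n) (x s) j" and ?g = "\<lambda>s j. (fstep \<alpha> ^^ n) (g s) j"
  have "weak_deriv_01
     (\<lambda>s. (1 - \<alpha> \<kappa>) * ?f s \<kappa> + (\<alpha> (\<kappa> + 1) / 2 * ?f s (\<kappa> + 1) + \<alpha> (\<kappa> - 1) / 2 * ?f s (\<kappa> - 1)))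
     (\<lambda>s. (1 - \<alpha> \<kappa>) * ?g s \<kappa> + (\<alpha> (\<kappa> + 1) / 2 * ?g s (\<kappa> + 1) + \<alpha> (\<kappa> - 1) / 2 * ?g s (\<kappa> - 1)))"
    by (intro weak_deriv_add weak_deriv_cmult Suc)
  moreover have "fstep \<alpha> u \<kappa> = (1 - \<alpha> \<kappa>) * u \<kappa> + (\<alpha> (\<kappa> + 1) / 2 * u (\<kappa> + 1) + \<alpha> (\<kappa> - 1) / 2 * u (\<kappa> - 1))" for u
    by (simp add: fstep_def add_divide_distrib)
  ultimately show ?case by simp
qed (simp add: assms)

text \<open>Shifting the index turns the differentiated weights into one more forward step: the sum
  of \<open>dpois n r\<close> times the iterates of \<open>x\<close> is the flow of
  \<open>fstep \<alpha> x - x\<close>. The factor \<open>- R\<close> is the derivative of the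
  parameter \<open>(1 - s) * R\<close>.\<close>

lemma fflow_dlap_sums:
  assumes r: "0 \<le> r" and x: "\<And>\<kappa>. \<bar>x \<kappa>\<bar> \<le> M" and g: "\<And>\<kappa>. \<bar>g \<kappa>\<bar> \<le> K"
  shows "(\<lambda>n. - R * dpois n r * (fstep \<alpha> ^^ n) x \<kappa> + pois n r * (fstep \<alpha> ^^ n) g \<kappa>) sums
     fflow \<alpha> r (\<lambda>j. g j - R * (fstep \<alpha> x j - x j)) \<kappa>"
proof -
  let ?f = "\<lambda>n. (fstep \<alpha> ^^ n) x \<kappa>" and ?g = "\<lambda>n. (fstep \<alpha> ^^ n) g \<kappa>"
  have fb: "\<bar>?f (Suc n)\<bar> \<le> (2 * M) * 2 ^ n" for n
    using fstep_pow_bound[of x M "Suc n" \<kappa>, OF x] by (simp add: mult_ac)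
  have s1: "summable (\<lambda>n. pois n r * ?f (Suc n))" using r fb by (rule summable_pois_bound)
  note s2 = fflow_summable[of r x M \<kappa>, OF r x] and s3 = fflow_summable[of r g K \<kappa>, OF r g]
  define z where "z n = (if n = 0 then 0 else pois (n - 1) r * ?f n)" for n
  have "(\<lambda>n. z (Suc n)) sums (\<Sum>n. pois n r * ?f (Suc n))"
    using summable_sums[OF s1] by (simp add: z_def)
  then have z: "z sums (\<Sum>n. pois n r * ?f (Suc n))" by (subst (asm) sums_Suc_iff) (simp add: z_def)
  have "(\<lambda>n. - R * (z n - pois n r * ?f n) + pois n r * ?g n) sums
     (- R * ((\<Sum>n. pois n r * ?f (Suc n)) - (\<Sum>n. pois n r * ?f n)) + (\<Sum>n. pois n r * ?g n))"
    by (intro sums_add sums_mult sums_diff z summable_sums s2 s3)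
  moreover have "- R * (z n - pois n r * ?f n) + pois n r * ?g n = - R * dpois n r * ?f n + pois n r * ?g n" for n
    by (simp add: z_def dpois_def algebra_simps)
  ultimately have 1: "(\<lambda>n. - R * dpois n r * ?f n + pois n r * ?g n) sums
     (- R * ((\<Sum>n. pois n r * ?f (Suc n)) - (\<Sum>n. pois n r * ?f n)) + (\<Sum>n. pois n r * ?g n))"
    by (simp only:)
  have "(\<lambda>n. pois n r * ?g n - R * (pois n r * ?f (Suc n) - pois n r * ?f n)) sums
     ((\<Sum>n. pois n r * ?g n) - R * ((\<Sum>n. pois n r * ?f (Suc n)) - (\<Sum>n. pois n r * ?f n)))"
    by (intro sums_mult sums_diff summable_sums s1 s2 s3)
  moreover have "pois n r * ?g n - R * (pois n r * ?f (Suc n) - pois n r * ?f n)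
     = pois n r * (fstep \<alpha> ^^ n) (\<lambda>j. g j - R * (fstep \<alpha> x j - x j)) \<kappa>" for n
  proof -
    have "(fstep \<alpha> ^^ n) (\<lambda>j. fstep \<alpha> x j - x j) = (\<lambda>j. (fstep \<alpha> ^^ Suc n) x j - (fstep \<alpha> ^^ n) x j)"
      using fstep_pow_lin[of n \<alpha> "fstep \<alpha> x" 1 x] by (simp add: funpow_swap1)
    then show ?thesis unfolding fstep_pow_lin by (simp only: right_diff_distrib mult.left_commute)
  qed
  ultimately have "(\<lambda>n. pois n r * (fstep \<alpha> ^^ n) (\<lambda>j. g j - R * (fstep \<alpha> x j - x j)) \<kappa>) sums
     ((\<Sum>n. pois n r * ?g n) - R * ((\<Sum>n. pois n r * ?f (Suc n)) - (\<Sum>n. pois n r * ?f n)))"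
    by (simp only:)
  then have "fflow \<alpha> r (\<lambda>j. g j - R * (fstep \<alpha> x j - x j)) \<kappa>
      = - R * ((\<Sum>n. pois n r * ?f (Suc n)) - (\<Sum>n. pois n r * ?f n)) + (\<Sum>n. pois n r * ?g n)"
    unfolding fflow_def by (subst sums_unique[symmetric]) simp_all
  with 1 show ?thesis by (simp only:)
qed

text \<open>Duhamel's formula for a flow whose parameter runs down from \<open>R\<close> to 0. The
  bound on \<open>g\<close> is only integrable in time because this is how finite action controls a
  flux. The series is differentiated term by term, with a majorant summable in \<open>n\<close> and
  integrable in \<open>s\<close>.\<close>

lemma weak_deriv_fflow:
  assumes wd: "\<And>\<kappa>. weak_deriv_01 (\<lambda>s. x s \<kappa>) (\<lambda>s. g s \<kappa>)"
    and x: "\<And>s \<kappa>. s \<in> {0..1} \<Longrightarrow> \<bar>x s \<kappa>\<bar> \<le> M"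
    and g: "\<And>s \<kappa>. s \<in> {0..1} \<Longrightarrow> \<bar>g s \<kappa>\<bar> \<le> G s"
    and G: "set_integrable lborel {0..1} G" and R: "0 \<le> R"
  shows "weak_deriv_01 (\<lambda>s. fflow \<alpha> ((1 - s) * R) (x s) \<kappa>)
     (\<lambda>s. fflow \<alpha> ((1 - s) * R) (\<lambda>j. g s j - R * (fstep \<alpha> (x s) j - x s j)) \<kappa>)" (is "weak_deriv_01 ?F ?H")
proof -
  define f where "f n s = (fstep \<alpha> ^^ n) (x s) \<kappa>" for n s
  define gg where "gg n s = (fstep \<alpha> ^^ n) (g s) \<kappa>" for n s
  define h where "h n s = - R * dpois n ((1 - s) * R) * f n s + pois n ((1 - s) * R) * gg n s" for n s
  \<comment> \<open>\<open>R ^ n / fact n\<close> bounds the Poisson weights, one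
    \<open>2 ^ n\<close> absorbs the factor \<open>n\<close> of \<open>abs_dpois_le\<close>, and the
    other bounds the \<open>n\<close>-fold step.\<close>
  define c where "c n = (R + 1) * ((4 * R) ^ n / fact n)" for n
  have r: "0 \<le> (1 - s) * R" "(1 - s) * R \<le> R" if "s \<in> {0..1}" for s
    using that R by (auto simp: mult_left_le_one_le)
  have wh: "weak_deriv_01 (\<lambda>s. pois n ((1 - s) * R) * f n s) (h n)" for n
  proof -
    have "weak_deriv_01 (\<lambda>s. pois n ((1 - s) * R) * f n s) (\<lambda>s. - R * dpois n ((1 - s) * R) * f n s + pois n ((1 - s) * R) * gg n s)"
    proof (rule weak_deriv_mult_smooth)
      show "weak_deriv_01 (f n) (gg n)" unfolding f_def[abs_def] gg_def[abs_def] by (rule weak_deriv_fstep_pow[OF wd])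
      show "((\<lambda>s. pois n ((1 - s) * R)) has_real_derivative - R * dpois n ((1 - s) * R)) (at s)" for s
      proof -
        have "((\<lambda>s. (1 - s) * R) has_real_derivative - R) (at s)"
          by (auto intro!: derivative_eq_intros)
        from DERIV_chain2[where f = "pois n" and g = "\<lambda>s. (1 - s) * R", OF pois_deriv[of n "(1 - s) * R"] this]
        show ?thesis by (simp add: mult.commute)
      qed
      show "continuous_on UNIV (\<lambda>s. - R * dpois n ((1 - s) * R))"
        by (intro continuous_intros continuous_on_compose2[OF continuous_dpois[of UNIV]]) auto
    qed
    then show ?thesis by (simp add: h_def[abs_def])
  qed
  have cs: "summable c"
    unfolding c_def[abs_def] using summable_exp[of "4 * R"] by (intro summable_mult) (simp add: divide_inverse mult.commute)
  have c0: "0 \<le> c n" for n using R by (simp add: c_def)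
  have hb: "\<bar>h n s\<bar> \<le> c n * (M + G s)" if s: "s \<in> {0..1}" for n s
  proof -
    note M = x[OF s] and G = g[OF s]
    have M0: "0 \<le> M" and G0: "0 \<le> G s" using M[of 0] G[of 0] by linarith+
    have k: "real n + 1 \<le> 2 ^ n" using of_nat_mono[of "Suc n" "2 ^ n", where 'a = real] less_exp[of n]
      by (simp add: Suc_le_eq)
    have kR: "real n + R \<le> (R + 1) * 2 ^ n" "1 \<le> (R + 1) * 2 ^ n"
    proof -
      have "R * 1 \<le> R * 2 ^ n" using R by (intro mult_left_mono) auto
      then show "real n + R \<le> (R + 1) * 2 ^ n" using k by (simp add: distrib_right)
      show "1 \<le> (R + 1) * 2 ^ n" using R k \<open>R * 1 \<le> R * 2 ^ n\<close> by (simp add: distrib_right)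
    qed
    have q: "(R + 1) * 2 ^ n * (R ^ n / fact n) * 2 ^ n = c n"
    proof -
      have "(4 * R) ^ n = (2 * R * 2) ^ n" by simp
      also have "\<dots> = 2 ^ n * R ^ n * 2 ^ n" by (simp only: power_mult_distrib)
      finally show ?thesis unfolding c_def by (simp only: times_divide_eq_right times_divide_eq_left mult_ac)
    qed
    have "\<bar>h n s\<bar> \<le> R * \<bar>dpois n ((1 - s) * R)\<bar> * \<bar>f n s\<bar> + pois n ((1 - s) * R) * \<bar>gg n s\<bar>"
      unfolding h_def using R pois_nonneg[OF r(1)[OF s], of n]
      by (intro order_trans[OF abs_triangle_ineq]) (simp add: abs_mult)
    also have "\<dots> \<le> ((R + 1) * 2 ^ n * (R ^ n / fact n)) * (M * 2 ^ n) + ((R + 1) * 2 ^ n * (R ^ n / fact n)) * (G s * 2 ^ n)"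
    proof (rule add_mono[OF mult_mono mult_mono])
      show "R * \<bar>dpois n ((1 - s) * R)\<bar> \<le> (R + 1) * 2 ^ n * (R ^ n / fact n)"
        using R by (intro order_trans[OF abs_dpois_le[OF r[OF s]]] mult_right_mono kR) auto
      show "pois n ((1 - s) * R) \<le> (R + 1) * 2 ^ n * (R ^ n / fact n)"
        using R mult_right_mono[OF kR(2), of "R ^ n / fact n"]
        by (intro order_trans[OF pois_le[OF r[OF s]]]) auto
      show "\<bar>f n s\<bar> \<le> M * 2 ^ n" unfolding f_def using M by (rule fstep_pow_bound)
      show "\<bar>gg n s\<bar> \<le> G s * 2 ^ n" unfolding gg_def using G by (rule fstep_pow_bound)
    qed (use R M0 G0 in auto)
    also have "\<dots> = c n * (M + G s)" 
    proof -
      have "X * (M * y) + X * (G s * y) = X * y * (M + G s)" for X y by (simp add: algebra_simps)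
      then show ?thesis unfolding q[symmetric] .
    qed
    finally show ?thesis .
  qed
  have hs: "(\<lambda>n. h n s) sums ?H s" if s: "s \<in> {0..1}" for s
    unfolding h_def f_def gg_def by (rule fflow_dlap_sums[OF r(1)[OF s] x[OF s] g[OF s]])
  \<comment> \<open>Integration over \<open>{0..T}\<close> commutes with the series;
    \<open>T = 1\<close> also yields the integrability of the limit that
    \<open>weak_deriv_01\<close> asks for.\<close>
  have exch: "set_integrable lborel {0..T} ?H \<and> (\<lambda>n. LINT s:{0..T}|lborel. h n s) sums (LINT s:{0..T}|lborel. ?H s)"
    if T: "T \<in> {0..1}" for T
  proof -
    define I where "I = {0..T}"
    have Isub: "s \<in> I \<Longrightarrow> s \<in> {0..1}" for s using T by (auto simp: I_def)
    have int: "integrable lborel (\<lambda>s. indicator I s *\<^sub>R h n s)" for n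
      using set_integrable_01_sub[OF weak_derivD(1)[OF wh[of n]] T] by (simp add: set_integrable_def I_def)
    have GI: "integrable lborel (\<lambda>s. indicator I s * (M + G s))"
    proof -
      have "set_integrable lborel I (\<lambda>s. M + G s)"
        unfolding I_def by (intro set_integral_add set_integrable_01_sub[OF G T] borel_integrable_atLeastAtMost' continuous_intros)
      then show ?thesis by (simp add: set_integrable_def)
    qed
    have nb: "norm (indicator I s *\<^sub>R h n s) \<le> c n * (indicator I s * (M + G s))" for n s
      using hb[of s n] Isub[of s] by (auto simp: indicator_def)
    have sm: "summable (\<lambda>n. norm (indicator I s *\<^sub>R h n s))" for s
      by (rule summable_comparison_test'[OF summable_mult2[OF cs, of "indicator I s * (M + G s)"], of 0])
        (use nb in simp)
    have sm2: "summable (\<lambda>n. \<integral>s. norm (indicator I s *\<^sub>R h n s) \<partial>lborel)"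
    proof (rule summable_comparison_test'[OF summable_mult2[OF cs, of "\<integral>s. indicator I s * (M + G s) \<partial>lborel"], of 0])
      fix n
      have "(\<integral>s. norm (indicator I s *\<^sub>R h n s) \<partial>lborel) \<le> (\<integral>s. c n * (indicator I s * (M + G s)) \<partial>lborel)"
        by (intro integral_mono integrable_norm int nb integrable_mult_right GI)
      then show "norm (\<integral>s. norm (indicator I s *\<^sub>R h n s) \<partial>lborel) \<le> c n * (\<integral>s. indicator I s * (M + G s) \<partial>lborel)"
        by simp
    qed
    have eq: "(\<Sum>n. indicator I s *\<^sub>R h n s) = indicator I s *\<^sub>R ?H s" for s
    proof (cases "s \<in> I")
      case True
      then show ?thesis using sums_unique[OF hs[OF Isub[OF True]]] by simp
    qed simp
    have "integrable lborel (\<lambda>s. \<Sum>n. indicator I s *\<^sub>R h n s)"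
      by (rule integrable_suminf[OF int AE_I2[OF sm] sm2])
    moreover have "(\<lambda>n. \<integral>s. indicator I s *\<^sub>R h n s \<partial>lborel) sums (\<integral>s. (\<Sum>n. indicator I s *\<^sub>R h n s) \<partial>lborel)"
      by (rule sums_integral[OF int AE_I2[OF sm] sm2])
    ultimately show ?thesis
      unfolding eq set_integrable_def set_lebesgue_integral_def I_def[symmetric] by (rule conjI)
  qed
  show ?thesis
  proof (rule weak_derivI)
    show "set_integrable lborel {0..1} ?H" using exch[of 1] by simp
    fix T :: real assume T: "T \<in> {0..1}"
    have fs: "(\<lambda>n. pois n ((1 - s) * R) * f n s) sums ?F s" if "s \<in> {0..1}" for s
      unfolding f_def fflow_def by (intro summable_sums fflow_summable[OF r(1)[OF that] x[OF that]])
    have "(\<lambda>n. pois n ((1 - 0) * R) * f n 0 + (LINT s:{0..T}|lborel. h n s)) sums (?F 0 + (LINT s:{0..T}|lborel. ?H s))"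
      using exch[OF T] by (intro sums_add fs) auto
    moreover have "pois n ((1 - 0) * R) * f n 0 + (LINT s:{0..T}|lborel. h n s) = pois n ((1 - T) * R) * f n T" for n
      by (rule weak_derivD(2)[OF wh[of n] T, symmetric])
    ultimately have "(\<lambda>n. pois n ((1 - T) * R) * f n T) sums (?F 0 + (LINT s:{0..T}|lborel. ?H s))"
      by (simp only:)
    with fs[OF T] show "?F T = ?F 0 + (LINT s:{0..T}|lborel. ?H s)" by (rule sums_unique2)
  qed
qed

end

section \<open>Identification of the semigroup\<close>

text \<open>The bridge from the unordered sums of the definitions to integrals over the counting
  measure, where Fubini and dominated convergence are at hand.\<close>

lemma has_sum_nonneg_count_space:
  fixes f :: "'a \<Rightarrow> real"
  assumes "(f has_sum c) UNIV" "\<And>x. 0 \<le> f x"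
  shows "integrable (count_space UNIV) f" "(\<integral>x. f x \<partial>count_space UNIV) = c"
proof -
  have "f summable_on UNIV" using assms(1) by (auto simp: summable_on_def)
  then have *: "Infinite_Set_Sum.abs_summable_on f UNIV"
    unfolding abs_summable_equivalent[symmetric] by (rule summable_on_iff_abs_summable_on_real[THEN iffD1])
  then show "integrable (count_space UNIV) f" by (simp add: abs_summable_on_def)
  then show "(\<integral>x. f x \<partial>count_space UNIV) = c"
    using infsetsum_infsum[OF *] infsumI[OF assms(1)] by (simp add: infsetsum_def)
qed

lemma P2c_nonneg: "\<rho> \<in> P2c \<delta> \<Longrightarrow> 0 \<le> \<rho> \<kappa>"
  by (simp add: P2c_def)

lemma P2c_integrable:
  assumes "\<rho> \<in> P2c \<delta>" "0 < \<delta>"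
  shows "integrable (count_space UNIV) \<rho>" "(\<integral>\<kappa>. \<rho> \<kappa> \<partial>count_space UNIV) = 1 / \<delta>"
proof -
  have "((\<lambda>\<kappa>. \<delta> * \<rho> \<kappa>) has_sum 1) UNIV" "\<And>\<kappa>. 0 \<le> \<delta> * \<rho> \<kappa>" using assms by (auto simp: P2c_def)
  note h = has_sum_nonneg_count_space[OF this]
  show "integrable (count_space UNIV) \<rho>" using h(1) assms(2) by simp
  show "(\<integral>\<kappa>. \<rho> \<kappa> \<partial>count_space UNIV) = 1 / \<delta>" using h(2) assms(2) by (simp add: field_simps)
qed

lemma P2c_second_moment:
  assumes "\<rho> \<in> P2c \<delta>" "0 < \<delta>"
  shows "integrable (count_space UNIV) (\<lambda>\<kappa>. (1 + (real_of_int \<kappa>)\<^sup>2) * \<rho> \<kappa>)"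
proof -
  let ?f = "\<lambda>\<kappa>. \<delta> * (\<delta> * real_of_int \<kappa>)\<^sup>2 * \<rho> \<kappa>"
  have "?f summable_on UNIV" using assms by (simp add: P2c_def)
  then obtain c where "(?f has_sum c) UNIV" by (auto simp: summable_on_def)
  from has_sum_nonneg_count_space(1)[OF this] have "integrable (count_space UNIV) ?f"
    using assms by (simp add: P2c_nonneg)
  then have "integrable (count_space UNIV) (\<lambda>\<kappa>. \<delta> ^ 3 * ((real_of_int \<kappa>)\<^sup>2 * \<rho> \<kappa>))"
    by (simp add: power2_eq_square power3_eq_cube mult_ac)
  then have "integrable (count_space UNIV) (\<lambda>\<kappa>. (real_of_int \<kappa>)\<^sup>2 * \<rho> \<kappa>)" using assms by simp
  then have "integrable (count_space UNIV) (\<lambda>\<kappa>. \<rho> \<kappa> + (real_of_int \<kappa>)\<^sup>2 * \<rho> \<kappa>)"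
    by (intro Bochner_Integration.integrable_add P2c_integrable(1)[OF assms])
  then show ?thesis by (simp add: distrib_right)
qed

lemma P2c_nn_integral:
  assumes "\<rho> \<in> P2c \<delta>" "0 < \<delta>"
  shows "(\<integral>\<^sup>+ \<kappa>. ennreal (\<rho> \<kappa>) \<partial>count_space UNIV) = ennreal (1 / \<delta>)"
  using nn_integral_eq_integral[OF P2c_integrable(1)[OF assms]] P2c_integrable(2)[OF assms] P2c_nonneg[OF assms(1)]
  by simp

lemma P2c_le:
  assumes "\<rho> \<in> P2c \<delta>" "0 < \<delta>"
  shows "\<bar>\<rho> \<kappa>\<bar> \<le> 1 / \<delta>"
proof -
  have "ennreal (\<rho> \<kappa>) \<le> ennreal (1 / \<delta>)"
    unfolding P2c_nn_integral[OF assms, symmetric] by (rule nn_integral_ge_point) simp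
  then show ?thesis using assms P2c_nonneg[OF assms(1)] by simp
qed

lemma dlap_bound:
  assumes "\<And>\<kappa>. \<bar>f \<kappa>\<bar> \<le> C"
  shows "\<bar>dlap \<delta> f \<kappa>\<bar> \<le> 4 * C / \<delta>\<^sup>2"
proof -
  have "\<bar>f (\<kappa> + 1) + f (\<kappa> - 1) - 2 * f \<kappa>\<bar> \<le> 4 * C"
    using assms[of "\<kappa> + 1"] assms[of "\<kappa> - 1"] assms[of \<kappa>] by linarith
  then show ?thesis by (simp add: dlap_def abs_divide divide_right_mono)
qed

lemma fflow_0 [simp]: "fflow \<alpha> 0 f = f"
proof
  fix \<kappa>
  have "(\<lambda>n. pois n 0 * (fstep \<alpha> ^^ n) f \<kappa>) = (\<lambda>n. if n = 0 then f \<kappa> else 0)" by auto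
  then show "fflow \<alpha> 0 f \<kappa> = f \<kappa>"
    unfolding fflow_def using sums_unique[OF sums_single[of 0 "\<lambda>_. f \<kappa>"]] by simp
qed

lemma fflow_zero [simp]: "fflow \<alpha> r (\<lambda>_. 0) = (\<lambda>_. 0)"
proof -
  have "(fstep \<alpha> ^^ n) (\<lambda>_. 0) = (\<lambda>_. 0)" for n
    by (induction n) (simp_all add: fstep_def[abs_def])
  then show ?thesis by (simp add: fflow_def[abs_def])
qed

text \<open>\<open>A\<close> bounds the rates and \<open>c\<close> is the intensity of the Poisson
  clock: real time \<open>t\<close> corresponds to the flow parameter \<open>c * t\<close>.\<close>

locale lattice_potential =
  fixes \<delta> A :: real and V :: "int \<Rightarrow> real" and \<alpha> :: "int \<Rightarrow> real" and c :: real
  assumes \<delta>: "0 < \<delta>" and A: "0 < A"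
    and lap_pos: "\<And>\<kappa>. 0 < dlap \<delta> V \<kappa>" and lap_le: "\<And>\<kappa>. dlap \<delta> V \<kappa> \<le> A"
    and \<alpha>_def: "\<alpha> = (\<lambda>\<kappa>. dlap \<delta> V \<kappa> / A)" and c_def: "c = 2 * A / \<delta>\<^sup>2"
begin

sublocale rates \<alpha>
  using A lap_pos lap_le by unfold_locales (auto simp: \<alpha>_def)

lemma c_pos: "0 < c" using \<delta> A by (simp add: c_def)

lemma generator: "c * (fstep \<alpha> f \<kappa> - f \<kappa>) = dlap \<delta> (\<lambda>j. f j * dlap \<delta> V j) \<kappa>"
proof -
  have a: "dlap \<delta> V j = A * \<alpha> j" for j using A by (simp add: \<alpha>_def)
  have "2 * A / d * (((1 - a0) * f0 + (a1 * f1 + am * fm) / 2) - f0)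
      = (f1 * (A * a1) + fm * (A * am) - 2 * (f0 * (A * a0))) / d" if "d \<noteq> 0" for a0 a1 am f0 f1 fm d :: real
    using that by (simp add: field_simps)
  from this[of "\<delta>\<^sup>2"] show ?thesis
    using \<delta> unfolding a c_def fstep_def dlap_def[of _ "\<lambda>j. f j * (A * \<alpha> j)"] by simp
qed

text \<open>Uniqueness by transport: \<open>s \<mapsto> fflow \<alpha> ((1 - s) * (c * t)) (S (s *
  t) \<rho>)\<close> has zero derivative by Duhamel's formula, and its end values are the two sides.
  Membership of the orbit in \<open>P2c\<close> provides the uniform bound that the series
  requires.\<close>

lemma semigroup_eq_fflow:
  assumes S: "generated_semigroup \<delta> V S" and \<rho>: "\<rho> \<in> P2c \<delta>" and t: "0 \<le> t"
  shows "S t \<rho> = fflow \<alpha> (c * t) \<rho>"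
proof
  fix \<kappa>
  define x where "x s = S (s * t) \<rho>" for s
  define g where "g s \<kappa> = t * dlap \<delta> (\<lambda>j. x s j * dlap \<delta> V j) \<kappa>" for s \<kappa>
  have xP: "x s \<in> P2c \<delta>" if "s \<in> {0..1}" for s
    using S \<rho> t that by (simp add: x_def generated_semigroup_def)
  have der: "((\<lambda>s. x s \<kappa>) has_real_derivative g s \<kappa>) (at s within {0..1})" if s: "s \<in> {0..1}" for s \<kappa>
  proof -
    have "((\<lambda>s. S s \<rho> \<kappa>) has_real_derivative dlap \<delta> (\<lambda>j. x s j * dlap \<delta> V j) \<kappa>) (at (s * t) within {0..})"
      using S \<rho> t s by (simp add: x_def generated_semigroup_def)
    then have "((\<lambda>s. S s \<rho> \<kappa>) has_real_derivative dlap \<delta> (\<lambda>j. x s j * dlap \<delta> V j) \<kappa>) (at (s * t) within ((\<lambda>s. s * t) ` {0..1}))"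
      by (rule DERIV_subset) (use t in auto)
    moreover have "((\<lambda>s. s * t) has_real_derivative t) (at s within {0..1})"
      by (auto intro!: derivative_eq_intros)
    ultimately have "(((\<lambda>s. S s \<rho> \<kappa>) \<circ> (\<lambda>s. s * t)) has_real_derivative dlap \<delta> (\<lambda>j. x s j * dlap \<delta> V j) \<kappa> * t) (at s within {0..1})"
      by (rule DERIV_image_chain)
    then show ?thesis by (simp add: o_def x_def g_def mult.commute)
  qed
  have cx: "continuous_on {0..1} (\<lambda>s. x s \<kappa>)" for \<kappa>
    by (rule DERIV_continuous_on[OF der])
  have cg: "continuous_on {0..1} (\<lambda>s. g s \<kappa>)" for \<kappa>
    unfolding g_def dlap_def[of _ "\<lambda>j. _ j * _ j"] by (intro continuous_intros cx) (use \<delta> in auto)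
  have wd: "weak_deriv_01 (\<lambda>s. x s \<kappa>) (\<lambda>s. g s \<kappa>)" for \<kappa>
  proof (rule weak_derivI)
    show "set_integrable lborel {0..1} (\<lambda>s. g s \<kappa>)" by (rule borel_integrable_atLeastAtMost'[OF cg])
    show "x T \<kappa> = x 0 \<kappa> + (LINT s:{0..T}|lborel. g s \<kappa>)" if T: "T \<in> {0..1}" for T
    proof -
      have "(LINT s:{0..T}|lborel. g s \<kappa>) = x T \<kappa> - x 0 \<kappa>"
        unfolding set_lebesgue_integral_def
      proof (rule integral_FTC_atLeastAtMost)
        show "((\<lambda>s. x s \<kappa>) has_vector_derivative g s \<kappa>) (at s within {0..T})" if "0 \<le> s" "s \<le> T" for s
          using T that DERIV_subset[OF der[of s \<kappa>], of "{0..T}"]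
          by (auto simp: has_real_derivative_iff_has_vector_derivative[symmetric])
        show "continuous_on {0..T} (\<lambda>s. g s \<kappa>)" using T by (intro continuous_on_subset[OF cg]) auto
      qed (use T in auto)
      then show ?thesis by simp
    qed
  qed
  have xb: "\<bar>x s \<kappa>\<bar> \<le> 1 / \<delta>" if "s \<in> {0..1}" for s \<kappa> by (rule P2c_le[OF xP[OF that] \<delta>])
  have gb: "\<bar>g s \<kappa>\<bar> \<le> t * (4 * (1 / \<delta> * A) / \<delta>\<^sup>2)" if "s \<in> {0..1}" for s \<kappa>
  proof -
    have "\<bar>x s j * dlap \<delta> V j\<bar> \<le> 1 / \<delta> * A" for j
      unfolding abs_mult using xb[OF that, of j] lap_pos[of j] lap_le[of j] \<delta>
      by (intro mult_mono) auto
    from mult_left_mono[OF dlap_bound[of "\<lambda>j. x s j * dlap \<delta> V j", OF this] t] show ?thesis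
      unfolding g_def abs_mult using t by simp
  qed
  have Gi: "set_integrable lborel {0..1} (\<lambda>s::real. t * (4 * (1 / \<delta> * A) / \<delta>\<^sup>2))"
    by (intro borel_integrable_atLeastAtMost' continuous_intros)
  have ct: "0 \<le> c * t" using c_pos t by simp
  have "weak_deriv_01 (\<lambda>s. fflow \<alpha> ((1 - s) * (c * t)) (x s) \<kappa>)
     (\<lambda>s. fflow \<alpha> ((1 - s) * (c * t)) (\<lambda>j. g s j - c * t * (fstep \<alpha> (x s) j - x s j)) \<kappa>)"
    by (rule weak_deriv_fflow[OF wd xb gb Gi ct])
  moreover have "g s j - c * t * (fstep \<alpha> (x s) j - x s j) = 0" for s j
    using generator[of "x s" j] by (simp add: g_def mult.commute mult.left_commute)
  ultimately have "weak_deriv_01 (\<lambda>s. fflow \<alpha> ((1 - s) * (c * t)) (x s) \<kappa>) (\<lambda>s. 0)" by simp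
  \<comment> \<open>At \<open>s = 1\<close> the flow parameter is 0, at \<open>s = 0\<close> it is
    \<open>c * t\<close>.\<close>
  from weak_derivD(2)[OF this, of 1] have "x 1 \<kappa> = fflow \<alpha> (c * t) (x 0) \<kappa>" by simp
  then show "S t \<rho> \<kappa> = fflow \<alpha> (c * t) \<rho> \<kappa>" using S \<rho> by (simp add: x_def generated_semigroup_def)
qed

end

section \<open>Summation by parts\<close>

lemma integrable_int_shift:
  fixes f :: "int \<Rightarrow> real"
  shows "integrable (count_space UNIV) (\<lambda>\<kappa>. f (\<kappa> + k)) \<longleftrightarrow> integrable (count_space UNIV) f"
    and integral_int_shift: "(\<integral>\<kappa>. f (\<kappa> + k) \<partial>count_space UNIV) = (\<integral>\<kappa>. f \<kappa> \<partial>count_space UNIV)"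
proof -
  have "bij_betw (\<lambda>\<kappa>. \<kappa> + k) UNIV UNIV" by (rule bij_betwI[of _ _ _ "\<lambda>x. x - k"]) simp_all
  note integrable_bij_count_space[OF this, of f] integral_bij_count_space[OF this, of f]
  then show "integrable (count_space UNIV) (\<lambda>\<kappa>. f (\<kappa> + k)) \<longleftrightarrow> integrable (count_space UNIV) f"
    "(\<integral>\<kappa>. f (\<kappa> + k) \<partial>count_space UNIV) = (\<integral>\<kappa>. f \<kappa> \<partial>count_space UNIV)" by blast+
qed

lemma integrable_count_space_bounded_mult:
  fixes m :: "int \<Rightarrow> real"
  assumes "integrable (count_space UNIV) m" "\<And>\<kappa>. \<bar>\<phi> \<kappa>\<bar> \<le> C"
  shows "integrable (count_space UNIV) (\<lambda>\<kappa>. \<phi> \<kappa> * m \<kappa>)"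
proof (rule Bochner_Integration.integrable_bound)
  show "integrable (count_space UNIV) (\<lambda>\<kappa>. C * m \<kappa>)" using assms(1) by simp
  have "\<bar>\<phi> \<kappa>\<bar> * \<bar>m \<kappa>\<bar> \<le> \<bar>C\<bar> * \<bar>m \<kappa>\<bar>" for \<kappa>
    using assms(2)[of \<kappa>] by (intro mult_right_mono) auto
  then show "AE \<kappa> in count_space UNIV. norm (\<phi> \<kappa> * m \<kappa>) \<le> norm (C * m \<kappa>)" by (simp add: abs_mult)
qed simp

lemma green_bounded:
  assumes m: "integrable (count_space UNIV) m" and \<phi>: "\<And>\<kappa>. \<bar>\<phi> \<kappa>\<bar> \<le> C"
  shows "(\<integral>\<kappa>. \<phi> \<kappa> * dlap \<delta> m \<kappa> \<partial>count_space UNIV) = (\<integral>\<kappa>. dlap \<delta> \<phi> \<kappa> * m \<kappa> \<partial>count_space UNIV)"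
proof -
  note b = integrable_count_space_bounded_mult
  have i1: "integrable (count_space UNIV) (\<lambda>\<kappa>. \<phi> \<kappa> * m (\<kappa> + k))" for k
    using m by (intro b[OF _ \<phi>]) (simp add: integrable_int_shift)
  have i2: "integrable (count_space UNIV) (\<lambda>\<kappa>. \<phi> (\<kappa> + k) * m \<kappa>)" for k
    by (rule b[OF m, of _ C]) (rule \<phi>)
  have sh: "(\<integral>\<kappa>. \<phi> \<kappa> * m (\<kappa> + k) \<partial>count_space UNIV) = (\<integral>\<kappa>. \<phi> (\<kappa> - k) * m \<kappa> \<partial>count_space UNIV)" for k
    using integral_int_shift[of "\<lambda>\<kappa>. \<phi> (\<kappa> - k) * m \<kappa>" k] by simp
  have "(\<integral>\<kappa>. \<phi> \<kappa> * dlap \<delta> m \<kappa> \<partial>count_space UNIV)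
      = (\<integral>\<kappa>. (\<phi> \<kappa> * m (\<kappa> + 1) + \<phi> \<kappa> * m (\<kappa> + -1) - 2 * (\<phi> \<kappa> * m (\<kappa> + 0))) / \<delta>\<^sup>2 \<partial>count_space UNIV)"
    by (simp add: dlap_def algebra_simps)
  also have "\<dots> = ((\<integral>\<kappa>. \<phi> \<kappa> * m (\<kappa> + 1) \<partial>count_space UNIV) + (\<integral>\<kappa>. \<phi> \<kappa> * m (\<kappa> + -1) \<partial>count_space UNIV)
      - 2 * (\<integral>\<kappa>. \<phi> \<kappa> * m (\<kappa> + 0) \<partial>count_space UNIV)) / \<delta>\<^sup>2"
    using i1[of 1] i1[of "-1"] i1[of 0] by simp
  also have "\<dots> = ((\<integral>\<kappa>. \<phi> (\<kappa> + -1) * m \<kappa> \<partial>count_space UNIV) + (\<integral>\<kappa>. \<phi> (\<kappa> + 1) * m \<kappa> \<partial>count_space UNIV)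
      - 2 * (\<integral>\<kappa>. \<phi> (\<kappa> + 0) * m \<kappa> \<partial>count_space UNIV)) / \<delta>\<^sup>2"
    unfolding sh by simp
  also have "\<dots> = (\<integral>\<kappa>. (\<phi> (\<kappa> + -1) * m \<kappa> + \<phi> (\<kappa> + 1) * m \<kappa> - 2 * (\<phi> (\<kappa> + 0) * m \<kappa>)) / \<delta>\<^sup>2 \<partial>count_space UNIV)"
    using i2[of 1] i2[of "-1"] i2[of 0] by simp
  also have "\<dots> = (\<integral>\<kappa>. dlap \<delta> \<phi> \<kappa> * m \<kappa> \<partial>count_space UNIV)"
    by (simp add: dlap_def algebra_simps)
  finally show ?thesis .
qed

section \<open>Growth of the potential and of its increments\<close>

lemma int_linear_growth:
  fixes f :: "int \<Rightarrow> real"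
  assumes "\<And>\<kappa>. \<bar>f (\<kappa> + 1) - f \<kappa>\<bar> \<le> D" "\<bar>f 0\<bar> \<le> D"
  shows "\<bar>f \<kappa>\<bar> \<le> D * (1 + \<bar>real_of_int \<kappa>\<bar>)"
proof (induction \<kappa> rule: int_induct[of _ 0])
  case (step1 i)
  then show ?case using assms(1)[of i] by (simp add: algebra_simps)
next
  case (step2 i)
  then show ?case using assms(1)[of "i - 1"] by (simp add: algebra_simps)
qed (use assms in simp)

lemma int_quadratic_growth:
  fixes f :: "int \<Rightarrow> real"
  assumes D: "\<And>\<kappa>. \<bar>f (\<kappa> + 1) - f \<kappa>\<bar> \<le> D * (1 + \<bar>real_of_int \<kappa>\<bar>)" "\<bar>f 0\<bar> \<le> D"
  shows "\<bar>f \<kappa>\<bar> \<le> 2 * D * (1 + (real_of_int \<kappa>)\<^sup>2)"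
proof -
  have D0: "0 \<le> D" using D(2) by linarith
  \<comment> \<open>The induction closes with this square, whose increments dominate those of
    \<open>f\<close>. The form \<open>1 + \<kappa>\<^sup>2\<close>, adapted to second moments, is
    reached afterwards at the price of a factor 2.\<close>
  have "\<bar>f \<kappa>\<bar> \<le> D * (1 + \<bar>real_of_int \<kappa>\<bar>)\<^sup>2"
  proof (induction \<kappa> rule: int_induct[of _ 0])
    case (step1 i)
    have "\<bar>f (i + 1)\<bar> \<le> D * (1 + \<bar>real_of_int i\<bar>)\<^sup>2 + D * (1 + \<bar>real_of_int i\<bar>)" using step1 D(1)[of i] by linarith
    also have "\<dots> = D * ((1 + real_of_int i)\<^sup>2 + (1 + real_of_int i))" using step1 by (simp add: distrib_left)
    also have "\<dots> \<le> D * (1 + \<bar>real_of_int (i + 1)\<bar>)\<^sup>2"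
      using step1 D0 by (intro mult_left_mono) (auto simp: power2_eq_square algebra_simps)
    finally show ?case .
  next
    case (step2 i)
    have "\<bar>f (i - 1)\<bar> \<le> D * (1 + \<bar>real_of_int i\<bar>)\<^sup>2 + D * (1 + \<bar>real_of_int (i - 1)\<bar>)" using step2 D(1)[of "i - 1"] by simp
    also have "\<dots> = D * ((1 - real_of_int i)\<^sup>2 + (2 - real_of_int i))" using step2 by (simp add: distrib_left)
    also have "\<dots> \<le> D * (1 + \<bar>real_of_int (i - 1)\<bar>)\<^sup>2"
      using step2 D0 by (intro mult_left_mono) (auto simp: power2_eq_square algebra_simps)
    finally show ?case .
  qed (use D in simp)
  also have "\<dots> \<le> D * (2 * (1 + (real_of_int \<kappa>)\<^sup>2))"
  proof (intro mult_left_mono D0)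
    have "0 \<le> (1 - \<bar>real_of_int \<kappa>\<bar>)\<^sup>2" by simp
    then show "(1 + \<bar>real_of_int \<kappa>\<bar>)\<^sup>2 \<le> 2 * (1 + (real_of_int \<kappa>)\<^sup>2)"
      by (simp add: power2_eq_square algebra_simps flip: abs_mult)
  qed
  finally show ?thesis by (simp add: mult_ac)
qed

text \<open>Second differences are at most \<open>\<delta>\<^sup>2 * A\<close>, so increments grow
  linearly and \<open>V\<close> quadratically; hence \<open>V\<close> can be integrated against
  measures with finite second moment.\<close>

lemma dlap_bounded_growth:
  assumes \<delta>: "0 < \<delta>" and bd: "\<And>\<kappa>. \<bar>dlap \<delta> V \<kappa>\<bar> \<le> A"
  obtains D where "0 \<le> D" "\<And>\<kappa>. \<bar>V (\<kappa> + 1) - V \<kappa>\<bar> \<le> D * (1 + \<bar>real_of_int \<kappa>\<bar>)"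
    "\<And>\<kappa>. \<bar>V \<kappa>\<bar> \<le> 2 * D * (1 + (real_of_int \<kappa>)\<^sup>2)"
proof -
  define D where "D = max \<bar>V 0\<bar> (max \<bar>V 1 - V 0\<bar> (\<delta>\<^sup>2 * A))"
  have "\<bar>(V (\<kappa> + 1 + 1) - V (\<kappa> + 1)) - (V (\<kappa> + 1) - V \<kappa>)\<bar> \<le> D" for \<kappa>
  proof -
    have "(V (\<kappa> + 1 + 1) - V (\<kappa> + 1)) - (V (\<kappa> + 1) - V \<kappa>) = \<delta>\<^sup>2 * dlap \<delta> V (\<kappa> + 1)"
      using \<delta> by (simp add: dlap_def)
    also have "\<bar>\<dots>\<bar> \<le> \<delta>\<^sup>2 * A" using bd[of "\<kappa> + 1"] by (simp add: abs_mult mult_left_mono)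
    finally show ?thesis by (simp add: D_def)
  qed
  then have V1: "\<bar>V (\<kappa> + 1) - V \<kappa>\<bar> \<le> D * (1 + \<bar>real_of_int \<kappa>\<bar>)" for \<kappa>
    using int_linear_growth[of "\<lambda>\<kappa>. V (\<kappa> + 1) - V \<kappa>" D \<kappa>] by (simp add: D_def)
  then have V0: "\<bar>V \<kappa>\<bar> \<le> 2 * D * (1 + (real_of_int \<kappa>)\<^sup>2)" for \<kappa>
    by (rule int_quadratic_growth) (simp add: D_def)
  have D0: "0 \<le> D" by (simp add: D_def)
  show ?thesis using that D0 V1 V0 by blast
qed

text \<open>The weight \<open>2 + \<bar>x\<bar>\<close> matches the linear growth of the increments
  of \<open>V\<close>. The difference of the cutoffs is \<open>e * (2 * x + 1)\<close> over two
  denominators, one of which absorbs \<open>e * x\<^sup>2\<close>. The hypothesis on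
  \<open>x\<close> holds for integers, and inserting \<open>- x\<close> gives the backward
  difference.\<close>

lemma cutoff_diff1:
  fixes x e :: real
  assumes e: "0 \<le> e" "e \<le> 1" and x: "\<bar>x\<bar> \<le> x\<^sup>2"
  shows "\<bar>1 / (1 + e * (x + 1)\<^sup>2) - 1 / (1 + e * x\<^sup>2)\<bar> * (2 + \<bar>x\<bar>) \<le> 9"
proof -
  define d d' where "d = 1 + e * x\<^sup>2" and "d' = 1 + e * (x + 1)\<^sup>2"
  have d: "1 \<le> d" "1 \<le> d'" using e by (auto simp: d_def d'_def)
  have "1 / d' - 1 / d = (d - d') / (d' * d)" using d by (simp add: field_simps)
  also have "d - d' = - (e * (2 * x + 1))" by (simp add: d_def d'_def power2_eq_square algebra_simps)
  finally have "\<bar>1 / d' - 1 / d\<bar> = e * \<bar>2 * x + 1\<bar> / (d' * d)"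
    using d e by (simp add: abs_mult abs_divide)
  then have "\<bar>1 / d' - 1 / d\<bar> * (2 + \<bar>x\<bar>) = e * (\<bar>2 * x + 1\<bar> * (2 + \<bar>x\<bar>)) / (d' * d)" by simp
  also have "\<dots> \<le> 9 * d / (1 * d)"
  proof (intro frac_le mult_right_mono)
    have "\<bar>2 * x + 1\<bar> * (2 + \<bar>x\<bar>) \<le> (2 * \<bar>x\<bar> + 1) * (2 + \<bar>x\<bar>)" by (intro mult_right_mono) auto
    also have "\<dots> = 2 * x\<^sup>2 + 5 * \<bar>x\<bar> + 2" by (simp add: power2_eq_square algebra_simps flip: abs_mult)
    also have "\<dots> \<le> 7 * x\<^sup>2 + 2" using x by simp
    finally have "e * (\<bar>2 * x + 1\<bar> * (2 + \<bar>x\<bar>)) \<le> e * (7 * x\<^sup>2 + 2)" using e by (intro mult_left_mono)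
    also have "\<dots> \<le> 7 * (e * x\<^sup>2) + 2" using e by (simp add: algebra_simps)
    also have "\<dots> \<le> 9 * d" using e by (simp add: d_def)
    finally show "e * (\<bar>2 * x + 1\<bar> * (2 + \<bar>x\<bar>)) \<le> 9 * d" .
  qed (use d in auto)
  also have "\<dots> = 9" using d by simp
  finally show ?thesis by (simp add: d_def d'_def)
qed

text \<open>Second differences of the cutoff have to offset the quadratic growth of
  \<open>V\<close>, uniformly in \<open>e\<close>. The numerator is at most
  \<open>12 * e * d\<close>, and \<open>p * m\<close> dominates \<open>d\<close> because one
  neighbour of \<open>x\<close> lies at least as far from 0 as \<open>x\<close>.\<close>

lemma cutoff_diff2:
  fixes x e :: real
  assumes e: "0 \<le> e" "e \<le> 1"
  shows "\<bar>1 / (1 + e * (x + 1)\<^sup>2) + 1 / (1 + e * (x - 1)\<^sup>2) - 2 * (1 / (1 + e * x\<^sup>2))\<bar> * (1 + x\<^sup>2) \<le> 12"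
proof -
  define d p m where "d = 1 + e * x\<^sup>2" and "p = 1 + e * (x + 1)\<^sup>2" and "m = 1 + e * (x - 1)\<^sup>2"
  have d: "1 \<le> d" "1 \<le> p" "1 \<le> m" using e by (auto simp: d_def p_def m_def)
  have "d \<le> max p m"
  proof (cases "x \<ge> 0")
    case True
    then have "d \<le> p" using e by (auto simp: d_def p_def intro!: mult_left_mono power_mono)
    then show ?thesis by simp
  next
    case False
    then have "x\<^sup>2 \<le> (x - 1)\<^sup>2" by (simp add: power2_eq_square algebra_simps)
    then have "d \<le> m" using e by (auto simp: d_def m_def intro!: mult_left_mono)
    then show ?thesis by simp
  qed
  also have "max p m \<le> p * m" using d by simp
  finally have dpm: "d \<le> p * m" .
  have "1 / p + 1 / m - 2 * (1 / d) = (d * (p + m) - 2 * (p * m)) / (d * (p * m))" using d by (simp add: field_simps)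
  also have "d * (p + m) - 2 * (p * m) = e * (8 * (e * x\<^sup>2) - 2 * d - 2 * e)"
    by (simp add: d_def p_def m_def power2_eq_square algebra_simps)
  finally have "\<bar>1 / p + 1 / m - 2 * (1 / d)\<bar> = e * \<bar>8 * (e * x\<^sup>2) - 2 * d - 2 * e\<bar> / (d * (p * m))"
    using d e by (simp add: abs_mult abs_divide)
  then have "\<bar>1 / p + 1 / m - 2 * (1 / d)\<bar> * (1 + x\<^sup>2) = (e * (1 + x\<^sup>2)) * \<bar>8 * (e * x\<^sup>2) - 2 * d - 2 * e\<bar> / (d * (p * m))"
    by simp
  also have "\<dots> \<le> d * (12 * d) / (d * d)"
  proof (intro frac_le mult_mono mult_left_mono dpm)
    show "e * (1 + x\<^sup>2) \<le> d" using e by (simp add: d_def algebra_simps)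
    have "\<bar>8 * y - 2 * (1 + y) - 2 * e\<bar> \<le> 12 * (1 + y)" if "0 \<le> y" for y
      using e that by (intro abs_leI) (simp_all add: algebra_simps)
    then show "\<bar>8 * (e * x\<^sup>2) - 2 * d - 2 * e\<bar> \<le> 12 * d" using e unfolding d_def by simp
  qed (use d e in auto)
  also have "\<dots> = 12" using d by simp
  finally show ?thesis by (simp add: d_def p_def m_def)
qed

text \<open>The potential grows quadratically while \<open>m\<close> is only summable, so summation by parts
  is done for the bounded functions \<open>V / (1 + e \<kappa>\<^sup>2)\<close>, whose discrete Laplacians are bounded
  uniformly in \<open>e\<close>.\<close>

lemma green_quadratic:
  assumes \<delta>: "0 < \<delta>" and bd: "\<And>\<kappa>. \<bar>dlap \<delta> V \<kappa>\<bar> \<le> A"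
    and m: "integrable (count_space UNIV) m"
    and q: "integrable (count_space UNIV) (\<lambda>\<kappa>. (1 + (real_of_int \<kappa>)\<^sup>2) * dlap \<delta> m \<kappa>)"
  shows "(\<integral>\<kappa>. V \<kappa> * dlap \<delta> m \<kappa> \<partial>count_space UNIV) = (\<integral>\<kappa>. dlap \<delta> V \<kappa> * m \<kappa> \<partial>count_space UNIV)"
proof -
  obtain D where D0: "0 \<le> D" and V1: "\<And>\<kappa>. \<bar>V (\<kappa> + 1) - V \<kappa>\<bar> \<le> D * (1 + \<bar>real_of_int \<kappa>\<bar>)"
    and V0: "\<And>\<kappa>. \<bar>V \<kappa>\<bar> \<le> 2 * D * (1 + (real_of_int \<kappa>)\<^sup>2)"
    using dlap_bounded_growth[OF \<delta> bd] by blast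
  define \<theta> where "\<theta> e \<kappa> = 1 / (1 + e * (real_of_int \<kappa>)\<^sup>2)" for e \<kappa>
  have \<theta>: "0 \<le> \<theta> e \<kappa>" "\<theta> e \<kappa> \<le> 1" if "0 \<le> e" for e \<kappa>
  proof -
    have "1 \<le> 1 + e * (real_of_int \<kappa>)\<^sup>2" using that by simp
    then show "0 \<le> \<theta> e \<kappa>" "\<theta> e \<kappa> \<le> 1" by (simp_all add: \<theta>_def)
  qed
  \<comment> \<open>Discrete product rule: \<open>\<theta> \<Delta> V\<close>, two products of
    increments, and \<open>V \<Delta> \<theta>\<close>. Up to the division by
    \<open>\<delta>\<^sup>2\<close>, the last three are bounded by \<open>9 D\<close>,
    \<open>9 D\<close> and \<open>24 D\<close>, whence 42.\<close>
  have lap: "\<bar>dlap \<delta> (\<lambda>\<kappa>. V \<kappa> * \<theta> e \<kappa>) \<kappa>\<bar> \<le> A + 42 * D / \<delta>\<^sup>2" if e: "0 \<le> e" "e \<le> 1" for e \<kappa>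
  proof -
    let ?x = "real_of_int \<kappa>"
    have "\<bar>\<kappa>\<bar> \<le> \<kappa>\<^sup>2" by (metis abs_ge_zero int_one_le_iff_zero_less le_less mult_left_mono mult_cancel_left2 power2_abs power2_eq_square zero_le_power2 mult.right_neutral)
    then have x: "\<bar>?x\<bar> \<le> ?x\<^sup>2" by (metis of_int_abs of_int_le_iff of_int_power)
    then have x': "\<bar>- ?x\<bar> \<le> (- ?x)\<^sup>2" by simp
    have 1: "\<bar>\<theta> e (\<kappa> + 1) - \<theta> e \<kappa>\<bar> * (2 + \<bar>?x\<bar>) \<le> 9"
      using cutoff_diff1[OF e x] by (simp add: \<theta>_def)
    have 2: "\<bar>\<theta> e (\<kappa> - 1) - \<theta> e \<kappa>\<bar> * (2 + \<bar>?x\<bar>) \<le> 9"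
      using cutoff_diff1[OF e x'] by (simp add: \<theta>_def power2_commute[of 1 ?x])
    have 3: "\<bar>\<theta> e (\<kappa> + 1) + \<theta> e (\<kappa> - 1) - 2 * \<theta> e \<kappa>\<bar> * (1 + ?x\<^sup>2) \<le> 12"
      using cutoff_diff2[OF e, of ?x] by (simp add: \<theta>_def)
    have b: "\<bar>u * v\<bar> \<le> k * D" if "\<bar>u\<bar> \<le> l * D * z" "\<bar>v\<bar> * z \<le> k'" "l * k' \<le> k" "0 \<le> l" for u v k k' l z
    proof -
      have "\<bar>u * v\<bar> \<le> (l * D * z) * \<bar>v\<bar>" unfolding abs_mult using that by (intro mult_right_mono) auto
      also have "\<dots> = l * D * (\<bar>v\<bar> * z)" by simp
      also have "\<dots> \<le> l * D * k'" using that D0 by (intro mult_left_mono) auto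
      also have "\<dots> = (l * k') * D" by simp
      also have "\<dots> \<le> k * D" using that D0 by (intro mult_right_mono) auto
      finally show ?thesis .
    qed
    have e1: "\<bar>(V (\<kappa> + 1) - V \<kappa>) * (\<theta> e (\<kappa> + 1) - \<theta> e \<kappa>)\<bar> \<le> 9 * D"
    proof (rule b[OF _ 1])
      show "\<bar>V (\<kappa> + 1) - V \<kappa>\<bar> \<le> 1 * D * (2 + \<bar>?x\<bar>)"
        using V1[of \<kappa>] D0 by (simp add: algebra_simps)
    qed auto
    have e2: "\<bar>(V (\<kappa> - 1) - V \<kappa>) * (\<theta> e (\<kappa> - 1) - \<theta> e \<kappa>)\<bar> \<le> 9 * D"
    proof (rule b[OF _ 2])
      have "\<bar>V (\<kappa> - 1) - V \<kappa>\<bar> \<le> D * (1 + \<bar>real_of_int (\<kappa> - 1)\<bar>)" using V1[of "\<kappa> - 1"] by simp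
      also have "\<dots> \<le> D * (2 + \<bar>?x\<bar>)" using D0 by (intro mult_left_mono) auto
      finally show "\<bar>V (\<kappa> - 1) - V \<kappa>\<bar> \<le> 1 * D * (2 + \<bar>?x\<bar>)" by simp
    qed auto
    have e3: "\<bar>V \<kappa> * (\<theta> e (\<kappa> + 1) + \<theta> e (\<kappa> - 1) - 2 * \<theta> e \<kappa>)\<bar> \<le> 24 * D"
      by (rule b[OF V0 3]) auto
    have e4: "\<bar>dlap \<delta> V \<kappa> * \<theta> e \<kappa>\<bar> \<le> A * 1"
      unfolding abs_mult using bd[of \<kappa>] \<theta>[OF e(1), of \<kappa>] by (intro mult_mono) auto
    have "dlap \<delta> (\<lambda>\<kappa>. V \<kappa> * \<theta> e \<kappa>) \<kappa> = dlap \<delta> V \<kappa> * \<theta> e \<kappa> +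
       ((V (\<kappa> + 1) - V \<kappa>) * (\<theta> e (\<kappa> + 1) - \<theta> e \<kappa>) + (V (\<kappa> - 1) - V \<kappa>) * (\<theta> e (\<kappa> - 1) - \<theta> e \<kappa>)
        + V \<kappa> * (\<theta> e (\<kappa> + 1) + \<theta> e (\<kappa> - 1) - 2 * \<theta> e \<kappa>)) / \<delta>\<^sup>2"
    proof -
      have "(v1 * t1 + vm * tm - 2 * (v0 * t0)) / dd = (v1 + vm - 2 * v0) / dd * t0 +
        ((v1 - v0) * (t1 - t0) + (vm - v0) * (tm - t0) + v0 * (t1 + tm - 2 * t0)) / dd"
        if "dd \<noteq> 0" for v0 v1 vm t0 t1 tm dd :: real
        using that by (simp add: field_simps)
      then show ?thesis using \<delta> unfolding dlap_def by simp
    qed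
    also have "\<bar>\<dots>\<bar> \<le> A * 1 + (9 * D + 9 * D + 24 * D) / \<delta>\<^sup>2"
    proof (intro order_trans[OF abs_triangle_ineq] add_mono e4)
      show "\<bar>((V (\<kappa> + 1) - V \<kappa>) * (\<theta> e (\<kappa> + 1) - \<theta> e \<kappa>) + (V (\<kappa> - 1) - V \<kappa>) * (\<theta> e (\<kappa> - 1) - \<theta> e \<kappa>)
        + V \<kappa> * (\<theta> e (\<kappa> + 1) + \<theta> e (\<kappa> - 1) - 2 * \<theta> e \<kappa>)) / \<delta>\<^sup>2\<bar> \<le> (9 * D + 9 * D + 24 * D) / \<delta>\<^sup>2"
        unfolding abs_divide using \<delta> e1 e2 e3 by (auto intro!: divide_right_mono)
    qed
    finally show ?thesis by simp
  qed
  define \<epsilon> where "\<epsilon> n = inverse (real (Suc n))" for n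
  have \<epsilon>: "0 < \<epsilon> n" "\<epsilon> n \<le> 1" for n by (auto simp: \<epsilon>_def inverse_le_1_iff)
  have \<theta>lim: "(\<lambda>n. \<theta> (\<epsilon> n) \<kappa>) \<longlonglongrightarrow> 1" for \<kappa>
  proof -
    have "(\<lambda>n. 1 / (1 + \<epsilon> n * (real_of_int \<kappa>)\<^sup>2)) \<longlonglongrightarrow> 1 / (1 + 0 * (real_of_int \<kappa>)\<^sup>2)"
      unfolding \<epsilon>_def by (intro tendsto_intros LIMSEQ_inverse_real_of_nat) simp
    then show ?thesis by (simp add: \<theta>_def)
  qed
  have gr: "(\<integral>\<kappa>. (V \<kappa> * \<theta> (\<epsilon> n) \<kappa>) * dlap \<delta> m \<kappa> \<partial>count_space UNIV)
      = (\<integral>\<kappa>. dlap \<delta> (\<lambda>\<kappa>. V \<kappa> * \<theta> (\<epsilon> n) \<kappa>) \<kappa> * m \<kappa> \<partial>count_space UNIV)" for n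
  proof (rule green_bounded[OF m])
    show "\<bar>V \<kappa> * \<theta> (\<epsilon> n) \<kappa>\<bar> \<le> 2 * D / \<epsilon> n" for \<kappa>
    proof -
      have "\<bar>V \<kappa> * \<theta> (\<epsilon> n) \<kappa>\<bar> \<le> (2 * D * (1 + (real_of_int \<kappa>)\<^sup>2)) * \<theta> (\<epsilon> n) \<kappa>"
        unfolding abs_mult using V0[of \<kappa>] \<theta>[of "\<epsilon> n" \<kappa>] \<epsilon>(1)[of n] by (intro mult_mono) auto
      also have "\<dots> = 2 * D * ((1 + (real_of_int \<kappa>)\<^sup>2) * \<theta> (\<epsilon> n) \<kappa>)" by simp
      also have "\<dots> \<le> 2 * D * (1 / \<epsilon> n)"
      proof (intro mult_left_mono)
        have "0 < 1 + \<epsilon> n * (real_of_int \<kappa>)\<^sup>2" using \<epsilon>(1)[of n] by (intro add_pos_nonneg) auto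
        then show "(1 + (real_of_int \<kappa>)\<^sup>2) * \<theta> (\<epsilon> n) \<kappa> \<le> 1 / \<epsilon> n"
          using \<epsilon>[of n] by (simp add: \<theta>_def field_simps)
      qed (use D0 in simp)
      finally show ?thesis by simp
    qed
  qed
  \<comment> \<open>The dominating function on the left: \<open>V\<close> grows at most
    quadratically and \<open>q\<close> controls the second moment of \<open>dlap \<delta> m\<close>.
    On the right the Laplacians are uniformly bounded by \<open>lap\<close>, and \<open>m\<close> is
    summable.\<close>
  let ?b = "\<lambda>\<kappa>. 2 * D * \<bar>(1 + (real_of_int \<kappa>)\<^sup>2) * dlap \<delta> m \<kappa>\<bar>"
  have qi: "integrable (count_space UNIV) ?b" using q by (intro integrable_mult_right integrable_abs)
  have vb: "\<bar>V \<kappa> * t * dlap \<delta> m \<kappa>\<bar> \<le> ?b \<kappa>" if "0 \<le> t" "t \<le> 1" for t \<kappa>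
  proof -
    have "\<bar>V \<kappa> * t\<bar> \<le> (2 * D * (1 + (real_of_int \<kappa>)\<^sup>2)) * 1"
      unfolding abs_mult using V0[of \<kappa>] that D0 by (intro mult_mono) auto
    from mult_right_mono[OF this abs_ge_zero[of "dlap \<delta> m \<kappa>"]] show ?thesis by (simp add: abs_mult mult_ac)
  qed
  have L1: "(\<lambda>n. \<integral>\<kappa>. (V \<kappa> * \<theta> (\<epsilon> n) \<kappa>) * dlap \<delta> m \<kappa> \<partial>count_space UNIV) \<longlonglongrightarrow> (\<integral>\<kappa>. (V \<kappa> * 1) * dlap \<delta> m \<kappa> \<partial>count_space UNIV)"
  proof (rule integral_dominated_convergence[OF _ _ qi])
    show "AE \<kappa> in count_space UNIV. (\<lambda>n. V \<kappa> * \<theta> (\<epsilon> n) \<kappa> * dlap \<delta> m \<kappa>) \<longlonglongrightarrow> V \<kappa> * 1 * dlap \<delta> m \<kappa>"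
      by (intro AE_I2 tendsto_intros \<theta>lim)
    show "AE \<kappa> in count_space UNIV. norm (V \<kappa> * \<theta> (\<epsilon> n) \<kappa> * dlap \<delta> m \<kappa>) \<le> ?b \<kappa>" for n
      unfolding real_norm_def using \<epsilon>(1)[of n] by (intro AE_I2 vb \<theta>) auto
  qed auto
  have L2: "(\<lambda>n. \<integral>\<kappa>. dlap \<delta> (\<lambda>\<kappa>. V \<kappa> * \<theta> (\<epsilon> n) \<kappa>) \<kappa> * m \<kappa> \<partial>count_space UNIV) \<longlonglongrightarrow> (\<integral>\<kappa>. dlap \<delta> (\<lambda>\<kappa>. V \<kappa> * 1) \<kappa> * m \<kappa> \<partial>count_space UNIV)"
  proof (rule integral_dominated_convergence[where w = "\<lambda>\<kappa>. (A + 42 * D / \<delta>\<^sup>2) * \<bar>m \<kappa>\<bar>"])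
    show "integrable (count_space UNIV) (\<lambda>\<kappa>. (A + 42 * D / \<delta>\<^sup>2) * \<bar>m \<kappa>\<bar>)" using m by simp
    show "AE \<kappa> in count_space UNIV. (\<lambda>n. dlap \<delta> (\<lambda>\<kappa>. V \<kappa> * \<theta> (\<epsilon> n) \<kappa>) \<kappa> * m \<kappa>) \<longlonglongrightarrow> dlap \<delta> (\<lambda>\<kappa>. V \<kappa> * 1) \<kappa> * m \<kappa>"
      unfolding dlap_def using \<delta> by (intro AE_I2 tendsto_intros \<theta>lim) auto
    show "AE \<kappa> in count_space UNIV. norm (dlap \<delta> (\<lambda>\<kappa>. V \<kappa> * \<theta> (\<epsilon> n) \<kappa>) \<kappa> * m \<kappa>) \<le> (A + 42 * D / \<delta>\<^sup>2) * \<bar>m \<kappa>\<bar>" for n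
      unfolding real_norm_def abs_mult using \<epsilon>[of n] by (intro AE_I2 mult_right_mono lap) auto
  qed auto
  show "(\<integral>\<kappa>. V \<kappa> * dlap \<delta> m \<kappa> \<partial>count_space UNIV) = (\<integral>\<kappa>. dlap \<delta> V \<kappa> * m \<kappa> \<partial>count_space UNIV)"
    using LIMSEQ_unique[OF L1 L2[folded gr]] by simp
qed

section \<open>Curves of finite action\<close>

text \<open>Enumerating the integers turns sums over sites into series, for which measurability and
  exchange with integrals are standard.\<close>

lemma nn_integral_int_suminf:
  "(\<integral>\<^sup>+ \<kappa>. f \<kappa> \<partial>count_space UNIV) = (\<Sum>n. f (int_decode n))"
proof -
  have "(\<integral>\<^sup>+ \<kappa>. f \<kappa> \<partial>count_space UNIV) = (\<integral>\<^sup>+ n. f (int_decode n) \<partial>count_space UNIV)"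
    by (rule nn_integral_bij_count_space[OF bij_int_decode, symmetric])
  then show ?thesis by (simp add: nn_integral_count_space_nat)
qed

lemma borel_measurable_nn_integral_int:
  assumes [measurable]: "\<And>\<kappa>::int. (\<lambda>s. f s \<kappa>) \<in> borel_measurable M"
  shows "(\<lambda>s. \<integral>\<^sup>+ \<kappa>. f s \<kappa> \<partial>count_space UNIV) \<in> borel_measurable M"
  unfolding nn_integral_int_suminf by measurable

lemma nn_integral_int_swap:
  assumes [measurable]: "\<And>\<kappa>::int. (\<lambda>s. f s \<kappa>) \<in> borel_measurable M"
  shows "(\<integral>\<^sup>+ s. (\<integral>\<^sup>+ \<kappa>. f s \<kappa> \<partial>count_space UNIV) \<partial>M) = (\<integral>\<^sup>+ \<kappa>. (\<integral>\<^sup>+ s. f s \<kappa> \<partial>M) \<partial>count_space UNIV)"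
  unfolding nn_integral_int_suminf by (rule nn_integral_suminf) measurable

lemma Qact_0 [simp]: "Qact 0 r = 0"
  by (simp add: Qact_def)

text \<open>The arithmetic-geometric mean inequality \<open>2 |p| \<le> p\<^sup>2 / r + r\<close>.
  Summed over sites it shows that a flux of finite action is summable, because the mass is
  finite.\<close>

lemma two_abs_le_Qact:
  assumes "0 \<le> r"
  shows "ennreal (2 * \<bar>p\<bar>) \<le> Qact p r + ennreal r"
proof (cases "r > 0")
  case True
  have "0 \<le> (\<bar>p\<bar> - r)\<^sup>2 / r" using True by simp
  also have "(\<bar>p\<bar> - r)\<^sup>2 / r = p\<^sup>2 / r + r - 2 * \<bar>p\<bar>"
    using True by (simp add: power2_eq_square field_simps flip: abs_mult)
  finally have "ennreal (2 * \<bar>p\<bar>) \<le> ennreal (p\<^sup>2 / r + r)" by (intro ennreal_leI) simp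
  then show ?thesis using True by (simp add: Qact_def)
qed (use assms in \<open>auto simp: Qact_def\<close>)

lemma Qact_imp_square_le:
  assumes "0 \<le> r" "r \<le> M" "Qact p r \<le> ennreal X" "0 \<le> X"
  shows "p\<^sup>2 \<le> M * X"
proof (cases "r > 0")
  case True
  then have "p\<^sup>2 / r \<le> X" using assms by (simp add: Qact_def)
  then have "p\<^sup>2 \<le> r * X" using True by (simp add: field_simps)
  also have "\<dots> \<le> M * X" using assms by (intro mult_right_mono)
  finally show ?thesis .
next
  case False
  then have "p = 0" using assms by (auto simp: Qact_def top_unique split: if_splits)
  then show ?thesis using assms by simp
qed

definition action_density :: "(int \<Rightarrow> real) \<Rightarrow> (int \<Rightarrow> real) \<Rightarrow> ennreal" where
  "action_density w \<rho> = (\<integral>\<^sup>+ \<kappa>. Qact (w \<kappa>) (\<rho> \<kappa>) \<partial>count_space UNIV)"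

lemma Qact_le_action_density: "Qact (w \<kappa>) (\<rho> \<kappa>) \<le> action_density w \<rho>"
  unfolding action_density_def by (rule nn_integral_ge_point) simp

lemma action_density_square_le:
  assumes "\<rho> \<in> P2c \<delta>" "0 < \<delta>" "action_density w \<rho> < top"
  shows "(w \<kappa>)\<^sup>2 \<le> 1 / \<delta> * enn2real (action_density w \<rho>)"
proof (rule Qact_imp_square_le[of "\<rho> \<kappa>"])
  show "\<rho> \<kappa> \<le> 1 / \<delta>" using P2c_le[OF assms(1,2), of \<kappa>] by simp
  show "Qact (w \<kappa>) (\<rho> \<kappa>) \<le> ennreal (enn2real (action_density w \<rho>))"
    using Qact_le_action_density[of w \<kappa> \<rho>] assms(3) by simp
qed (use assms(1) P2c_nonneg in auto)

lemma action_density_l1: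
  assumes "\<rho> \<in> P2c \<delta>" "0 < \<delta>"
  shows "2 * (\<integral>\<^sup>+ \<kappa>. ennreal \<bar>w \<kappa>\<bar> \<partial>count_space UNIV) \<le> action_density w \<rho> + ennreal (1 / \<delta>)"
proof -
  have "2 * (\<integral>\<^sup>+ \<kappa>. ennreal \<bar>w \<kappa>\<bar> \<partial>count_space UNIV) = (\<integral>\<^sup>+ \<kappa>. ennreal (2 * \<bar>w \<kappa>\<bar>) \<partial>count_space UNIV)"
    by (simp add: nn_integral_cmult[symmetric] ennreal_mult)
  also have "\<dots> \<le> (\<integral>\<^sup>+ \<kappa>. Qact (w \<kappa>) (\<rho> \<kappa>) + ennreal (\<rho> \<kappa>) \<partial>count_space UNIV)"
    by (intro nn_integral_mono two_abs_le_Qact P2c_nonneg[OF assms(1)])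
  also have "\<dots> = action_density w \<rho> + ennreal (1 / \<delta>)"
    by (simp add: nn_integral_add action_density_def P2c_nn_integral[OF assms])
  finally show ?thesis .
qed

lemma action_density_l1':
  assumes "\<rho> \<in> P2c \<delta>" "0 < \<delta>" "action_density w \<rho> < top"
  shows "(\<integral>\<^sup>+ \<kappa>. ennreal \<bar>w \<kappa>\<bar> \<partial>count_space UNIV) \<le> ennreal ((enn2real (action_density w \<rho>) + 1 / \<delta>) / 2)"
proof -
  let ?W = "\<integral>\<^sup>+ \<kappa>. ennreal \<bar>w \<kappa>\<bar> \<partial>count_space UNIV"
  have "2 * ?W \<le> ennreal (enn2real (action_density w \<rho>) + 1 / \<delta>)"
    using action_density_l1[OF assms(1,2), of w] assms(2,3) by simp
  then have "ennreal (1/2) * (2 * ?W) \<le> ennreal (1/2) * ennreal (enn2real (action_density w \<rho>) + 1 / \<delta>)"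
    by (rule mult_left_mono) simp
  moreover have "ennreal (1/2) * (2 * ?W) = (ennreal (1/2) * ennreal 2) * ?W" by (simp only: mult.assoc ennreal_numeral)
  moreover have "ennreal (1/2) * ennreal 2 = 1" by (subst ennreal_mult[symmetric]) auto
  moreover have "ennreal (1/2) * ennreal (enn2real (action_density w \<rho>) + 1 / \<delta>)
     = ennreal ((enn2real (action_density w \<rho>) + 1 / \<delta>) / 2)"
    using assms(2) by (subst ennreal_mult[symmetric]) auto
  ultimately show ?thesis by simp
qed

lemma integrable_count_space_of_l1:
  fixes w :: "int \<Rightarrow> real"
  assumes "(\<integral>\<^sup>+ \<kappa>. ennreal \<bar>w \<kappa>\<bar> \<partial>count_space UNIV) < top"
  shows "integrable (count_space UNIV) w"
  using assms by (intro integrableI_bounded) (auto simp: less_top)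

text \<open>Finiteness of the action density is imposed at every time and the flux vanishes off
  \<open>{0..1}\<close>, so pointwise estimates hold without exceptional sets and may be integrated
  over the whole line.\<close>

locale regular_curve =
  fixes \<delta> :: real and \<rho> w :: "real \<Rightarrow> int \<Rightarrow> real"
  assumes \<delta>0: "0 < \<delta>"
    and P2c: "\<And>s. s \<in> {0..1} \<Longrightarrow> \<rho> s \<in> P2c \<delta>"
    and outside: "\<And>s. s \<notin> {0..1} \<Longrightarrow> w s = (\<lambda>_. 0)"
    and \<rho>_meas [measurable]: "\<And>\<kappa>. (\<lambda>s. \<rho> s \<kappa>) \<in> borel_measurable borel"
    and w_meas [measurable]: "\<And>\<kappa>. (\<lambda>s. w s \<kappa>) \<in> borel_measurable borel"
    and wd: "\<And>\<kappa>. weak_deriv_01 (\<lambda>s. \<rho> s \<kappa>) (\<lambda>s. dlap \<delta> (w s) \<kappa>)"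
    and fin: "\<And>s. action_density (w s) (\<rho> s) < top"

lemma dlap_measurable [measurable]:
  assumes [measurable]: "\<And>\<kappa>. (\<lambda>s. w s \<kappa>) \<in> borel_measurable M"
  shows "(\<lambda>s. dlap \<delta> (w s) \<kappa>) \<in> borel_measurable M"
  unfolding dlap_def by measurable

text \<open>Admissible curves are made everywhere measurable, and the flux is set to zero on the null
  set of times at which the action density is infinite.\<close>

lemma admissible_regularize:
  assumes adm: "(\<rho>, w) \<in> adm_curves \<delta> \<rho>0 \<rho>1" and \<delta>: "0 < \<delta>" and fin: "action \<delta> \<rho> w < top"
  obtains \<rho>' w' where "regular_curve \<delta> \<rho>' w'" "\<rho>' 0 = \<rho>0" "\<rho>' 1 = \<rho>1"
    "ennreal \<delta> * (\<integral>\<^sup>+ s. action_density (w' s) (\<rho>' s) \<partial>lborel) \<le> action \<delta> \<rho> w"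
proof -
  have P: "\<And>s. s \<in> {0..1} \<Longrightarrow> \<rho> s \<in> P2c \<delta>" and L2: "\<And>\<kappa>. L2_01 (\<lambda>s. w s \<kappa>)"
    and wd: "\<And>\<kappa>. weak_deriv_01 (\<lambda>s. \<rho> s \<kappa>) (\<lambda>s. dlap \<delta> (w s) \<kappa>)" and ends: "\<rho> 0 = \<rho>0" "\<rho> 1 = \<rho>1"
    using adm by (auto simp: adm_curves_def)
  define \<rho>' where "\<rho>' s \<kappa> = indicator {0..1} s * \<rho> s \<kappa>" for s \<kappa>
  define w1 where "w1 s \<kappa> = indicator {0..1} s * w s \<kappa>" for s \<kappa>
  define \<Phi> where "\<Phi> s = action_density (w1 s) (\<rho>' s)" for s
  define w' where "w' s \<kappa> = (if \<Phi> s < top then w1 s \<kappa> else 0)" for s \<kappa>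
  \<comment> \<open>The density is measurable because its representative is continuous on
    \<open>{0..1}\<close>.\<close>
  have [measurable]: "(\<lambda>s. \<rho>' s \<kappa>) \<in> borel_measurable borel" for \<kappa>
    using borel_measurable_continuous_on_indicator[OF _ weak_deriv_continuous[OF wd[of \<kappa>]]] by (simp add: \<rho>'_def)
  have [measurable]: "(\<lambda>s. w1 s \<kappa>) \<in> borel_measurable borel" for \<kappa>
    using L2[of \<kappa>] by (simp add: w1_def L2_01_def set_borel_measurable_def)
  have [measurable]: "\<Phi> \<in> borel_measurable borel"
    unfolding \<Phi>_def[abs_def] action_density_def by (rule borel_measurable_nn_integral_int) measurable
  have [measurable]: "(\<lambda>s. w' s \<kappa>) \<in> borel_measurable borel" for \<kappa>
    unfolding w'_def by measurable
  have tot: "ennreal \<delta> * (\<integral>\<^sup>+ s. \<Phi> s \<partial>lborel) = action \<delta> \<rho> w"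
  proof -
    have "(\<integral>\<^sup>+ s. \<Phi> s \<partial>lborel) = (\<integral>\<^sup>+ \<kappa>. (\<integral>\<^sup>+ s. Qact (w1 s \<kappa>) (\<rho>' s \<kappa>) \<partial>lborel) \<partial>count_space UNIV)"
      unfolding \<Phi>_def action_density_def by (rule nn_integral_int_swap) measurable
    also have "\<dots> = (\<integral>\<^sup>+ \<kappa>. (\<integral>\<^sup>+ s\<in>{0..1}. Qact (w s \<kappa>) (\<rho> s \<kappa>) \<partial>lborel) \<partial>count_space UNIV)"
      by (intro nn_integral_cong) (auto simp: w1_def \<rho>'_def indicator_def)
    finally show ?thesis by (simp add: action_def)
  qed
  have "(\<integral>\<^sup>+ s. \<Phi> s \<partial>lborel) < top"
    using fin \<delta> unfolding tot[symmetric] by (auto simp: ennreal_mult_less_top)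
  then have AE: "AE s in lborel. \<Phi> s \<noteq> \<infinity>"
    by (intro nn_integral_noteq_infinite) (auto simp: less_top)
  have dens: "action_density (w' s) (\<rho>' s) = (if \<Phi> s < top then \<Phi> s else 0)" for s
    by (simp add: w'_def \<Phi>_def action_density_def)
  have in01: "\<rho>' s = \<rho> s" if "s \<in> {0..1}" for s using that by (auto simp: \<rho>'_def)
  have "regular_curve \<delta> \<rho>' w'"
  proof
    show "weak_deriv_01 (\<lambda>s. \<rho>' s \<kappa>) (\<lambda>s. dlap \<delta> (w' s) \<kappa>)" for \<kappa>
    proof (rule weak_deriv_cong[OF wd[of \<kappa>]])
      show "\<rho> s \<kappa> = \<rho>' s \<kappa>" if "s \<in> {0..1}" for s using in01[OF that] by simp
      show "AE s in lborel. s \<in> {0..1} \<longrightarrow> dlap \<delta> (w s) \<kappa> = dlap \<delta> (w' s) \<kappa>"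
        using AE by eventually_elim (auto simp: dlap_def w'_def w1_def less_top)
      show "set_borel_measurable lborel {0..1} (\<lambda>s. dlap \<delta> (w' s) \<kappa>)"
        unfolding set_borel_measurable_def by measurable
    qed
    show "action_density (w' s) (\<rho>' s) < top" for s by (simp add: dens)
    show "\<rho>' s \<in> P2c \<delta>" if "s \<in> {0..1}" for s using P[OF that] in01[OF that] by simp
    show "w' s = (\<lambda>_. 0)" if "s \<notin> {0..1}" for s using that by (auto simp: w'_def w1_def)
  qed (use \<delta> in auto)
  moreover have "(\<integral>\<^sup>+ s. action_density (w' s) (\<rho>' s) \<partial>lborel) \<le> (\<integral>\<^sup>+ s. \<Phi> s \<partial>lborel)"
    by (intro nn_integral_mono) (simp add: dens)
  then have "ennreal \<delta> * (\<integral>\<^sup>+ s. action_density (w' s) (\<rho>' s) \<partial>lborel) \<le> action \<delta> \<rho> w"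
    unfolding tot[symmetric] by (rule mult_left_mono) simp
  moreover have "\<rho>' 0 = \<rho>0" "\<rho>' 1 = \<rho>1" using in01[of 0] in01[of 1] ends by auto
  ultimately show ?thesis using that by blast
qed

lemma energy_eq_integral:
  assumes "integrable (count_space UNIV) (\<lambda>\<kappa>. V \<kappa> * \<rho> \<kappa>)"
  shows "energy \<delta> V \<rho> = - \<delta> * (\<integral>\<kappa>. V \<kappa> * \<rho> \<kappa> \<partial>count_space UNIV)"
proof -
  have *: "Infinite_Set_Sum.abs_summable_on (\<lambda>\<kappa>. V \<kappa> * \<rho> \<kappa>) UNIV"
    using assms by (simp add: abs_summable_on_def)
  show ?thesis using infsetsum_infsum[OF *] by (simp add: energy_def infsetsum_def)
qed

context regular_curve
begin

definition kin :: "real \<Rightarrow> real" where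
  "kin s = enn2real (action_density (w s) (\<rho> s))"

lemma action_density_meas [measurable]: "(\<lambda>s. action_density (w s) (\<rho> s)) \<in> borel_measurable borel"
  unfolding action_density_def by (rule borel_measurable_nn_integral_int) measurable

lemma kin_meas [measurable]: "kin \<in> borel_measurable borel"
  unfolding kin_def[abs_def] by measurable

lemma kin_nonneg: "0 \<le> kin s" by (simp add: kin_def)

lemma ennreal_kin: "ennreal (kin s) = action_density (w s) (\<rho> s)"
  using fin[of s] by (simp add: kin_def)

lemma kin_outside: "s \<notin> {0..1} \<Longrightarrow> kin s = 0"
  by (simp add: kin_def outside action_density_def)

lemma w_square_le: "(w s \<kappa>)\<^sup>2 \<le> kin s / \<delta>"
proof (cases "s \<in> {0..1}")
  case True
  then show ?thesis using action_density_square_le[OF P2c[OF True] \<delta>0 fin, of \<kappa>] by (simp add: kin_def)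
next
  case False
  then show ?thesis using kin_nonneg[of s] \<delta>0 outside[OF False] by simp
qed

lemma w_l1: "(\<integral>\<^sup>+ \<kappa>. ennreal \<bar>w s \<kappa>\<bar> \<partial>count_space UNIV) \<le> ennreal ((kin s + indicator {0..1} s / \<delta>) / 2)"
proof (cases "s \<in> {0..1}")
  case True
  then show ?thesis using action_density_l1'[OF P2c[OF True] \<delta>0 fin] by (simp add: kin_def)
next
  case False
  then show ?thesis using outside[OF False] by simp
qed

context
  assumes total: "(\<integral>\<^sup>+ s. action_density (w s) (\<rho> s) \<partial>lborel) < top"
begin

lemma kin_integrable: "integrable lborel kin"
  using total kin_nonneg by (intro integrableI_bounded) (auto simp: ennreal_kin less_top)

text \<open>The time-integrated flux \<open>m\<close> satisfies
  \<open>\<rho> 1 - \<rho> 0 = dlap \<delta> m\<close>, so one summation by parts in space suffices.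
  Its moment condition then concerns the two end points, which have second moments, and not the
  flux, which is known only to be summable.\<close>

lemma energy_identity:
  assumes lap: "\<And>\<kappa>. \<bar>dlap \<delta> V \<kappa>\<bar> \<le> A"
  shows "integrable lborel (\<lambda>s. \<integral>\<kappa>. dlap \<delta> V \<kappa> * w s \<kappa> \<partial>count_space UNIV)" (is ?I)
    and "energy \<delta> V (\<rho> 0) - energy \<delta> V (\<rho> 1) = \<delta> * (\<integral>s. (\<integral>\<kappa>. dlap \<delta> V \<kappa> * w s \<kappa> \<partial>count_space UNIV) \<partial>lborel)" (is ?E)
proof -
  interpret C: sigma_finite_measure "count_space (UNIV :: int set)" by (rule sigma_finite_measure_count_space)
  interpret P: pair_sigma_finite "count_space (UNIV :: int set)" lborel ..
  have wp: "(\<lambda>(\<kappa>, s). w s \<kappa>) \<in> borel_measurable (count_space UNIV \<Otimes>\<^sub>M lborel)"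
    by (rule measurable_pair_measure_countable1) simp_all
  \<comment> \<open>Joint summability of the flux in space and time, from which the uses of Fubini
    below follow.\<close>
  have "(\<integral>\<^sup>+ \<kappa>. (\<integral>\<^sup>+ s. ennreal \<bar>w s \<kappa>\<bar> \<partial>lborel) \<partial>count_space UNIV) = (\<integral>\<^sup>+ s. (\<integral>\<^sup>+ \<kappa>. ennreal \<bar>w s \<kappa>\<bar> \<partial>count_space UNIV) \<partial>lborel)"
    by (rule nn_integral_int_swap[symmetric]) measurable
  also have "\<dots> \<le> (\<integral>\<^sup>+ s. ennreal ((kin s + indicator {0..1} s / \<delta>) / 2) \<partial>lborel)"
    by (intro nn_integral_mono w_l1)
  also have "\<dots> < top"
  proof -
    have "integrable lborel (\<lambda>s. (kin s + indicator {0..1} s / \<delta>) / 2)"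
      using kin_integrable by (intro integrable_divide Bochner_Integration.integrable_add integrable_real_indicator) auto
    then show ?thesis using kin_nonneg \<delta>0
      by (subst nn_integral_eq_integral) (auto intro!: AE_I2)
  qed
  finally have fin1: "(\<integral>\<^sup>+ \<kappa>. (\<integral>\<^sup>+ s. ennreal \<bar>w s \<kappa>\<bar> \<partial>lborel) \<partial>count_space UNIV) < top" .
  have W: "integrable (count_space UNIV \<Otimes>\<^sub>M lborel) (\<lambda>(\<kappa>, s). w s \<kappa>)"
  proof (rule integrableI_bounded[OF wp])
    have "(\<integral>\<^sup>+ x. ennreal (norm (case x of (\<kappa>, s) \<Rightarrow> w s \<kappa>)) \<partial>(count_space UNIV \<Otimes>\<^sub>M lborel))
       = (\<integral>\<^sup>+ \<kappa>. (\<integral>\<^sup>+ s. ennreal \<bar>w s \<kappa>\<bar> \<partial>lborel) \<partial>count_space UNIV)"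
      using wp by (subst lborel.nn_integral_fst[symmetric]) auto
    then show "(\<integral>\<^sup>+ x. ennreal (norm (case x of (\<kappa>, s) \<Rightarrow> w s \<kappa>)) \<partial>(count_space UNIV \<Otimes>\<^sub>M lborel)) < \<infinity>"
      using fin1 by simp
  qed
  have aW: "integrable (count_space UNIV \<Otimes>\<^sub>M lborel) (case_prod (\<lambda>\<kappa> s. dlap \<delta> V \<kappa> * w s \<kappa>))"
  proof (rule Bochner_Integration.integrable_bound)
    show "integrable (count_space UNIV \<Otimes>\<^sub>M lborel) (\<lambda>x. A * (case x of (\<kappa>, s) \<Rightarrow> w s \<kappa>))" using W by simp
    show "case_prod (\<lambda>\<kappa> s. dlap \<delta> V \<kappa> * w s \<kappa>) \<in> borel_measurable (count_space UNIV \<Otimes>\<^sub>M lborel)"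
      by (rule measurable_pair_measure_countable1) simp_all
    show "AE x in count_space UNIV \<Otimes>\<^sub>M lborel. norm (case_prod (\<lambda>\<kappa> s. dlap \<delta> V \<kappa> * w s \<kappa>) x) \<le> norm (A * (case x of (\<kappa>, s) \<Rightarrow> w s \<kappa>))"
      using order_trans[OF lap abs_ge_self] by (intro AE_I2) (auto simp: abs_mult intro!: mult_right_mono)
  qed
  show ?I using P.integrable_snd[OF aW] by simp
  define m where "m \<kappa> = (\<integral>s. w s \<kappa> \<partial>lborel)" for \<kappa>
  have m: "integrable (count_space UNIV) m"
    using P.integrable_fst[OF W] by (simp add: m_def[abs_def])
  have wi: "integrable lborel (\<lambda>s. w s \<kappa>)" for \<kappa>
  proof -
    have "(\<integral>\<^sup>+ s. ennreal \<bar>w s \<kappa>\<bar> \<partial>lborel) \<le> (\<integral>\<^sup>+ \<kappa>. (\<integral>\<^sup>+ s. ennreal \<bar>w s \<kappa>\<bar> \<partial>lborel) \<partial>count_space UNIV)"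
      by (rule nn_integral_ge_point[of \<kappa> UNIV "\<lambda>\<kappa>. \<integral>\<^sup>+ s. ennreal \<bar>w s \<kappa>\<bar> \<partial>lborel"]) simp
    then show ?thesis using fin1 by (intro integrableI_bounded) (auto simp: less_top)
  qed
  have dm: "\<rho> 1 \<kappa> - \<rho> 0 \<kappa> = dlap \<delta> m \<kappa>" for \<kappa>
  proof -
    have "\<rho> 1 \<kappa> - \<rho> 0 \<kappa> = (LINT s:{0..1}|lborel. dlap \<delta> (w s) \<kappa>)"
      using weak_derivD(2)[OF wd[of \<kappa>], of 1] by simp
    also have "\<dots> = (\<integral>s. dlap \<delta> (w s) \<kappa> \<partial>lborel)"
      unfolding set_lebesgue_integral_def
    proof (intro Bochner_Integration.integral_cong refl)
      show "indicator {0..1} s *\<^sub>R dlap \<delta> (w s) \<kappa> = dlap \<delta> (w s) \<kappa>" for s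
        by (cases "s \<in> {0..1}") (simp, simp add: outside dlap_def)
    qed
    also have "\<dots> = dlap \<delta> m \<kappa>"
      using wi by (simp add: dlap_def m_def)
    finally show ?thesis .
  qed
  have q: "integrable (count_space UNIV) (\<lambda>\<kappa>. (1 + (real_of_int \<kappa>)\<^sup>2) * \<rho> 1 \<kappa>)"
    "integrable (count_space UNIV) (\<lambda>\<kappa>. (1 + (real_of_int \<kappa>)\<^sup>2) * \<rho> 0 \<kappa>)"
    using P2c_second_moment[OF P2c[of 1] \<delta>0] P2c_second_moment[OF P2c[of 0] \<delta>0] by simp_all
  have q': "integrable (count_space UNIV) (\<lambda>\<kappa>. (1 + (real_of_int \<kappa>)\<^sup>2) * dlap \<delta> m \<kappa>)"
    unfolding dm[symmetric] right_diff_distrib by (intro Bochner_Integration.integrable_diff q)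
  obtain D where D: "\<And>\<kappa>. \<bar>V \<kappa>\<bar> \<le> D * (1 + (real_of_int \<kappa>)\<^sup>2)"
    by (metis dlap_bounded_growth[OF \<delta>0 lap])
  have Vi: "integrable (count_space UNIV) (\<lambda>\<kappa>. V \<kappa> * r \<kappa>)"
    if "integrable (count_space UNIV) (\<lambda>\<kappa>. (1 + (real_of_int \<kappa>)\<^sup>2) * r \<kappa>)" for r
  proof (rule Bochner_Integration.integrable_bound)
    show "integrable (count_space UNIV) (\<lambda>\<kappa>. D * ((1 + (real_of_int \<kappa>)\<^sup>2) * r \<kappa>))" using that by simp
    have "\<bar>V \<kappa>\<bar> * \<bar>r \<kappa>\<bar> \<le> \<bar>D * (1 + (real_of_int \<kappa>)\<^sup>2)\<bar> * \<bar>r \<kappa>\<bar>" for \<kappa>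
      using D[of \<kappa>] by (intro mult_right_mono) auto
    then show "AE \<kappa> in count_space UNIV. norm (V \<kappa> * r \<kappa>) \<le> norm (D * ((1 + (real_of_int \<kappa>)\<^sup>2) * r \<kappa>))"
      by (simp add: abs_mult mult.assoc)
  qed simp
  have "energy \<delta> V (\<rho> 0) - energy \<delta> V (\<rho> 1)
     = \<delta> * ((\<integral>\<kappa>. V \<kappa> * \<rho> 1 \<kappa> \<partial>count_space UNIV) - (\<integral>\<kappa>. V \<kappa> * \<rho> 0 \<kappa> \<partial>count_space UNIV))"
    unfolding energy_eq_integral[OF Vi[OF q(1)]] energy_eq_integral[OF Vi[OF q(2)]] by (simp add: right_diff_distrib)
  also have "(\<integral>\<kappa>. V \<kappa> * \<rho> 1 \<kappa> \<partial>count_space UNIV) - (\<integral>\<kappa>. V \<kappa> * \<rho> 0 \<kappa> \<partial>count_space UNIV)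
     = (\<integral>\<kappa>. V \<kappa> * dlap \<delta> m \<kappa> \<partial>count_space UNIV)"
    unfolding dm[symmetric] right_diff_distrib
    by (rule Bochner_Integration.integral_diff[OF Vi[OF q(1)] Vi[OF q(2)], symmetric])
  also have "\<dots> = (\<integral>\<kappa>. dlap \<delta> V \<kappa> * m \<kappa> \<partial>count_space UNIV)"
    by (rule green_quadratic[OF \<delta>0 lap m q'])
  also have "\<dots> = (\<integral>\<kappa>. (\<integral>s. dlap \<delta> V \<kappa> * w s \<kappa> \<partial>lborel) \<partial>count_space UNIV)"
    by (simp add: m_def)
  also have "\<dots> = (\<integral>s. (\<integral>\<kappa>. dlap \<delta> V \<kappa> * w s \<kappa> \<partial>count_space UNIV) \<partial>lborel)"
    by (rule P.Fubini_integral[OF aW, symmetric])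
  finally show ?E .
qed

end

end

section \<open>Action of the evolved curve\<close>

text \<open>Expanding \<open>(p - k * r)\<^sup>2 / r\<close> leaves a cross term free of
  \<open>r\<close>, hence linear in the flux. At \<open>r = 0\<close> finiteness forces
  \<open>p = 0\<close> and both sides vanish.\<close>

lemma Qact_shift:
  assumes "0 \<le> r" "Qact p r < top"
  shows "Qact (p - k * r) r = ennreal (enn2real (Qact p r) - 2 * k * p + k\<^sup>2 * r)"
    and "0 \<le> enn2real (Qact p r) - 2 * k * p + k\<^sup>2 * r"
proof -
  have "Qact (p - k * r) r = ennreal (enn2real (Qact p r) - 2 * k * p + k\<^sup>2 * r)
    \<and> 0 \<le> enn2real (Qact p r) - 2 * k * p + k\<^sup>2 * r"
  proof (cases "r > 0")
    case True
    have "(p - k * r)\<^sup>2 / r = p\<^sup>2 / r - 2 * k * p + k\<^sup>2 * r"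
      using True by (simp add: power2_eq_square field_simps)
    moreover have "0 \<le> (p - k * r)\<^sup>2 / r" using True by simp
    ultimately show ?thesis using True by (simp add: Qact_def)
  next
    case False
    then show ?thesis using assms by (auto simp: Qact_def split: if_splits)
  qed
  then show "Qact (p - k * r) r = ennreal (enn2real (Qact p r) - 2 * k * p + k\<^sup>2 * r)"
    "0 \<le> enn2real (Qact p r) - 2 * k * p + k\<^sup>2 * r" by blast+
qed

lemma abs_le_1_plus_square: "(x::real)\<^sup>2 \<le> y \<Longrightarrow> \<bar>x\<bar> \<le> 1 + y"
proof -
  assume "x\<^sup>2 \<le> y"
  moreover have "0 \<le> (\<bar>x\<bar> - 1)\<^sup>2" by simp
  then have "2 * \<bar>x\<bar> \<le> x\<^sup>2 + 1" by (simp add: power2_eq_square algebra_simps flip: abs_mult)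
  moreover have "0 \<le> x\<^sup>2" by simp
  ultimately show ?thesis by linarith
qed

text \<open>Finite action makes the flux both summable and bounded, hence square summable.\<close>

lemma action_density_summable_square:
  assumes "\<rho> \<in> P2c \<delta>" "0 < \<delta>" "action_density w \<rho> < top"
  shows "(\<lambda>\<kappa>. (w \<kappa>)\<^sup>2) summable_on UNIV"
proof -
  have "integrable (count_space UNIV) w"
    by (rule integrable_count_space_of_l1[OF le_less_trans[OF action_density_l1'[OF assms]]]) simp
  then have "integrable (count_space UNIV) (\<lambda>\<kappa>. w \<kappa> * w \<kappa>)"
    by (rule integrable_count_space_bounded_mult) (rule abs_le_1_plus_square[OF action_density_square_le[OF assms]])
  then have "Infinite_Set_Sum.abs_summable_on (\<lambda>\<kappa>. (w \<kappa>)\<^sup>2) UNIV"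
    by (simp add: abs_summable_on_def power2_eq_square)
  then show ?thesis unfolding abs_summable_equivalent[symmetric] by (rule abs_summable_summable)
qed

lemma L2_01_bounded:
  assumes [measurable]: "g \<in> borel_measurable borel"
    and b: "\<And>s. s \<in> {0..1} \<Longrightarrow> (g s)\<^sup>2 \<le> G s" and G: "set_integrable lborel {0..1} G"
  shows "L2_01 g"
  unfolding L2_01_def set_borel_measurable_def set_integrable_def
proof
  show "integrable lborel (\<lambda>x. indicat_real {0..1} x *\<^sub>R (g x)\<^sup>2)"
  proof (rule Bochner_Integration.integrable_bound)
    show "integrable lborel (\<lambda>x. indicat_real {0..1} x *\<^sub>R G x)" using G by (simp add: set_integrable_def)
    show "AE x in lborel. norm (indicat_real {0..1} x *\<^sub>R (g x)\<^sup>2) \<le> norm (indicat_real {0..1} x *\<^sub>R G x)"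
    proof (rule AE_I2)
      fix x
      show "norm (indicat_real {0..1} x *\<^sub>R (g x)\<^sup>2) \<le> norm (indicat_real {0..1} x *\<^sub>R G x)"
        by (cases "x \<in> {0..1}") (use b[of x] in auto)
    qed
  qed measurable
qed measurable

section \<open>Measurability of the two flows in time\<close>

context rates
begin

lemma fstep_pow_measurable:
  assumes [measurable]: "\<And>\<kappa>. (\<lambda>s. f s \<kappa>) \<in> borel_measurable M"
  shows "(\<lambda>s. (fstep \<alpha> ^^ n) (f s) \<kappa>) \<in> borel_measurable M"
proof (induction n arbitrary: \<kappa>)
  case (Suc n)
  note [measurable] = Suc
  show ?case unfolding funpow.simps comp_apply fstep_def[of _ "(fstep \<alpha> ^^ n) _"] by measurable
qed simp

lemma bstep_pow_measurable:
  assumes [measurable]: "\<And>\<kappa>. (\<lambda>s. f s \<kappa>) \<in> borel_measurable M"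
  shows "(\<lambda>s. (bstep \<alpha> ^^ n) (f s) \<kappa>) \<in> borel_measurable M"
proof (induction n arbitrary: \<kappa>)
  case (Suc n)
  note [measurable] = Suc
  show ?case unfolding funpow.simps comp_apply bstep_def[of _ "(bstep \<alpha> ^^ n) _"] by measurable
qed simp

lemma fflow_measurable:
  assumes [measurable]: "\<And>\<kappa>. (\<lambda>s. f s \<kappa>) \<in> borel_measurable M" "r \<in> borel_measurable M"
  shows "(\<lambda>s. fflow \<alpha> (r s) (f s) \<kappa>) \<in> borel_measurable M"
proof -
  note [measurable] = fstep_pow_measurable[of f M, OF assms(1)]
  show ?thesis unfolding fflow_def pois_def by measurable
qed

lemma bflow_measurable:
  assumes [measurable]: "\<And>\<kappa>. (\<lambda>s. f s \<kappa>) \<in> borel_measurable M" "r \<in> borel_measurable M"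
  shows "(\<lambda>s. bflow \<alpha> (r s) (f s) \<kappa>) \<in> borel_measurable M"
proof -
  note [measurable] = bstep_pow_measurable[of f M, OF assms(1)]
  show ?thesis unfolding bflow_def pois_def by measurable
qed

end

context lattice_potential
begin

text \<open>One step has size \<open>1 / c\<close>. The loss \<open>- \<alpha> \<kappa>\<close> on
  the diagonal is exactly the central term of the second difference of the squared rates.\<close>

lemma step_rate_eq:
  "1 - \<alpha> \<kappa> + ((\<alpha> (\<kappa> + 1))\<^sup>2 + (\<alpha> (\<kappa> - 1))\<^sup>2) / (2 * \<alpha> \<kappa>)
    = 1 + (dlap \<delta> (\<lambda>j. (dlap \<delta> V j)\<^sup>2) \<kappa> / dlap \<delta> V \<kappa>) / c"
proof -
  have a: "dlap \<delta> V j = A * \<alpha> j" for j using A by (simp add: \<alpha>_def)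
  have "1 - a0 + (a1\<^sup>2 + am\<^sup>2) / (2 * a0)
      = 1 + ((((A * a1)\<^sup>2 + (A * am)\<^sup>2 - 2 * (A * a0)\<^sup>2) / d) / (A * a0)) / (2 * A / d)"
    if "0 < a0" "0 < d" for a0 a1 am d :: real
    using that A by (simp add: field_simps power2_eq_square)
  from this[OF pos, of "\<delta>\<^sup>2" \<kappa>] show ?thesis
    using \<delta> unfolding a dlap_def[of _ "\<lambda>j. (A * \<alpha> j)\<^sup>2"] c_def by simp
qed

text \<open>The constant of \<open>bflow_minus_id_l1\<close> at parameter \<open>c * t\<close>. It
  tends to 0 with \<open>t\<close>, so \<open>t * \<omega> t\<close> is negligible after division by
  \<open>t\<close>.\<close>

definition \<omega> :: "real \<Rightarrow> real" where
  "\<omega> t = exp (c * t) + 1 - 2 * exp (- (c * t))"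

lemma \<omega>_mono: "s \<le> t \<Longrightarrow> \<omega> s \<le> \<omega> t"
  unfolding \<omega>_def using c_pos by (intro diff_mono add_mono mult_left_mono) auto

lemma \<omega>_nonneg: "0 \<le> t \<Longrightarrow> 0 \<le> \<omega> t"
  using \<omega>_mono[of 0 t] by (simp add: \<omega>_def)

text \<open>Here \<tau> is the elapsed evolution and \<open>t\<close> the coefficient of the
  correction flux; \<open>B\<close> serves all \<open>\<tau> \<le> t\<close> at once. The square
  splits into the transported action, a cross term and a quadratic remainder. In the cross term the
  evolved flux is replaced by \<open>w\<close>, at the cost of \<open>\<omega> t\<close> times the
  summable norm of \<open>w\<close>, which is at most
  \<open>(\<phi> + 1 / \<delta>) / 2\<close>.\<close>

lemma action_density_flow:
  assumes \<rho>: "\<rho> \<in> P2c \<delta>" and \<rho>': "fflow \<alpha> (c * \<tau>) \<rho> \<in> P2c \<delta>" and fin: "action_density w \<rho> < top"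
    and \<tau>: "0 \<le> \<tau>" "\<tau> \<le> t"
    and \<Lambda>: "0 \<le> \<Lambda>" "\<And>\<kappa>. dlap \<delta> (\<lambda>j. (dlap \<delta> V j)\<^sup>2) \<kappa> / dlap \<delta> V \<kappa> \<le> \<Lambda>"
  defines "\<phi> \<equiv> enn2real (action_density w \<rho>)"
  defines "B \<equiv> exp (\<Lambda> * t) * \<phi> - 2 * t * (\<integral>\<kappa>. dlap \<delta> V \<kappa> * w \<kappa> \<partial>count_space UNIV)
      + t * A * \<omega> t * (\<phi> + 1 / \<delta>) + t\<^sup>2 * A\<^sup>2 / \<delta>"
  shows "action_density (\<lambda>\<kappa>. bflow \<alpha> (c * \<tau>) w \<kappa> - t * dlap \<delta> V \<kappa> * fflow \<alpha> (c * \<tau>) \<rho> \<kappa>) (fflow \<alpha> (c * \<tau>) \<rho>) \<le> ennreal B"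
    and "0 \<le> B"
proof -
  define r where "r = c * \<tau>"
  define v where "v = bflow \<alpha> r w"
  define \<rho>' where "\<rho>' = fflow \<alpha> r \<rho>"
  have P: "\<rho>' \<in> P2c \<delta>" using assms(2) by (simp add: \<rho>'_def r_def)
  have r: "0 \<le> r" using \<tau> c_pos by (simp add: r_def)
  have t: "0 \<le> t" using \<tau> by simp
  have \<phi>0: "0 \<le> \<phi>" by (simp add: \<phi>_def)
  have w\<phi>: "action_density w \<rho> = ennreal \<phi>" using fin by (simp add: \<phi>_def)
  have wb: "\<bar>w \<kappa>\<bar> \<le> 1 + 1 / \<delta> * \<phi>" for \<kappa>
    unfolding \<phi>_def by (rule abs_le_1_plus_square[OF action_density_square_le[OF \<rho> \<delta> fin]])
  \<comment> \<open>A growth factor \<open>1 + \<Lambda> / c\<close> per step over Poisson time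
    \<open>c * \<tau>\<close> amounts to \<open>exp (\<Lambda> * \<tau>)\<close>.\<close>
  have "action_density v \<rho>' \<le> ennreal (exp (r * (1 + \<Lambda> / c - 1))) * action_density w \<rho>"
    unfolding action_density_def v_def \<rho>'_def
  proof (rule action_flow[OF P2c_nonneg[OF \<rho>] _ r _ wb P2c_le[OF \<rho> \<delta>]])
    show "0 \<le> 1 + \<Lambda> / c" using \<Lambda>(1) c_pos by simp
    show "1 - \<alpha> \<kappa> + ((\<alpha> (\<kappa> + 1))\<^sup>2 + (\<alpha> (\<kappa> - 1))\<^sup>2) / (2 * \<alpha> \<kappa>) \<le> 1 + \<Lambda> / c" for \<kappa>
      unfolding step_rate_eq using \<Lambda>(2) c_pos by (intro add_left_mono divide_right_mono) auto
  qed
  also have "\<dots> \<le> ennreal (exp (\<Lambda> * t)) * ennreal \<phi>"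
    unfolding w\<phi>
  proof (intro mult_right_mono ennreal_leI)
    have "r * (1 + \<Lambda> / c - 1) = \<Lambda> * \<tau>" using c_pos by (simp add: r_def)
    \<comment> \<open>Passing from \<tau> to \<open>t\<close> uses
      \<open>0 \<le> \<Lambda>\<close>.\<close>
    then show "exp (r * (1 + \<Lambda> / c - 1)) \<le> exp (\<Lambda> * t)" using \<Lambda>(1) \<tau> by (simp add: mult_left_mono)
  qed simp
  finally have dv: "action_density v \<rho>' \<le> ennreal (exp (\<Lambda> * t) * \<phi>)"
    using \<phi>0 by (simp add: ennreal_mult)
  then have dvf: "action_density v \<rho>' < top" by (rule le_less_trans) simp
  define \<psi> where "\<psi> = enn2real (action_density v \<rho>')"
  have \<psi>: "\<psi> \<le> exp (\<Lambda> * t) * \<phi>"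
    using enn2real_mono[OF dv] \<phi>0 by (simp add: \<psi>_def)
  define q where "q \<kappa> = enn2real (Qact (v \<kappa>) (\<rho>' \<kappa>))" for \<kappa>
  have Qf: "Qact (v \<kappa>) (\<rho>' \<kappa>) < top" for \<kappa> by (rule le_less_trans[OF Qact_le_action_density dvf])
  then have eq: "ennreal (q \<kappa>) = Qact (v \<kappa>) (\<rho>' \<kappa>)" for \<kappa> by (simp add: q_def)
  have q0: "0 \<le> q \<kappa>" for \<kappa> by (simp add: q_def)
  have qi: "integrable (count_space UNIV) q"
    using dvf q0 by (intro integrableI_bounded) (auto simp: eq action_density_def less_top)
  have qI: "(\<integral>\<kappa>. q \<kappa> \<partial>count_space UNIV) = \<psi>"
    using q0 by (subst integral_eq_nn_integral) (auto simp: eq \<psi>_def action_density_def)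
  have wi: "integrable (count_space UNIV) w"
    by (rule integrable_count_space_of_l1[OF le_less_trans[OF action_density_l1'[OF \<rho> \<delta> fin]]]) simp
  have vi: "integrable (count_space UNIV) v"
    by (rule integrable_count_space_of_l1[OF le_less_trans[OF action_density_l1'[OF P \<delta> dvf]]]) simp
  have ab: "\<bar>dlap \<delta> V \<kappa>\<bar> \<le> A" for \<kappa> using lap_pos[of \<kappa>] lap_le[of \<kappa>] by simp
  note ai = integrable_count_space_bounded_mult[OF _ ab]
  have a2: "(dlap \<delta> V \<kappa>)\<^sup>2 \<le> A\<^sup>2" for \<kappa>
    using lap_pos[of \<kappa>] lap_le[of \<kappa>] by (intro power_mono) auto
  have ri: "integrable (count_space UNIV) (\<lambda>\<kappa>. (dlap \<delta> V \<kappa>)\<^sup>2 * \<rho>' \<kappa>)"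
    using a2 by (intro integrable_count_space_bounded_mult[OF P2c_integrable(1)[OF P \<delta>], of _ "A\<^sup>2"]) simp
  have rI: "(\<integral>\<kappa>. (dlap \<delta> V \<kappa>)\<^sup>2 * \<rho>' \<kappa> \<partial>count_space UNIV) \<le> A\<^sup>2 / \<delta>"
  proof -
    have "(\<integral>\<kappa>. (dlap \<delta> V \<kappa>)\<^sup>2 * \<rho>' \<kappa> \<partial>count_space UNIV) \<le> (\<integral>\<kappa>. A\<^sup>2 * \<rho>' \<kappa> \<partial>count_space UNIV)"
      using P2c_integrable(1)[OF P \<delta>] a2 P2c_nonneg[OF P]
      by (intro integral_mono ri mult_right_mono) auto
    then show ?thesis using P2c_integrable(2)[OF P \<delta>] by simp
  qed
  have diff: "(\<integral>\<kappa>. dlap \<delta> V \<kappa> * w \<kappa> \<partial>count_space UNIV) - (\<integral>\<kappa>. dlap \<delta> V \<kappa> * v \<kappa> \<partial>count_space UNIV)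
      \<le> A * (\<omega> t * ((\<phi> + 1 / \<delta>) / 2))"
  proof -
    have "(\<integral>\<^sup>+ \<kappa>. ennreal \<bar>v \<kappa> - w \<kappa>\<bar> \<partial>count_space UNIV) \<le> ennreal (\<omega> \<tau>) * (\<integral>\<^sup>+ \<kappa>. ennreal \<bar>w \<kappa>\<bar> \<partial>count_space UNIV)"
      using bflow_minus_id_l1[OF r wb] by (simp add: v_def \<omega>_def r_def)
    also have "\<dots> \<le> ennreal (\<omega> t) * ennreal ((\<phi> + 1 / \<delta>) / 2)"
      unfolding \<phi>_def by (intro mult_mono ennreal_leI \<omega>_mono \<tau> action_density_l1'[OF \<rho> \<delta> fin]) auto
    also have "\<dots> = ennreal (\<omega> t * ((\<phi> + 1 / \<delta>) / 2))"
      by (rule ennreal_mult'[OF \<omega>_nonneg[OF t], symmetric])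
    finally have n: "(\<integral>\<^sup>+ \<kappa>. ennreal \<bar>v \<kappa> - w \<kappa>\<bar> \<partial>count_space UNIV) \<le> ennreal (\<omega> t * ((\<phi> + 1 / \<delta>) / 2))" .
    have vw: "integrable (count_space UNIV) (\<lambda>\<kappa>. \<bar>v \<kappa> - w \<kappa>\<bar>)" using vi wi by simp
    have "(\<integral>\<kappa>. \<bar>v \<kappa> - w \<kappa>\<bar> \<partial>count_space UNIV) \<le> \<omega> t * ((\<phi> + 1 / \<delta>) / 2)"
    proof -
      have "ennreal (\<integral>\<kappa>. \<bar>v \<kappa> - w \<kappa>\<bar> \<partial>count_space UNIV) \<le> ennreal (\<omega> t * ((\<phi> + 1 / \<delta>) / 2))"
        using n by (subst nn_integral_eq_integral[OF vw, symmetric]) auto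
      then show ?thesis using \<omega>_nonneg[OF t] \<phi>0 \<delta> by (subst (asm) ennreal_le_iff) auto
    qed
    then have n': "A * (\<integral>\<kappa>. \<bar>v \<kappa> - w \<kappa>\<bar> \<partial>count_space UNIV) \<le> A * (\<omega> t * ((\<phi> + 1 / \<delta>) / 2))"
      using A by (intro mult_left_mono) auto
    have "(\<integral>\<kappa>. dlap \<delta> V \<kappa> * w \<kappa> \<partial>count_space UNIV) - (\<integral>\<kappa>. dlap \<delta> V \<kappa> * v \<kappa> \<partial>count_space UNIV)
       = (\<integral>\<kappa>. dlap \<delta> V \<kappa> * w \<kappa> - dlap \<delta> V \<kappa> * v \<kappa> \<partial>count_space UNIV)"
      by (rule Bochner_Integration.integral_diff[symmetric, OF ai[OF wi] ai[OF vi]])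
    also have "\<dots> \<le> (\<integral>\<kappa>. A * \<bar>v \<kappa> - w \<kappa>\<bar> \<partial>count_space UNIV)"
    proof (intro integral_mono Bochner_Integration.integrable_diff ai wi vi integrable_mult_right vw)
      fix \<kappa>
      have "dlap \<delta> V \<kappa> * w \<kappa> - dlap \<delta> V \<kappa> * v \<kappa> \<le> \<bar>dlap \<delta> V \<kappa> * (w \<kappa> - v \<kappa>)\<bar>"
        by (simp only: right_diff_distrib abs_ge_self)
      also have "\<dots> \<le> A * \<bar>v \<kappa> - w \<kappa>\<bar>" unfolding abs_mult using ab[of \<kappa>]
        by (simp add: abs_minus_commute mult_right_mono)
      finally show "dlap \<delta> V \<kappa> * w \<kappa> - dlap \<delta> V \<kappa> * v \<kappa> \<le> A * \<bar>v \<kappa> - w \<kappa>\<bar>" .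
    qed
    also have "\<dots> \<le> A * (\<omega> t * ((\<phi> + 1 / \<delta>) / 2))" using n' by simp
    finally show ?thesis .
  qed
  define h where "h \<kappa> = q \<kappa> - 2 * (t * dlap \<delta> V \<kappa>) * v \<kappa> + (t * dlap \<delta> V \<kappa>)\<^sup>2 * \<rho>' \<kappa>" for \<kappa>
  have h_eq: "h = (\<lambda>\<kappa>. q \<kappa> - 2 * t * (dlap \<delta> V \<kappa> * v \<kappa>) + t\<^sup>2 * ((dlap \<delta> V \<kappa>)\<^sup>2 * \<rho>' \<kappa>))"
    by (simp add: h_def[abs_def] power_mult_distrib mult_ac)
  have hi: "integrable (count_space UNIV) h"
    unfolding h_eq by (intro Bochner_Integration.integrable_add Bochner_Integration.integrable_diff integrable_mult_right qi ri ai vi)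
  have hI: "(\<integral>\<kappa>. h \<kappa> \<partial>count_space UNIV) = \<psi> - 2 * t * (\<integral>\<kappa>. dlap \<delta> V \<kappa> * v \<kappa> \<partial>count_space UNIV)
      + t\<^sup>2 * (\<integral>\<kappa>. (dlap \<delta> V \<kappa>)\<^sup>2 * \<rho>' \<kappa> \<partial>count_space UNIV)"
    unfolding h_eq using qi ri ai[OF vi] by (simp add: qI)
  have sh: "Qact (v \<kappa> - t * dlap \<delta> V \<kappa> * \<rho>' \<kappa>) (\<rho>' \<kappa>) = ennreal (h \<kappa>)" and h0: "0 \<le> h \<kappa>" for \<kappa>
    using Qact_shift[OF P2c_nonneg[OF P] Qf, of \<kappa> "t * dlap \<delta> V \<kappa>"] by (simp_all add: h_def q_def)
  have hB: "(\<integral>\<kappa>. h \<kappa> \<partial>count_space UNIV) \<le> B"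
  proof -
    have "2 * t * ((\<integral>\<kappa>. dlap \<delta> V \<kappa> * w \<kappa> \<partial>count_space UNIV) - (\<integral>\<kappa>. dlap \<delta> V \<kappa> * v \<kappa> \<partial>count_space UNIV))
       \<le> 2 * t * (A * (\<omega> t * ((\<phi> + 1 / \<delta>) / 2)))" using t by (intro mult_left_mono diff) auto
    moreover have "2 * t * (A * (\<omega> t * ((\<phi> + 1 / \<delta>) / 2))) = t * A * \<omega> t * (\<phi> + 1 / \<delta>)" by simp
    moreover have "t\<^sup>2 * (\<integral>\<kappa>. (dlap \<delta> V \<kappa>)\<^sup>2 * \<rho>' \<kappa> \<partial>count_space UNIV) \<le> t\<^sup>2 * (A\<^sup>2 / \<delta>)"
      by (intro mult_left_mono rI) simp
    ultimately show ?thesis unfolding hI B_def using \<psi> by (simp add: right_diff_distrib)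
  qed
  have "action_density (\<lambda>\<kappa>. v \<kappa> - t * dlap \<delta> V \<kappa> * \<rho>' \<kappa>) \<rho>' = ennreal (\<integral>\<kappa>. h \<kappa> \<partial>count_space UNIV)"
    unfolding action_density_def sh using h0 by (intro nn_integral_eq_integral hi) simp
  then show "action_density (\<lambda>\<kappa>. bflow \<alpha> (c * \<tau>) w \<kappa> - t * dlap \<delta> V \<kappa> * fflow \<alpha> (c * \<tau>) \<rho> \<kappa>) (fflow \<alpha> (c * \<tau>) \<rho>) \<le> ennreal B"
    using hB by (simp add: v_def \<rho>'_def r_def ennreal_leI)
  have "0 \<le> (\<integral>\<kappa>. h \<kappa> \<partial>count_space UNIV)" using h0 by simp
  then show "0 \<le> B" using hB by linarith
qed

end

section \<open>The evolved curve as a competitor, and the variational inequality\<close>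

context lattice_potential
begin

lemma Dsq_flow_le:
  assumes S: "generated_semigroup \<delta> V S" and reg: "regular_curve \<delta> \<rho> w"
    and total: "ennreal \<delta> * (\<integral>\<^sup>+ s. action_density (w s) (\<rho> s) \<partial>lborel) \<le> ennreal X" and X: "0 \<le> X" and t: "0 \<le> t"
    and \<Lambda>: "0 \<le> \<Lambda>" "\<And>\<kappa>. dlap \<delta> (\<lambda>j. (dlap \<delta> V j)\<^sup>2) \<kappa> / dlap \<delta> V \<kappa> \<le> \<Lambda>"
  shows "Dsq \<delta> (S t (\<rho> 0)) (\<rho> 1) \<le> ennreal (exp (\<Lambda> * t) * X
      + 2 * t * (energy \<delta> V (\<rho> 1) - energy \<delta> V (\<rho> 0)) + t * A * \<omega> t * (X + 1) + t\<^sup>2 * A\<^sup>2)" (is "_ \<le> ennreal ?U")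
    and "0 \<le> exp (\<Lambda> * t) * X
      + 2 * t * (energy \<delta> V (\<rho> 1) - energy \<delta> V (\<rho> 0)) + t * A * \<omega> t * (X + 1) + t\<^sup>2 * A\<^sup>2"
proof -
  interpret C: regular_curve \<delta> \<rho> w by (rule reg)
  define R where "R = c * t"
  have R: "0 \<le> R" using t c_pos by (simp add: R_def)
  define \<sigma> where "\<sigma> s = fflow \<alpha> ((1 - s) * R) (\<rho> s)" for s
  define u where "u s \<kappa> = (if s \<in> {0..1} then bflow \<alpha> ((1 - s) * R) (w s) \<kappa> - t * dlap \<delta> V \<kappa> * \<sigma> s \<kappa> else 0)" for s \<kappa>
  have Sf: "S ((1 - s) * t) (\<rho> s) = \<sigma> s" if s: "s \<in> {0..1}" for s
    using semigroup_eq_fflow[OF S C.P2c[OF s], of "(1 - s) * t"] s t by (simp add: \<sigma>_def R_def mult_ac)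
  \<comment> \<open>The semigroup stays in \<open>P2c\<close> by hypothesis, so mass and moments of
    \<sigma> are inherited through \<open>Sf\<close>.\<close>
  have \<sigma>P: "\<sigma> s \<in> P2c \<delta>" if s: "s \<in> {0..1}" for s
  proof -
    have "0 \<le> (1 - s) * t" using s t by simp
    then have "S ((1 - s) * t) (\<rho> s) \<in> P2c \<delta>" using S C.P2c[OF s] by (simp add: generated_semigroup_def)
    then show ?thesis by (simp add: Sf[OF s])
  qed
  have [measurable]: "(\<lambda>s. \<sigma> s \<kappa>) \<in> borel_measurable borel" for \<kappa>
    unfolding \<sigma>_def by (rule fflow_measurable) (use C.\<rho>_meas in measurable)
  have [measurable]: "(\<lambda>s. bflow \<alpha> ((1 - s) * R) (w s) \<kappa>) \<in> borel_measurable borel" for \<kappa>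
    by (rule bflow_measurable) (use C.w_meas in measurable)
  have [measurable]: "(\<lambda>s. u s \<kappa>) \<in> borel_measurable borel" for \<kappa>
    unfolding u_def by measurable
  define B where "B s = exp (\<Lambda> * t) * C.kin s - 2 * t * (\<integral>\<kappa>. dlap \<delta> V \<kappa> * w s \<kappa> \<partial>count_space UNIV)
      + t * A * \<omega> t * (C.kin s + 1 / \<delta>) + t\<^sup>2 * A\<^sup>2 / \<delta>" for s
  have dens: "action_density (u s) (\<sigma> s) \<le> ennreal (B s)" and B0: "0 \<le> B s" if s: "s \<in> {0..1}" for s
  proof -
    have \<tau>: "0 \<le> (1 - s) * t" "(1 - s) * t \<le> t" using s t by (auto simp: mult_left_le_one_le)
    have e: "c * ((1 - s) * t) = (1 - s) * R" by (simp add: R_def mult_ac)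
    have P: "fflow \<alpha> (c * ((1 - s) * t)) (\<rho> s) \<in> P2c \<delta>" using \<sigma>P[OF s] by (simp add: e \<sigma>_def)
    have us: "u s = (\<lambda>\<kappa>. bflow \<alpha> ((1 - s) * R) (w s) \<kappa> - t * dlap \<delta> V \<kappa> * fflow \<alpha> ((1 - s) * R) (\<rho> s) \<kappa>)"
      using s by (simp add: u_def fun_eq_iff \<sigma>_def)
    note f = action_density_flow[OF C.P2c[OF s] P C.fin \<tau> \<Lambda>]
    show "action_density (u s) (\<sigma> s) \<le> ennreal (B s)"
      using f(1) unfolding e us \<sigma>_def B_def C.kin_def .
    show "0 \<le> B s" using f(2) unfolding B_def C.kin_def .
  qed
  have tot: "(\<integral>\<^sup>+ s. action_density (w s) (\<rho> s) \<partial>lborel) < top"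
    using le_less_trans[OF total ennreal_less_top] \<delta> by (auto simp: ennreal_mult_less_top)
  have ab: "\<bar>dlap \<delta> V \<kappa>\<bar> \<le> A" for \<kappa> using lap_pos[of \<kappa>] lap_le[of \<kappa>] by simp
  note kin = C.kin_integrable[OF tot] and EI = C.energy_identity[OF tot ab]
  have on01: "set_integrable lborel {0..1} f" if "integrable lborel f" for f :: "real \<Rightarrow> real"
    using that unfolding set_integrable_def by (intro integrable_mult_indicator) auto
  have const: "set_integrable lborel {0..1} (\<lambda>s::real. k)" for k :: real
    by (intro borel_integrable_atLeastAtMost' continuous_intros)
  define J where "J s = (\<integral>\<kappa>. dlap \<delta> V \<kappa> * w s \<kappa> \<partial>count_space UNIV)" for s
  have B_eq: "B = (\<lambda>s. (exp (\<Lambda> * t) + t * A * \<omega> t) * C.kin s + (- 2 * t) * J s + (t * A * \<omega> t / \<delta> + t\<^sup>2 * A\<^sup>2 / \<delta>))"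
    by (simp add: B_def[abs_def] J_def[abs_def] algebra_simps)
  have Ji: "integrable lborel J" using EI(1) by (simp add: J_def[abs_def])
  have Bi: "set_integrable lborel {0..1} B"
    unfolding B_eq by (intro set_integral_add on01 const integrable_mult_right kin Ji)
  define K where "K = (\<integral>s. C.kin s \<partial>lborel)"
  have KX: "\<delta> * K \<le> X"
  proof -
    have "ennreal K = (\<integral>\<^sup>+ s. action_density (w s) (\<rho> s) \<partial>lborel)"
      unfolding K_def C.ennreal_kin[symmetric] using C.kin_nonneg by (intro nn_integral_eq_integral[symmetric] kin) auto
    then have "ennreal (\<delta> * K) \<le> ennreal X" using total \<delta> by (simp add: ennreal_mult')
    then show ?thesis using X by simp
  qed
  have full: "(LINT s:{0..1}|lborel. f s) = (\<integral>s. f s \<partial>lborel)" if "\<And>s. s \<notin> {0..1} \<Longrightarrow> f s = 0" for f :: "real \<Rightarrow> real"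
    unfolding set_lebesgue_integral_def
  proof (intro Bochner_Integration.integral_cong refl)
    show "indicator {0..1} s *\<^sub>R f s = f s" for s using that by (cases "s \<in> {0..1}") auto
  qed
  have BI: "\<delta> * (LINT s:{0..1}|lborel. B s) = (exp (\<Lambda> * t) + t * A * \<omega> t) * (\<delta> * K)
      - 2 * t * (energy \<delta> V (\<rho> 0) - energy \<delta> V (\<rho> 1)) + t * A * \<omega> t + t\<^sup>2 * A\<^sup>2"
  proof -
    have "(LINT s:{0..1}|lborel. B s) = (exp (\<Lambda> * t) + t * A * \<omega> t) * (LINT s:{0..1}|lborel. C.kin s)
        + (- 2 * t) * (LINT s:{0..1}|lborel. J s) + (t * A * \<omega> t / \<delta> + t\<^sup>2 * A\<^sup>2 / \<delta>)"
    proof -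
      note i1 = on01[OF integrable_mult_right[OF kin], of "exp (\<Lambda> * t) + t * A * \<omega> t"]
        and i2 = on01[OF integrable_mult_right[OF Ji], of "- 2 * t"]
      have "(LINT s:{0..1}|lborel. B s) = (LINT s:{0..1}|lborel. (exp (\<Lambda> * t) + t * A * \<omega> t) * C.kin s)
        + (LINT s:{0..1}|lborel. (- 2 * t) * J s) + (LINT s:{0..1::real}|lborel. (t * A * \<omega> t / \<delta> + t\<^sup>2 * A\<^sup>2 / \<delta>))"
        unfolding B_eq set_integral_add(2)[OF set_integral_add(1)[OF i1 i2] const] set_integral_add(2)[OF i1 i2] ..
      also have "(LINT s:{0..1::real}|lborel. (t * A * \<omega> t / \<delta> + t\<^sup>2 * A\<^sup>2 / \<delta>)) = (t * A * \<omega> t / \<delta> + t\<^sup>2 * A\<^sup>2 / \<delta>)"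
        by (simp add: set_lebesgue_integral_def)
      finally show ?thesis unfolding set_integral_mult_right .
    qed
    also have "(LINT s:{0..1}|lborel. C.kin s) = K" unfolding K_def by (rule full[OF C.kin_outside])
    also have "(LINT s:{0..1}|lborel. J s) = (\<integral>s. J s \<partial>lborel)" by (rule full) (simp add: J_def C.outside)
    finally have e: "(LINT s:{0..1}|lborel. B s) = (exp (\<Lambda> * t) + t * A * \<omega> t) * K
        + (- 2 * t) * (\<integral>s. J s \<partial>lborel) + (t * A * \<omega> t / \<delta> + t\<^sup>2 * A\<^sup>2 / \<delta>)" .
    have "\<delta> * (p * K + (- 2 * t) * i + (y / \<delta> + z / \<delta>)) = p * (\<delta> * K) - 2 * t * (\<delta> * i) + y + z" for p i y z
      using \<delta> by (simp add: field_simps)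
    then show ?thesis unfolding e EI(2) J_def .
  qed
  have sq: "(u s \<kappa>)\<^sup>2 \<le> B s / \<delta>" if s: "s \<in> {0..1}" for s \<kappa>
  proof -
    have f: "action_density (u s) (\<sigma> s) < top" by (rule le_less_trans[OF dens[OF s]]) simp
    have "enn2real (action_density (u s) (\<sigma> s)) \<le> B s"
      using enn2real_mono[OF dens[OF s]] B0[OF s] by simp
    then have "1 / \<delta> * enn2real (action_density (u s) (\<sigma> s)) \<le> 1 / \<delta> * B s"
      using \<delta> by (intro mult_left_mono) auto
    then show ?thesis using action_density_square_le[OF \<sigma>P[OF s] \<delta> f, of \<kappa>] by simp
  qed
  \<comment> \<open>Square integrability of the new derivative, as \<open>H1_01\<close> demands: the
    flux is bounded by \<open>sqrt (B s / \<delta>)\<close> at all sites.\<close>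
  have dsq: "(dlap \<delta> (u s) \<kappa>)\<^sup>2 \<le> (4 / \<delta>\<^sup>2)\<^sup>2 * (B s / \<delta>)" if s: "s \<in> {0..1}" for s \<kappa>
  proof -
    have "\<bar>u s \<kappa>\<bar> \<le> sqrt (B s / \<delta>)" for \<kappa> using real_sqrt_le_mono[OF sq[OF s, of \<kappa>]] by simp
    from dlap_bound[of "u s", OF this] have "\<bar>dlap \<delta> (u s) \<kappa>\<bar>\<^sup>2 \<le> (4 * sqrt (B s / \<delta>) / \<delta>\<^sup>2)\<^sup>2"
      by (intro power_mono) auto
    also have "\<dots> = (4 / \<delta>\<^sup>2)\<^sup>2 * (B s / \<delta>)"
      using B0[OF s] \<delta> by (simp add: power_mult_distrib power_divide)
    finally show ?thesis by simp
  qed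
  have wder: "weak_deriv_01 (\<lambda>s. \<sigma> s \<kappa>) (\<lambda>s. dlap \<delta> (u s) \<kappa>)" for \<kappa>
  proof -
    have wb: "\<bar>w s \<kappa>\<bar> \<le> 1 + C.kin s / \<delta>" for s \<kappa> by (rule abs_le_1_plus_square[OF C.w_square_le])
    have "weak_deriv_01 (\<lambda>s. fflow \<alpha> ((1 - s) * R) (\<rho> s) \<kappa>)
       (\<lambda>s. fflow \<alpha> ((1 - s) * R) (\<lambda>j. dlap \<delta> (w s) j - R * (fstep \<alpha> (\<rho> s) j - \<rho> s j)) \<kappa>)"
    proof (rule weak_deriv_fflow[OF C.wd P2c_le[OF C.P2c \<delta>] dlap_bound[OF wb] _ R])
      have "set_integrable lborel {0..1} (\<lambda>s. 4 / \<delta>\<^sup>2 + (4 / \<delta>\<^sup>2 / \<delta>) * C.kin s)"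
        by (intro set_integral_add on01 const integrable_mult_right kin)
      then show "set_integrable lborel {0..1} (\<lambda>s. 4 * (1 + C.kin s / \<delta>) / \<delta>\<^sup>2)"
        by (simp add: algebra_simps add_divide_distrib)
    qed
    then show ?thesis
    proof (rule weak_deriv_cong)
      show "AE s in lborel. s \<in> {0..1} \<longrightarrow> fflow \<alpha> ((1 - s) * R) (\<lambda>j. dlap \<delta> (w s) j - R * (fstep \<alpha> (\<rho> s) j - \<rho> s j)) \<kappa> = dlap \<delta> (u s) \<kappa>"
      proof (rule AE_I2, rule impI)
        fix s :: real assume s: "s \<in> {0..1}"
        have r: "0 \<le> (1 - s) * R" using s R by simp
        have \<alpha>V: "dlap \<delta> V j = A * \<alpha> j" for j using A by (simp add: \<alpha>_def)
        \<comment> \<open>The source is itself a Laplacian, since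
          \<open>R (fstep \<rho> - \<rho>) = t \<Delta> (a \<rho>)\<close>; hence the derivative is
          the forward flow of \<open>dlap \<delta> y\<close>. Then \<open>dlap_bflow\<close> pulls
          the Laplacian out and \<open>bflow_diff_mult\<close> recognizes \<open>u\<close>.\<close>
        define y where "y = (\<lambda>j. w s j - (t * A) * \<alpha> j * \<rho> s j)"
        have "dlap \<delta> (w s) j - R * (fstep \<alpha> (\<rho> s) j - \<rho> s j) = dlap \<delta> y j" for j
        proof -
          have "R * (fstep \<alpha> (\<rho> s) j - \<rho> s j) = t * dlap \<delta> (\<lambda>j. \<rho> s j * (A * \<alpha> j)) j"
            using generator[of "\<rho> s" j] by (simp add: R_def mult_ac \<alpha>V)
          also have "dlap \<delta> (w s) j - \<dots> = dlap \<delta> y j"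
            by (simp add: y_def dlap_def diff_divide_distrib[symmetric] algebra_simps)
          finally show ?thesis .
        qed
        then have "fflow \<alpha> ((1 - s) * R) (\<lambda>j. dlap \<delta> (w s) j - R * (fstep \<alpha> (\<rho> s) j - \<rho> s j)) \<kappa>
          = fflow \<alpha> ((1 - s) * R) (dlap \<delta> y) \<kappa>" by simp
        also have "\<dots> = dlap \<delta> (bflow \<alpha> ((1 - s) * R) y) \<kappa>"
        proof (rule dlap_bflow[OF r, symmetric])
          show "\<bar>y j\<bar> \<le> (1 + C.kin s / \<delta>) + t * A * 1 * (1 / \<delta>)" for j
          proof -
            have "\<bar>(t * A) * \<alpha> j * \<rho> s j\<bar> \<le> t * A * 1 * (1 / \<delta>)"
              unfolding abs_mult using P2c_le[OF C.P2c[OF s] \<delta>, of j] t A pos[of j] le1[of j]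
              by (intro mult_mono) auto
            then show ?thesis using wb[of s j] unfolding y_def by linarith
          qed
        qed
        also have "bflow \<alpha> ((1 - s) * R) y = u s"
          unfolding y_def using s bflow_diff_mult[where w = "w s" and f = "\<rho> s" and k = "t * A", OF r wb P2c_le[OF C.P2c[OF s] \<delta>]]
          by (simp add: fun_eq_iff u_def \<sigma>_def \<alpha>V mult.assoc)
        finally show "fflow \<alpha> ((1 - s) * R) (\<lambda>j. dlap \<delta> (w s) j - R * (fstep \<alpha> (\<rho> s) j - \<rho> s j)) \<kappa> = dlap \<delta> (u s) \<kappa>" .
      qed
      show "set_borel_measurable lborel {0..1} (\<lambda>s. dlap \<delta> (u s) \<kappa>)"
        unfolding set_borel_measurable_def by measurable
    qed (simp add: \<sigma>_def)
  qed
  have "(\<sigma>, u) \<in> adm_curves \<delta> (S t (\<rho> 0)) (\<rho> 1)"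
  proof -
    have "(\<lambda>\<kappa>. (u s \<kappa>)\<^sup>2) summable_on UNIV" if s: "s \<in> {0..1}" for s
      by (rule action_density_summable_square[OF \<sigma>P[OF s] \<delta> le_less_trans[OF dens[OF s]]]) simp
    moreover have "\<sigma> 0 = S t (\<rho> 0)" using Sf[of 0] by simp
    \<comment> \<open>The evolution time is 0 at \<open>s = 1\<close>.\<close>
    moreover have "\<sigma> 1 = \<rho> 1" by (simp add: \<sigma>_def)
    moreover have B\<delta>: "set_integrable lborel {0..1} (\<lambda>s. B s / \<delta>)" using Bi by simp
    then have "L2_01 (\<lambda>s. u s \<kappa>)" for \<kappa>
      by (intro L2_01_bounded[where G = "\<lambda>s. B s / \<delta>"]) (auto intro: sq)
    moreover have "L2_01 (\<lambda>s. dlap \<delta> (u s) \<kappa>)" for \<kappa>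
      using B\<delta> by (intro L2_01_bounded[where G = "\<lambda>s. (4 / \<delta>\<^sup>2)\<^sup>2 * (B s / \<delta>)", OF _ dsq] set_integrable_mult_right) measurable
    then have "H1_01 (\<lambda>s. \<sigma> s \<kappa>)" for \<kappa> unfolding H1_01_def using wder by blast
    ultimately show ?thesis using \<sigma>P wder unfolding adm_curves_def by simp
  qed
  then have "Dsq \<delta> (S t (\<rho> 0)) (\<rho> 1) \<le> action \<delta> \<sigma> u"
    unfolding Dsq_def by (rule INF_lower2) simp
  also have "action \<delta> \<sigma> u = ennreal \<delta> * (\<integral>\<^sup>+ s. action_density (u s) (\<sigma> s) * indicator {0..1} s \<partial>lborel)"
  proof -
    have "(\<integral>\<^sup>+ s. (\<integral>\<^sup>+ \<kappa>. Qact (u s \<kappa>) (\<sigma> s \<kappa>) * indicator {0..1} s \<partial>count_space UNIV) \<partial>lborel)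
       = (\<integral>\<^sup>+ \<kappa>. (\<integral>\<^sup>+ s. Qact (u s \<kappa>) (\<sigma> s \<kappa>) * indicator {0..1} s \<partial>lborel) \<partial>count_space UNIV)"
      by (rule nn_integral_int_swap) measurable
    then show ?thesis by (simp add: action_def action_density_def nn_integral_multc)
  qed
  also have "\<dots> \<le> ennreal \<delta> * (\<integral>\<^sup>+ s. ennreal (indicator {0..1} s *\<^sub>R B s) \<partial>lborel)"
    by (intro mult_left_mono nn_integral_mono) (auto simp: indicator_def intro: dens)
  also have "\<dots> = ennreal \<delta> * ennreal (LINT s:{0..1}|lborel. B s)"
    unfolding set_lebesgue_integral_def
    using Bi B0 by (subst nn_integral_eq_integral) (auto simp: set_integrable_def indicator_def)
  also have "\<dots> = ennreal (\<delta> * (LINT s:{0..1}|lborel. B s))"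
    using \<delta> by (simp add: ennreal_mult')
  finally have D: "Dsq \<delta> (S t (\<rho> 0)) (\<rho> 1) \<le> ennreal (\<delta> * (LINT s:{0..1}|lborel. B s))" .
  have "(exp (\<Lambda> * t) + t * A * \<omega> t) * (\<delta> * K) \<le> (exp (\<Lambda> * t) + t * A * \<omega> t) * X"
    using KX t A \<omega>_nonneg[OF t] by (intro mult_left_mono add_nonneg_nonneg mult_nonneg_nonneg) auto
  then have U: "\<delta> * (LINT s:{0..1}|lborel. B s) \<le> ?U"
    unfolding BI by (simp add: algebra_simps)
  show "Dsq \<delta> (S t (\<rho> 0)) (\<rho> 1) \<le> ennreal ?U" by (rule order_trans[OF D ennreal_leI[OF U]])
  have "0 \<le> indicator {0..1} s *\<^sub>R B s" for s by (cases "s \<in> {0..1}") (simp_all add: B0)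
  then have "0 \<le> (LINT s:{0..1}|lborel. B s)"
    unfolding set_lebesgue_integral_def by (rule Bochner_Integration.integral_nonneg)
  then show "0 \<le> ?U" using U \<delta> by (intro order_trans[OF _ U]) simp
qed

text \<open>For each \<open>t\<close> the competitor is built from a curve whose action exceeds the
  squared distance by less than \<open>t\<^sup>2\<close>, an excess that vanishes after division by
  \<open>2 * t\<close>. The bound \<open>h\<close> of the difference quotient tends to
  \<open>\<Lambda> * d / 2\<close> plus the energy difference, and the contraction term cancels the
  first part.\<close>

lemma flow_EVI:
  assumes S: "generated_semigroup \<delta> V S" and \<rho>: "\<rho> \<in> P2c \<delta>" and \<eta>: "\<eta> \<in> P2c \<delta>"
    and fin: "Dsq \<delta> \<rho> \<eta> < top"
    and \<Lambda>: "0 \<le> \<Lambda>" "\<And>\<kappa>. dlap \<delta> (\<lambda>j. (dlap \<delta> V j)\<^sup>2) \<kappa> / dlap \<delta> V \<kappa> \<le> \<Lambda>"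
  shows "Limsup (at_right 0) (\<lambda>t. (enn2ereal (Dsq \<delta> (S t \<rho>) \<eta>) - enn2ereal (Dsq \<delta> \<rho> \<eta>)) / ereal (2 * t))
      + ereal (- \<Lambda> / 2 * enn2real (Dsq \<delta> \<rho> \<eta>)) \<le> ereal (energy \<delta> V \<eta> - energy \<delta> V \<rho>)"
proof -
  define d where "d = enn2real (Dsq \<delta> \<rho> \<eta>)"
  have d: "0 \<le> d" "Dsq \<delta> \<rho> \<eta> = ennreal d" using fin by (simp_all add: d_def)
  define E where "E = energy \<delta> V \<eta> - energy \<delta> V \<rho>"
  define U where "U t = exp (\<Lambda> * t) * (d + t\<^sup>2) + 2 * t * E + t * A * \<omega> t * (d + t\<^sup>2 + 1) + t\<^sup>2 * A\<^sup>2" for t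
  define h where "h t = d / 2 * ((exp (\<Lambda> * t) - 1) / t) + exp (\<Lambda> * t) * t / 2 + E
      + A / 2 * \<omega> t * (d + t\<^sup>2 + 1) + t * A\<^sup>2 / 2" for t
  have DU: "Dsq \<delta> (S t \<rho>) \<eta> \<le> ennreal (U t)" and U0: "0 \<le> U t" if t: "0 < t" for t
  proof -
    have "Dsq \<delta> \<rho> \<eta> < ennreal (d + t\<^sup>2)"
      unfolding d(2) using d(1) t by (subst ennreal_less_iff) auto
    then obtain r w where adm: "(r, w) \<in> adm_curves \<delta> \<rho> \<eta>" and act: "action \<delta> r w < ennreal (d + t\<^sup>2)"
      unfolding Dsq_def INF_less_iff by auto
    have "action \<delta> r w < top" using act by (rule less_trans) simp
    then obtain r' w' where reg: "regular_curve \<delta> r' w'" and e: "r' 0 = \<rho>" "r' 1 = \<eta>"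
      and le: "ennreal \<delta> * (\<integral>\<^sup>+ s. action_density (w' s) (r' s) \<partial>lborel) \<le> action \<delta> r w"
      by (rule admissible_regularize[OF adm \<delta>])
    have "0 \<le> d + t\<^sup>2" using d(1) by simp
    note f = Dsq_flow_le[OF S reg order_trans[OF le less_imp_le[OF act]] this less_imp_le[OF t] \<Lambda>]
    show "Dsq \<delta> (S t \<rho>) \<eta> \<le> ennreal (U t)" using f(1) unfolding e U_def E_def .
    show "0 \<le> U t" using f(2) unfolding e U_def E_def .
  qed
  have le_h: "(enn2ereal (Dsq \<delta> (S t \<rho>) \<eta>) - enn2ereal (Dsq \<delta> \<rho> \<eta>)) / ereal (2 * t) \<le> ereal (h t)" if t: "0 < t" for t
  proof -
    have "Dsq \<delta> (S t \<rho>) \<eta> < top" by (rule le_less_trans[OF DU[OF t]]) simp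
    then obtain x where x: "0 \<le> x" "Dsq \<delta> (S t \<rho>) \<eta> = ennreal x"
      by (cases "Dsq \<delta> (S t \<rho>) \<eta>") auto
    have "x \<le> U t" using DU[OF t] U0[OF t] by (simp add: x)
    then have "(x - d) / (2 * t) \<le> (U t - d) / (2 * t)" using t by (intro divide_right_mono) auto
    also have "(U t - d) / (2 * t) = h t"
      using t by (simp add: U_def h_def field_simps power2_eq_square)
    finally show ?thesis using t by (simp add: x d enn2ereal_ennreal)
  qed
  have "(h \<longlongrightarrow> d / 2 * \<Lambda> + exp (\<Lambda> * 0) * 0 / 2 + E + A / 2 * 0 * (d + 0\<^sup>2 + 1) + 0 * A\<^sup>2 / 2) (at_right 0)"
  proof -
    \<comment> \<open>The quotient of the exponential tends to its derivative at 0, the source of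
      the coefficient \<open>\<Lambda> / 2\<close>.\<close>
    have "((\<lambda>t. exp (\<Lambda> * t)) has_real_derivative \<Lambda>) (at 0)" by (auto intro!: derivative_eq_intros)
    then have "((\<lambda>t. (exp (\<Lambda> * t) - 1) / t) \<longlongrightarrow> \<Lambda>) (at 0)" by (simp add: DERIV_def)
    then have "((\<lambda>t. (exp (\<Lambda> * t) - 1) / t) \<longlongrightarrow> \<Lambda>) (at_right 0)" by (rule tendsto_mono[OF at_le[OF subset_UNIV]])
    moreover have "(\<omega> \<longlongrightarrow> exp (c * 0) + 1 - 2 * exp (- (c * 0))) (at_right 0)"
      unfolding \<omega>_def[abs_def] by (intro tendsto_intros)
    then have "(\<omega> \<longlongrightarrow> 0) (at_right 0)" by simp
    ultimately show ?thesis unfolding h_def[abs_def] by (intro tendsto_intros) auto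
  qed
  then have "((\<lambda>t. ereal (h t)) \<longlongrightarrow> ereal (d / 2 * \<Lambda> + E)) (at_right 0)" by (intro tendsto_ereal) simp
  then have lim: "Limsup (at_right 0) (\<lambda>t. ereal (h t)) = ereal (d / 2 * \<Lambda> + E)"
    by (intro lim_imp_Limsup trivial_limit_at_right_real)
  have "Limsup (at_right 0) (\<lambda>t. (enn2ereal (Dsq \<delta> (S t \<rho>) \<eta>) - enn2ereal (Dsq \<delta> \<rho> \<eta>)) / ereal (2 * t)) \<le> ereal (d / 2 * \<Lambda> + E)"
    unfolding lim[symmetric]
    by (rule Limsup_mono) (use le_h in \<open>auto intro: eventually_mono[OF eventually_at_right_less]\<close>)
  from add_right_mono[OF this, of "ereal (- \<Lambda> / 2 * d)"]
  show ?thesis by (simp add: d_def[symmetric] E_def[symmetric])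
qed

end

text \<open>The slopes decrease strictly, so they cannot all vanish, while a nonzero slope drives
  \<open>b\<close> below zero along its tangent line: to the right if it is negative, to the left if
  it is positive.\<close>

lemma concave_int_nonneg_False:
  fixes b :: "int \<Rightarrow> real"
  assumes nn: "\<And>\<kappa>. 0 \<le> b \<kappa>" and cc: "\<And>\<kappa>. b (\<kappa> + 1) + b (\<kappa> - 1) - 2 * b \<kappa> < 0"
  shows False
proof -
  define D where "D \<kappa> = b (\<kappa> + 1) - b \<kappa>" for \<kappa>
  have dec: "D \<kappa> < D (\<kappa> - 1)" for \<kappa> using cc[of \<kappa>] by (simp add: D_def)
  have Dp: "D (\<kappa> + int n) \<le> D \<kappa>" for \<kappa> n
  proof (induction n)
    case (Suc n)
    then show ?case using dec[of "\<kappa> + int (Suc n)"] by (simp add: algebra_simps)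
  qed simp
  have Dm: "D \<kappa> \<le> D (\<kappa> - int n)" for \<kappa> n
  proof (induction n)
    case (Suc n)
    then show ?case using dec[of "\<kappa> - int n"] by (simp add: algebra_simps)
  qed simp
  have up: "b (\<kappa> + int n) \<le> b \<kappa> + real n * D \<kappa>" for \<kappa> n
  proof (induction n)
    case (Suc n)
    then show ?case using Dp[of \<kappa> n] D_def[of "\<kappa> + int n"] by (simp add: algebra_simps)
  qed simp
  have down: "b (\<kappa> - int n) \<le> b \<kappa> - real n * D \<kappa>" for \<kappa> n
  proof (induction n)
    case (Suc n)
    then show ?case using Dm[of \<kappa> "Suc n"] D_def[of "\<kappa> - int (Suc n)"] by (simp add: algebra_simps)
  qed simp
  have "D \<kappa> = 0" for \<kappa>
  proof (rule ccontr)
    assume "D \<kappa> \<noteq> 0"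
    then obtain n where n: "b \<kappa> < real n * \<bar>D \<kappa>\<bar>" using reals_Archimedean3[of "\<bar>D \<kappa>\<bar>"] by auto
    show False
      using n up[of \<kappa> n] down[of \<kappa> n] nn[of "\<kappa> + int n"] nn[of "\<kappa> - int n"] by (cases "D \<kappa> \<ge> 0") auto
  qed
  then show False using dec[of 0] by simp
qed

theorem theorem1p3:
  fixes \<delta> :: real and V :: "int \<Rightarrow> real"
    and S :: "real \<Rightarrow> (int \<Rightarrow> real) \<Rightarrow> (int \<Rightarrow> real)"
  assumes "\<delta> > 0"
    and "\<forall>\<kappa>. dlap \<delta> V \<kappa> > 0"
    and "bounded (range (dlap \<delta> V))"
    and "bdd_above (range (\<lambda>\<kappa>. dlap \<delta> (\<lambda>j. (dlap \<delta> V j)\<^sup>2) \<kappa> / dlap \<delta> V \<kappa>))"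
    and "\<Lambda> = (SUP \<kappa>. dlap \<delta> (\<lambda>j. (dlap \<delta> V j)\<^sup>2) \<kappa> / dlap \<delta> V \<kappa>)"
    and "generated_semigroup \<delta> V S"
  shows "lambda_contractive \<delta> (- \<Lambda>) (energy \<delta> V) S"
proof -
  let ?R = "\<lambda>\<kappa>. dlap \<delta> (\<lambda>j. (dlap \<delta> V j)\<^sup>2) \<kappa> / dlap \<delta> V \<kappa>"
  obtain A where "\<And>\<kappa>. \<bar>dlap \<delta> V \<kappa>\<bar> \<le> A"
    using assms(3) by (auto simp: bounded_iff)
  then have A: "\<And>\<kappa>. dlap \<delta> V \<kappa> \<le> A" by (meson abs_ge_self order_trans)
  then have "0 < A" using assms(2) by (meson less_le_trans)
  \<comment> \<open>\<open>A\<close> may be any upper bound of the Laplacian, from which it inherits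
    positivity; the choice does not enter the final inequality.\<close>
  then interpret lattice_potential \<delta> A V "\<lambda>\<kappa>. dlap \<delta> V \<kappa> / A" "2 * A / \<delta>\<^sup>2"
    using assms(1,2) A by unfold_locales auto
  have R: "?R \<kappa> \<le> \<Lambda>" for \<kappa>
    unfolding assms(5) using assms(4) by (intro cSUP_upper) auto
  have "0 \<le> \<Lambda>"
  proof (rule ccontr)
    assume "\<not> 0 \<le> \<Lambda>"
    then have neg: "?R \<kappa> < 0" for \<kappa> using R[of \<kappa>] by linarith
    show False
    proof (rule concave_int_nonneg_False[of "\<lambda>j. (dlap \<delta> V j)\<^sup>2"])
      fix \<kappa>
      have "dlap \<delta> (\<lambda>j. (dlap \<delta> V j)\<^sup>2) \<kappa> < 0"
        using neg[of \<kappa>] lap_pos[of \<kappa>] by (simp add: divide_less_0_iff)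
      then show "(dlap \<delta> V (\<kappa> + 1))\<^sup>2 + (dlap \<delta> V (\<kappa> - 1))\<^sup>2 - 2 * (dlap \<delta> V \<kappa>)\<^sup>2 < 0"
        unfolding dlap_def[of \<delta> "\<lambda>j. (dlap \<delta> V j)\<^sup>2"] by (simp add: divide_less_0_iff)
    qed simp
  qed
  then show ?thesis
    unfolding lambda_contractive_def using flow_EVI[OF assms(6) _ _ _ _ R] by blast
qed

end
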